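(* Let $\Omega=\mathbb{T}^d=\mathbb{R}^d/\mathbb{Z}^d$, let $g\in C^2(\Omega)$ and $\phi,\psi\in C^1(\Omega)$ with $\phi<\psi$ and $\phi\le g\le\psi$ in $\Omega$. For $\varepsilon\in(0,1)$ let $u_\varepsilon$ be the unique classical solution of problem $(P_\varepsilon)$ (see context). Then, as $\varepsilon\to0$, $u_\varepsilon\to u$ locally uniformly in $\Omega\times[0,\infty)$, where $u$ is the unique viscosity solution (see context) of the level set mean curvature flow with obstacles $\phi$ and $\psi$ satisfying $u(\cdot,0)=g$.
   Context: Summation over repeated indices is used. Functions on $\Omega=\mathbb{T}^d$ are identified with $\mathbb{Z}^d$-periodic functions on $\mathbb{R}^d$. For $p\in\mathbb{R}^d$, $|p|_\varepsilon=\sqrt{\varepsilon^2+|p|^2}$. Put $V_\varepsilon(s)=V_\varepsilon(x,s)=\frac1\varepsilon(\phi(x)-s)_+^4+\frac1\varepsilon(s-\psi(x))_+^4$ and let $V_\varepsilon'$ denote the derivative in $s$. Problem $(P_\varepsilon)$: $$\partial_t u_\varepsilon=\Big(\delta_{ij}-\frac{\partial_{x_i}u_\varepsilon\,\partial_{x_j}u_\varepsilon}{|\nabla u_\varepsilon|_\varepsilon^2}\Big)\partial_{x_ix_j}u_\varepsilon-|\nabla u_\varepsilon|_\varepsilon V_\varepsilon'(u_\varepsilon)\ \text{ in }\Omega\times(0,\infty),\qquad u_\varepsilon(\cdot,0)=g.$$ Viscosity solutions of the level set mean curvature flow with obstacles $\phi,\psi$. A function $u\in C(\Omega\times[0,\infty))\cap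 L^\infty(\Omega\times[0,\infty))$ is a viscosity subsolution if (i) $\phi(x)\le u(x,t)\le\psi(x)$ for all $x\in\Omega$, $t\ge0$; and (ii) for the periodically extended $u$ and every $\eta\in C^\infty(\mathbb{R}^{d+1})$, whenever $u-\eta$ has a local maximum at $(x_0,t_0)\in\mathbb{R}^d\times(0,\infty)$ and $u(x_0,t_0)>\phi(x_0)$, then at $(x_0,t_0)$: $\partial_t\eta\le\big(\delta_{ij}-\frac{\partial_{x_i}\eta\,\partial_{x_j}\eta}{|\nabla\eta|^2}\big)\partial_{x_ix_j}\eta$ if $\nabla\eta(x_0,t_0)\ne0$, and $\partial_t\eta\le(\delta_{ij}-\zeta_i\zeta_j)\partial_{x_ix_j}\eta$ for some $\zeta\in\mathbb{R}^d$ with $|\zeta|\le1$ if $\nabla\eta(x_0,t_0)=0$. It is a viscosity supersolution if (i) holds and (ii) holds with "local maximum" replaced by "local minimum", "$u(x_0,t_0)>\phi(x_0)$" replaced by "$u(x_0,t_0)<\psi(x_0)$", and "$\le$" replaced by "$\ge$" in the two differential inequalities. It is a viscosity solution if it is both a viscosity subsolution and a viscosity supersolution. *)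

theory Defs
  imports "HOL-Analysis.Analysis"
begin

text \<open>
  Functions on the torus are \<open>\<int>\<^sup>n\<close>-periodic functions on \<^typ>\<open>real ^ 'n\<close>. Space-time functions have
  domain \<^typ>\<open>(real ^ 'n) \<times> real\<close>; for functions on the torus times \<open>[0,\<infinity>)\<close> only the values at
  times \<open>t \<ge> 0\<close> are meaningful, and the predicates below ignore all others.
\<close>

definition periodic :: "(real ^ 'n \<Rightarrow> real) \<Rightarrow> bool" where
  "periodic f \<longleftrightarrow> (\<forall>x k. (\<forall>i. k $ i \<in> \<int>) \<longrightarrow> f (x + k) = f x)"

primrec C_k :: "nat \<Rightarrow> ('a::euclidean_space \<Rightarrow> real) \<Rightarrow> bool" where
  "C_k 0 f \<longleftrightarrow> continuous_on UNIV f"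
| "C_k (Suc k) f \<longleftrightarrow>
     (\<forall>x. f differentiable (at x)) \<and> (\<forall>b\<in>Basis. C_k k (\<lambda>x. frechet_derivative f (at x) b))"

definition smooth :: "('a::euclidean_space \<Rightarrow> real) \<Rightarrow> bool" where
  "smooth f \<longleftrightarrow> (\<forall>k. C_k k f)"

definition dx :: "'n \<Rightarrow> ((real ^ 'n) \<times> real \<Rightarrow> real) \<Rightarrow> (real ^ 'n) \<times> real \<Rightarrow> real" where
  "dx i f z = frechet_derivative (\<lambda>y. f (y, snd z)) (at (fst z)) (axis i 1)"

definition dt :: "((real ^ 'n) \<times> real \<Rightarrow> real) \<Rightarrow> (real ^ 'n) \<times> real \<Rightarrow> real" where
  "dt f z = deriv (\<lambda>s. f (fst z, s)) (snd z)"

definition grad :: "((real ^ 'n) \<times> real \<Rightarrow> real) \<Rightarrow> (real ^ 'n) \<times> real \<Rightarrow> real ^ 'n" where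
  "grad f z = (\<chi> i. dx i f z)"

definition kron :: "'n \<Rightarrow> 'n \<Rightarrow> real" where
  "kron i j = (if i = j then 1 else 0)"

definition contract_hessian ::
  "('n::finite \<Rightarrow> 'n \<Rightarrow> real) \<Rightarrow> ((real ^ 'n) \<times> real \<Rightarrow> real) \<Rightarrow> (real ^ 'n) \<times> real \<Rightarrow> real" where
  "contract_hessian A f z = (\<Sum>i\<in>UNIV. \<Sum>j\<in>UNIV. A i j * dx i (dx j f) z)"

definition norm_eps :: "real \<Rightarrow> real ^ 'n \<Rightarrow> real" where
  "norm_eps \<epsilon> p = sqrt (\<epsilon>\<^sup>2 + (norm p)\<^sup>2)"

definition V ::
  "real \<Rightarrow> (real ^ 'n \<Rightarrow> real) \<Rightarrow> (real ^ 'n \<Rightarrow> real) \<Rightarrow> real ^ 'n \<Rightarrow> real \<Rightarrow> real" where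
  "V \<epsilon> \<phi> \<psi> x s = 1 / \<epsilon> * (max (\<phi> x - s) 0) ^ 4 + 1 / \<epsilon> * (max (s - \<psi> x) 0) ^ 4"

text \<open>Regularity \<open>C\<^sup>2\<^sup>,\<^sup>1\<close> (two space derivatives, one time derivative) at positive times.\<close>

definition C21 :: "((real ^ 'n) \<times> real \<Rightarrow> real) \<Rightarrow> bool" where
  "C21 u \<longleftrightarrow>
     (\<forall>x. \<forall>t>0. (\<lambda>y. u (y, t)) differentiable (at x) \<and>
        (\<forall>i. (\<lambda>y. dx i u (y, t)) differentiable (at x)) \<and>
        (\<lambda>s. u (x, s)) differentiable (at t)) \<and>
     continuous_on (UNIV \<times> {0<..}) u \<and>
     continuous_on (UNIV \<times> {0<..}) (dt u) \<and>
     (\<forall>i. continuous_on (UNIV \<times> {0<..}) (dx i u)) \<and>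
     (\<forall>i j. continuous_on (UNIV \<times> {0<..}) (dx i (dx j u)))"

definition classical_solution ::
  "real \<Rightarrow> (real ^ 'n::finite \<Rightarrow> real) \<Rightarrow> (real ^ 'n \<Rightarrow> real) \<Rightarrow> (real ^ 'n \<Rightarrow> real) \<Rightarrow>
   ((real ^ 'n) \<times> real \<Rightarrow> real) \<Rightarrow> bool" where
  "classical_solution \<epsilon> \<phi> \<psi> g u \<longleftrightarrow>
     (\<forall>t\<ge>0. periodic (\<lambda>x. u (x, t))) \<and>
     continuous_on (UNIV \<times> {0..}) u \<and>
     C21 u \<and>
     (\<forall>x. \<forall>t>0.
        dt u (x, t) =
          contract_hessian
            (\<lambda>i j. kron i j - dx i u (x, t) * dx j u (x, t) / (norm_eps \<epsilon> (grad u (x, t)))\<^sup>2) u (x, t)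
          - norm_eps \<epsilon> (grad u (x, t)) * deriv (V \<epsilon> \<phi> \<psi> x) (u (x, t))) \<and>
     (\<forall>x. u (x, 0) = g x)"

text \<open>For continuous functions, membership in \<open>L\<^sup>\<infinity>\<close> is boundedness.\<close>

definition admissible ::
  "(real ^ 'n \<Rightarrow> real) \<Rightarrow> (real ^ 'n \<Rightarrow> real) \<Rightarrow> ((real ^ 'n) \<times> real \<Rightarrow> real) \<Rightarrow> bool" where
  "admissible \<phi> \<psi> u \<longleftrightarrow>
     (\<forall>t\<ge>0. periodic (\<lambda>x. u (x, t))) \<and>
     continuous_on (UNIV \<times> {0..}) u \<and>
     bounded (u ` (UNIV \<times> {0..})) \<and>
     (\<forall>x. \<forall>t\<ge>0. \<phi> x \<le> u (x, t) \<and> u (x, t) \<le> \<psi> x)"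

definition local_max_at :: "('a::topological_space \<Rightarrow> real) \<Rightarrow> 'a \<Rightarrow> bool" where
  "local_max_at f z \<longleftrightarrow> (\<forall>\<^sub>F y in nhds z. f y \<le> f z)"

definition local_min_at :: "('a::topological_space \<Rightarrow> real) \<Rightarrow> 'a \<Rightarrow> bool" where
  "local_min_at f z \<longleftrightarrow> (\<forall>\<^sub>F y in nhds z. f z \<le> f y)"

definition viscosity_subsolution ::
  "(real ^ 'n::finite \<Rightarrow> real) \<Rightarrow> (real ^ 'n \<Rightarrow> real) \<Rightarrow> ((real ^ 'n) \<times> real \<Rightarrow> real) \<Rightarrow> bool" where
  "viscosity_subsolution \<phi> \<psi> u \<longleftrightarrow>
     admissible \<phi> \<psi> u \<and>
     (\<forall>\<eta> x t. smooth \<eta> \<and> t > 0 \<and> local_max_at (\<lambda>z. u z - \<eta> z) (x, t) \<and> u (x, t) > \<phi> x \<longrightarrow>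
        (grad \<eta> (x, t) \<noteq> 0 \<longrightarrow>
           dt \<eta> (x, t) \<le> contract_hessian
             (\<lambda>i j. kron i j - dx i \<eta> (x, t) * dx j \<eta> (x, t) / (norm (grad \<eta> (x, t)))\<^sup>2) \<eta> (x, t)) \<and>
        (grad \<eta> (x, t) = 0 \<longrightarrow>
           (\<exists>\<zeta> :: real ^ 'n. norm \<zeta> \<le> 1 \<and>
              dt \<eta> (x, t) \<le> contract_hessian (\<lambda>i j. kron i j - \<zeta> $ i * \<zeta> $ j) \<eta> (x, t))))"

definition viscosity_supersolution ::
  "(real ^ 'n::finite \<Rightarrow> real) \<Rightarrow> (real ^ 'n \<Rightarrow> real) \<Rightarrow> ((real ^ 'n) \<times> real \<Rightarrow> real) \<Rightarrow> bool" where
  "viscosity_supersolution \<phi> \<psi> u \<longleftrightarrow>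
     admissible \<phi> \<psi> u \<and>
     (\<forall>\<eta> x t. smooth \<eta> \<and> t > 0 \<and> local_min_at (\<lambda>z. u z - \<eta> z) (x, t) \<and> u (x, t) < \<psi> x \<longrightarrow>
        (grad \<eta> (x, t) \<noteq> 0 \<longrightarrow>
           dt \<eta> (x, t) \<ge> contract_hessian
             (\<lambda>i j. kron i j - dx i \<eta> (x, t) * dx j \<eta> (x, t) / (norm (grad \<eta> (x, t)))\<^sup>2) \<eta> (x, t)) \<and>
        (grad \<eta> (x, t) = 0 \<longrightarrow>
           (\<exists>\<zeta> :: real ^ 'n. norm \<zeta> \<le> 1 \<and>
              dt \<eta> (x, t) \<ge> contract_hessian (\<lambda>i j. kron i j - \<zeta> $ i * \<zeta> $ j) \<eta> (x, t))))"

definition viscosity_solution ::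
  "(real ^ 'n::finite \<Rightarrow> real) \<Rightarrow> (real ^ 'n \<Rightarrow> real) \<Rightarrow> ((real ^ 'n) \<times> real \<Rightarrow> real) \<Rightarrow> bool" where
  "viscosity_solution \<phi> \<psi> u \<longleftrightarrow> viscosity_subsolution \<phi> \<psi> u \<and> viscosity_supersolution \<phi> \<psi> u"

end

theory Submission
  imports Defs
begin

text \<open>Everything rests on one comparison of a (possibly only viscosity) subsolution \<open>w\<close> of the
  \<open>\<epsilon>\<close>-equation, \<open>0 \<le> \<epsilon> \<le> \<epsilon>'\<close>, with a classical solution \<open>v\<close> of the \<open>\<epsilon>'\<close>-equation. At a maximum of
  \<open>w(x,t) - v(y,t) - K|x - y|\<^sup>4 - \<delta>t\<close>, translating \<open>v\<close> tests \<open>w\<close> with the \<open>C\<^sup>2\<close> function \<open>v\<close> itself, and the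
  penalty gives \<open>|p| = 4K|x - y|\<^sup>3\<close> and \<open>D\<^sup>2v \<ge> - 12K|x - y|\<^sup>2\<close>. Hence the discrepancy between the two
  equations is at most \<open>12K|x - y|\<^sup>2 \<epsilon>'\<^sup>2 / |p|\<^sub>\<epsilon>\<^sub>'\<^sup>2\<close>, which tends to \<open>0\<close> with \<open>\<epsilon>'\<close> uniformly in \<open>x - y\<close>. The
  same penalty shows that the obstacles are violated by at most \<open>o(1)\<close>, which makes the penalization
  terms harmless. So the \<open>u\<^sub>\<epsilon>\<close> are uniformly Cauchy, every viscosity solution is their limit, and the
  limit is a viscosity solution by stability.\<close>

section \<open>Quadratic forms and contractions\<close>

text \<open>Why a fourth power: the operator is singular at p = 0. A quadratic penalty has a Hessian
  of size K at every gradient, so where |p| is comparable to \<epsilon>' the two equations could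
  differ by an amount of order K that does not vanish. For |x - y|^4 the Hessian bound degenerates
  together with p, and a zero gradient forces x = y, hence D^2 v \<ge> 0 there. Why \<epsilon> \<le>
  \<epsilon>': with Y = D^2 v the traces cancel, and for p nonzero the difference of the curvature
  terms is - Y(p,p) (1/|p|_\<epsilon>^2 - 1/|p|_\<epsilon>'^2). In this order the bracket is
  nonnegative, so a lower bound on Y suffices, and that is what touching v from one side provides.
  Why jets: the translated v has two derivatives in x and one in t, whereas viscosity solutions are
  tested with smooth functions. The stability argument also upgrades smooth tests to jets. Only
  upper estimates are proved directly; the reflection u -> - u, which exchanges the obstacles,
  supplies the lower ones.\<close>

definition qform :: "('n::finite \<Rightarrow> 'n \<Rightarrow> real) \<Rightarrow> real ^ 'n \<Rightarrow> real" where
  "qform H v = (\<Sum>i\<in>UNIV. \<Sum>j\<in>UNIV. v $ i * v $ j * H i j)"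

text \<open>The trace of (I - \<zeta>\<zeta>^T) H. With
  \<open>\<zeta> = p /\<^sub>R norm_eps \<epsilon> p\<close> it is the second order part of the
  regularized equation; a free \<open>\<zeta>\<close> in the unit ball gives the relaxed condition
  at vanishing gradient.\<close>

definition curv :: "real ^ 'n::finite \<Rightarrow> ('n \<Rightarrow> 'n \<Rightarrow> real) \<Rightarrow> real" where
  "curv \<zeta> H = (\<Sum>i\<in>UNIV. \<Sum>j\<in>UNIV. (kron i j - \<zeta> $ i * \<zeta> $ j) * H i j)"

definition hess :: "((real ^ 'n) \<times> real \<Rightarrow> real) \<Rightarrow> (real ^ 'n) \<times> real \<Rightarrow> 'n \<Rightarrow> 'n \<Rightarrow> real" where
  "hess f z i j = dx i (dx j f) z"

lemma kron_sum [simp]: "(\<Sum>j\<in>UNIV. kron i j * f j) = f (i::'n::finite)"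
  by (simp add: kron_def if_distrib[of "\<lambda>x. x * _"] cong: if_cong)

lemma curv_eq: "curv \<zeta> H = (\<Sum>i\<in>UNIV. H i i) - qform H \<zeta>"
  by (simp add: curv_def qform_def left_diff_distrib sum_subtractf)

lemma qform_add: "qform (\<lambda>i j. A i j + B i j) v = qform A v + qform B v"
  by (simp add: qform_def distrib_left sum.distrib)

lemma qform_diff: "qform (\<lambda>i j. A i j - B i j) v = qform A v - qform B v"
  by (simp add: qform_def right_diff_distrib sum_subtractf)

lemma qform_scale: "qform H (c *\<^sub>R v) = c\<^sup>2 * qform H v"
  by (simp add: qform_def sum_distrib_left power2_eq_square algebra_simps)

lemma qform_zero [simp]: "qform H 0 = 0"
  by (simp add: qform_def)

lemma norm_sq_vec: "(norm (v :: real ^ 'n::finite))\<^sup>2 = (\<Sum>i\<in>UNIV. v $ i * v $ i)"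
  by (simp add: power2_norm_eq_inner inner_vec_def)

lemma qform_kron: "qform (\<lambda>i j. c * kron i j) v = c * (norm v)\<^sup>2"
proof -
  have "qform (\<lambda>i j. c * kron i j) v = (\<Sum>i\<in>UNIV. \<Sum>j\<in>UNIV. kron i j * (c * (v $ i * v $ j)))"
    by (simp add: qform_def mult_ac)
  then show ?thesis by (simp add: norm_sq_vec sum_distrib_left)
qed

lemma curv_add_kron:
  "curv \<zeta> (\<lambda>i j. H i j + c * kron i j) = curv \<zeta> H + c * (real CARD('n) - (norm \<zeta>)\<^sup>2)"
  for \<zeta> :: "real ^ 'n::finite"
  unfolding curv_eq qform_add qform_kron by (simp add: sum.distrib kron_def algebra_simps)

lemma curv_diff: "curv \<zeta> (\<lambda>i j. A i j - B i j) = curv \<zeta> A - curv \<zeta> B"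
  by (simp add: curv_eq qform_diff sum_subtractf)

text \<open>The matrix \<open>I - \<zeta>\<zeta>\<^sup>T\<close> is the square of \<open>I - c \<zeta>\<zeta>\<^sup>T\<close> with the constant \<open>c\<close> below; so no
  symmetry of the contracted matrix is needed.\<close>

lemma curv_nonneg:
  fixes \<zeta> :: "real ^ 'n::finite"
  assumes \<zeta>: "norm \<zeta> \<le> 1" and H: "\<And>v. 0 \<le> qform H v"
  shows "0 \<le> curv \<zeta> H"
proof -
  define m where "m = (norm \<zeta>)\<^sup>2"
  define r where "r = sqrt (1 - m)"
  \<comment> \<open>Squaring I - c \<zeta>\<zeta>^T gives I - \<zeta>\<zeta>^T as soon as 2c - c^2 m
    = 1. The root (1 - r)/m is written as 1/(1 + r), which stays meaningful for m = 0.\<close>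
  define c where "c = 1 / (1 + r)"
  have m: "0 \<le> m" "m \<le> 1" using \<zeta> by (auto simp: m_def power_le_one)
  then have r: "0 \<le> r" "r\<^sup>2 = 1 - m" by (auto simp: r_def)
  have mr: "m = 1 - r\<^sup>2" using r by simp
  have c: "2 * c - c\<^sup>2 * m = 1"
    unfolding c_def mr using r(1)
    by (simp add: divide_simps power2_eq_square) (simp add: algebra_simps)
  \<comment> \<open>\<open>e k\<close> is the k-th row of I - c \<zeta>\<zeta>^T, so summing its
    products over k squares this matrix and turns the contraction into a sum of values of the
    quadratic form.\<close>
  define e where "e k = axis k 1 - (c * \<zeta> $ k) *\<^sub>R \<zeta>" for k :: 'n
  have ek: "e k $ i * e k $ j =
      kron k i * kron k j - c * (\<zeta> $ j * (kron k i * \<zeta> $ k)) - c * (\<zeta> $ i * (kron k j * \<zeta> $ k))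
      + (\<zeta> $ k * \<zeta> $ k) * (c\<^sup>2 * \<zeta> $ i * \<zeta> $ j)" for k i j
    by (simp add: e_def axis_def kron_def power2_eq_square algebra_simps)
  have sumk: "(\<Sum>k\<in>UNIV. kron k i * f k) = f i" for f :: "'n \<Rightarrow> real" and i
    by (simp add: kron_def if_distrib[of "\<lambda>x. x * _"] cong: if_cong)
  have "(\<Sum>k\<in>UNIV. e k $ i * e k $ j) = kron i j - \<zeta> $ i * \<zeta> $ j" for i j
  proof -
    have "(\<Sum>k\<in>UNIV. e k $ i * e k $ j) =
        kron i j - c * (\<zeta> $ j * \<zeta> $ i) - c * (\<zeta> $ i * \<zeta> $ j) + m * (c\<^sup>2 * \<zeta> $ i * \<zeta> $ j)"
      unfolding ek sum.distrib sum_subtractf sum_distrib_left[symmetric] sum_distrib_right[symmetric]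
      by (simp add: sumk m_def norm_sq_vec)
    also have "\<dots> = kron i j - (2 * c - c\<^sup>2 * m) * (\<zeta> $ i * \<zeta> $ j)" by (simp add: algebra_simps)
    finally show ?thesis using c by simp
  qed
  then have "curv \<zeta> H = (\<Sum>i\<in>UNIV. \<Sum>j\<in>UNIV. \<Sum>k\<in>UNIV. e k $ i * e k $ j * H i j)"
    by (simp add: curv_def sum_distrib_right[symmetric])
  also have "\<dots> = (\<Sum>i\<in>UNIV. \<Sum>k\<in>UNIV. \<Sum>j\<in>UNIV. e k $ i * e k $ j * H i j)"
    by (intro sum.cong refl sum.swap)
  also have "\<dots> = (\<Sum>k\<in>UNIV. qform H (e k))"
    by (subst sum.swap) (simp add: qform_def)
  also have "\<dots> \<ge> 0" by (intro sum_nonneg H)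
  finally show ?thesis .
qed

lemma curv_mono:
  assumes "norm \<zeta> \<le> 1" "\<And>v. qform A v \<le> qform B v"
  shows "curv \<zeta> A \<le> curv \<zeta> B"
  using curv_nonneg[of \<zeta> "\<lambda>i j. B i j - A i j"] assms by (simp add: qform_diff curv_diff)

text \<open>H + B I has a nonnegative form, and adding B I raises the contraction by at most B times
  the dimension.\<close>

lemma curv_lower_bound:
  fixes \<zeta> :: "real ^ 'n::finite"
  assumes "norm \<zeta> \<le> 1" "0 \<le> B" "\<And>v. - (B * (norm v)\<^sup>2) \<le> qform H v"
  shows "- (B * real CARD('n)) \<le> curv \<zeta> H"
proof -
  have "0 \<le> curv \<zeta> (\<lambda>i j. H i j + B * kron i j)"
  proof (rule curv_nonneg[OF assms(1)])
    show "0 \<le> qform (\<lambda>i j. H i j + B * kron i j) v" for v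
      using assms(3)[of v] by (simp add: qform_add qform_kron)
  qed
  moreover have "B * (real CARD('n) - (norm \<zeta>)\<^sup>2) \<le> B * real CARD('n)"
    using assms by (intro mult_left_mono) auto
  ultimately show ?thesis unfolding curv_add_kron by linarith
qed

section \<open>The regularized length and the direction it normalizes\<close>

lemma norm_eps_pos: "0 < \<epsilon> \<Longrightarrow> 0 < norm_eps \<epsilon> p"
  by (simp add: norm_eps_def add_pos_nonneg)

lemma norm_eps_sq: "(norm_eps \<epsilon> p)\<^sup>2 = \<epsilon>\<^sup>2 + (norm p)\<^sup>2"
  by (simp add: norm_eps_def)

lemma norm_eps_zero [simp]: "norm_eps 0 p = norm p"
  by (simp add: norm_eps_def)

lemma norm_le_norm_eps: "norm p \<le> norm_eps \<epsilon> p"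
  by (simp add: norm_eps_def real_le_rsqrt)

lemma norm_eps_ge: "0 \<le> \<epsilon> \<Longrightarrow> \<epsilon> \<le> norm_eps \<epsilon> p"
  by (simp add: norm_eps_def real_le_rsqrt)

lemma norm_eps_minus [simp]: "norm_eps \<epsilon> (- p) = norm_eps \<epsilon> p"
  by (simp add: norm_eps_def)

text \<open>If the regularized length is 0, the inverse is 0 by convention and so is the vector.
  Hence \<epsilon> = 0 together with p = 0 needs no special treatment.\<close>

lemma norm_unit_eps: "norm (p /\<^sub>R norm_eps \<epsilon> p) \<le> 1"
proof (cases "norm_eps \<epsilon> p = 0")
  case False
  have "0 \<le> norm_eps \<epsilon> p" by (simp add: norm_eps_def)
  with False show ?thesis using norm_le_norm_eps[of p \<epsilon>] by (simp add: divide_simps)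
qed simp

lemma qform_unit_eps: "qform H (p /\<^sub>R norm_eps \<epsilon> p) = qform H p / (\<epsilon>\<^sup>2 + (norm p)\<^sup>2)"
  by (simp add: qform_scale power_inverse norm_eps_sq divide_inverse)

section \<open>One-dimensional second order tests\<close>

text \<open>An upper bound alone fixes the derivative because s may approach t from both sides: the
  right side excludes D > a, the left side D < a.\<close>

lemma derivative_eq_of_upper_bound:
  fixes f :: "real \<Rightarrow> real"
  assumes f: "(f has_real_derivative D) (at t)"
    and ub: "\<And>\<gamma>. \<gamma> > 0 \<Longrightarrow> \<forall>\<^sub>F s in nhds t. f s \<le> f t + a * (s - t) + \<gamma> * \<bar>s - t\<bar>"
  shows "D = a"
proof (rule ccontr)
  assume "D \<noteq> a"
  define \<gamma> where "\<gamma> = \<bar>D - a\<bar> / 2"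
  have \<gamma>: "\<gamma> > 0" using \<open>D \<noteq> a\<close> by (simp add: \<gamma>_def)
  from ub[OF \<gamma>] obtain d where d: "d > 0"
    and db: "\<And>s. dist s t < d \<Longrightarrow> f s \<le> f t + a * (s - t) + \<gamma> * \<bar>s - t\<bar>"
    unfolding eventually_nhds_metric by blast
  show False
  proof (cases "D > a")
    case True
    have *: "((\<lambda>s. f s - (a + \<gamma>) * s) has_real_derivative D - (a + \<gamma>)) (at t)"
      using f by (auto intro!: derivative_eq_intros)
    have pos: "D - (a + \<gamma>) > 0"
    proof -
      have "D = a + 2 * \<gamma>" using True by (simp add: \<gamma>_def field_simps)
      with \<gamma> show ?thesis by simp
    qed
    obtain e where e: "e > 0"
      "\<And>h. h > 0 \<Longrightarrow> h < e \<Longrightarrow> f t - (a + \<gamma>) * t < f (t + h) - (a + \<gamma>) * (t + h)"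
      using DERIV_pos_inc_right[OF * pos] by blast
    define h where "h = min d e / 2"
    have h: "h > 0" "h < d" "h < e" using d e by (auto simp: h_def)
    have "f (t + h) \<le> f t + a * h + \<gamma> * h" using db[of "t + h"] h by (simp add: dist_norm)
    moreover have "f t + (a + \<gamma>) * h < f (t + h)" using e(2)[OF h(1,3)] by (simp add: distrib_left)
    ultimately show False by (simp add: distrib_right)
  next
    case False
    have *: "((\<lambda>s. f s - (a - \<gamma>) * s) has_real_derivative D - (a - \<gamma>)) (at t)"
      using f by (auto intro!: derivative_eq_intros)
    have pos: "D - (a - \<gamma>) < 0"
    proof -
      have "D = a - 2 * \<gamma>" using False by (simp add: \<gamma>_def field_simps)
      with \<gamma> show ?thesis by simp
    qed
    obtain e where e: "e > 0"
      "\<And>h. h > 0 \<Longrightarrow> h < e \<Longrightarrow> f t - (a - \<gamma>) * t < f (t - h) - (a - \<gamma>) * (t - h)"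
      using DERIV_neg_dec_left[OF * pos] by blast
    define h where "h = min d e / 2"
    have h: "h > 0" "h < d" "h < e" using d e by (auto simp: h_def)
    have "f (t - h) \<le> f t - a * h + \<gamma> * h" using db[of "t - h"] h by (simp add: dist_norm)
    moreover have "f t - (a - \<gamma>) * h < f (t - h)" using e(2)[OF h(1,3)] by (simp add: right_diff_distrib)
    ultimately show False by (simp add: left_diff_distrib)
  qed
qed

text \<open>Otherwise subtracting the quadratic bound leaves a function \<open>k\<close> whose
  derivative vanishes at 0 and is positive just to the right of it, so \<open>k\<close> exceeds its
  value at 0. The second derivative is used at 0 only.\<close>

lemma second_derivative_le_of_upper_bound:
  fixes f f' :: "real \<Rightarrow> real"
  assumes f: "\<And>s. (f has_real_derivative f' s) (at s)"
    and f': "(f' has_real_derivative f'') (at 0)"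
    and ub: "\<And>\<gamma>. \<gamma> > 0 \<Longrightarrow> \<forall>\<^sub>F s in nhds 0. f s \<le> f 0 + f' 0 * s + (c / 2 + \<gamma>) * s\<^sup>2"
  shows "f'' \<le> c"
proof (rule ccontr)
  assume "\<not> f'' \<le> c"
  \<comment> \<open>With this choice f'' exceeds the second derivative c + 2\<gamma> of the
    quadratic bound by 2\<gamma>.\<close>
  define \<gamma> where "\<gamma> = (f'' - c) / 4"
  have \<gamma>: "\<gamma> > 0" using \<open>\<not> f'' \<le> c\<close> by (simp add: \<gamma>_def)
  define k where "k s = f s - f' 0 * s - (c / 2 + \<gamma>) * s\<^sup>2" for s
  define k' where "k' s = f' s - f' 0 - (c + 2 * \<gamma>) * s" for s
  have k: "(k has_real_derivative k' s) (at s)" for s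
    unfolding k_def k'_def using f[of s] by (auto intro!: derivative_eq_intros simp: algebra_simps)
  have *: "(k' has_real_derivative f'' - (c + 2 * \<gamma>)) (at 0)"
    unfolding k'_def using f' by (auto intro!: derivative_eq_intros)
  have pos: "f'' - (c + 2 * \<gamma>) > 0"
    using \<open>\<not> f'' \<le> c\<close> by (simp add: \<gamma>_def field_simps)
  obtain e where e: "e > 0" "\<And>h. h > 0 \<Longrightarrow> h < e \<Longrightarrow> k' 0 < k' h"
    using DERIV_pos_inc_right[OF * pos] by auto
  from ub[OF \<gamma>] obtain d where d: "d > 0"
    and db: "\<And>s. dist s 0 < d \<Longrightarrow> f s \<le> f 0 + f' 0 * s + (c / 2 + \<gamma>) * s\<^sup>2"
    unfolding eventually_nhds_metric by blast
  define h where "h = min d e / 2"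
  have h: "h > 0" "h < d" "h < e" using d e by (auto simp: h_def)
  have "k 0 < k h"
  proof (rule DERIV_pos_imp_increasing_open[OF \<open>0 < h\<close>])
    show "\<exists>y. DERIV k x :> y \<and> y > 0" if "0 < x" "x < h" for x
      using k[of x] e(2)[of x] that h by (auto simp: k'_def)
    show "continuous_on {0..h} k"
      by (intro continuous_at_imp_continuous_on ballI DERIV_isCont[OF k])
  qed
  with db[of h] h show False by (simp add: k_def algebra_simps)
qed

lemma second_derivative_test:
  fixes f f' :: "real \<Rightarrow> real"
  assumes f: "\<And>s. (f has_real_derivative f' s) (at s)"
    and f': "(f' has_real_derivative f'') (at 0)"
    and max: "\<And>s. f s \<le> f 0"
  shows "f' 0 = 0 \<and> f'' \<le> 0"
proof -
  have 0: "f' 0 = 0"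
  proof (rule derivative_eq_of_upper_bound[OF f])
    show "\<forall>\<^sub>F s in nhds 0. f s \<le> f 0 + 0 * (s - 0) + \<gamma> * \<bar>s - 0\<bar>" if "\<gamma> > 0" for \<gamma>
      using that max by (intro always_eventually allI) (simp add: add_increasing2)
  qed
  moreover have "f'' \<le> 0"
  proof (rule second_derivative_le_of_upper_bound[OF f f'])
    show "\<forall>\<^sub>F s in nhds 0. f s \<le> f 0 + f' 0 * s + (0 / 2 + \<gamma>) * s\<^sup>2" if "\<gamma> > 0" for \<gamma>
      using that max by (intro always_eventually allI) (simp add: 0 add_increasing2)
  qed
  ultimately show ?thesis by simp
qed

text \<open>Applied to maxima over a time interval [0, T] that may be attained at T: only backward
  increments are available, so the derivative gets a sign instead of vanishing.\<close>

lemma derivative_nonneg_at_right_end_max: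
  fixes f :: "real \<Rightarrow> real"
  assumes "(f has_real_derivative D) (at t)" "0 < t" "\<And>s. 0 \<le> s \<Longrightarrow> s \<le> t \<Longrightarrow> f s \<le> f t"
  shows "0 \<le> D"
proof (rule ccontr)
  assume "\<not> 0 \<le> D"
  then obtain e where e: "e > 0" "\<And>h. h > 0 \<Longrightarrow> h < e \<Longrightarrow> f t < f (t - h)"
    using DERIV_neg_dec_left[OF assms(1)] by (auto simp: not_le)
  define h where "h = min t e / 2"
  have "h > 0" "h < e" "h \<le> t" using e assms(2) by (auto simp: h_def)
  then show False using e(2)[of h] assms(3)[of "t - h"] by auto
qed

section \<open>Parabolic calculus\<close>

lemma dx_has_derivative:
  assumes "(\<lambda>y. f (y, t)) differentiable (at x)"
  shows "((\<lambda>y. f (y, t)) has_derivative (\<lambda>v. grad f (x, t) \<bullet> v)) (at x)"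
proof -
  let ?F = "frechet_derivative (\<lambda>y. f (y, t)) (at x)"
  have D: "((\<lambda>y. f (y, t)) has_derivative ?F) (at x)"
    using assms by (simp add: frechet_derivative_works)
  then have lin: "linear ?F" by (rule has_derivative_linear)
  have "?F v = grad f (x, t) \<bullet> v" for v
  proof -
    have "?F v = ?F (\<Sum>i\<in>UNIV. v $ i *\<^sub>R axis i 1)"
      using basis_expansion[of v] by (simp add: scalar_mult_eq_scaleR)
    also have "\<dots> = (\<Sum>i\<in>UNIV. v $ i * dx i f (x, t))"
      by (simp add: linear_sum[OF lin] linear_cmul[OF lin] dx_def)
    finally show ?thesis by (simp add: inner_vec_def grad_def mult.commute)
  qed
  then have "?F = (\<lambda>v. grad f (x, t) \<bullet> v)" by auto
  then show ?thesis using D by simp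
qed

lemma dx_eqI:
  assumes "((\<lambda>y. f (y, t)) has_derivative D) (at x)"
  shows "dx i f (x, t) = D (axis i 1)"
  using frechet_derivative_at[OF assms] by (simp add: dx_def)

lemma grad_eqI:
  assumes "((\<lambda>y. f (y, t)) has_derivative (\<lambda>v. p \<bullet> v)) (at x)"
  shows "grad f (x, t) = p"
  by (simp add: grad_def dx_eqI[OF assms] inner_axis vec_eq_iff)

lemma dt_eqI:
  assumes "((\<lambda>s. f (x, s)) has_real_derivative D) (at t)"
  shows "dt f (x, t) = D"
  using assms by (simp add: dt_def DERIV_imp_deriv)

lemma C21_D:
  assumes "C21 u" "0 < t"
  shows "((\<lambda>y. u (y, t)) has_derivative (\<lambda>v. grad u (x, t) \<bullet> v)) (at x)"
    and "((\<lambda>y. dx i u (y, t)) has_derivative (\<lambda>v. grad (dx i u) (x, t) \<bullet> v)) (at x)"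
    and "((\<lambda>s. u (x, s)) has_real_derivative dt u (x, t)) (at t)"
  using assms
  by (auto simp: C21_def dt_def DERIV_deriv_iff_real_differentiable intro!: dx_has_derivative)

lemma has_derivative_line:
  fixes f :: "real ^ 'n::finite \<Rightarrow> real"
  assumes "(f has_derivative (\<lambda>v. p \<bullet> v)) (at (x + s *\<^sub>R v))"
  shows "((\<lambda>s. f (x + s *\<^sub>R v)) has_real_derivative p \<bullet> v) (at s)"
proof -
  have "((\<lambda>s. x + s *\<^sub>R v) has_derivative (\<lambda>h. h *\<^sub>R v)) (at s)"
    by (auto intro!: derivative_eq_intros)
  from has_derivative_compose[OF this assms] show ?thesis
    by (simp add: has_field_derivative_def mult.commute[of _ "p \<bullet> v"])
qed

text \<open>Restriction to spatial lines reduces second order information to one-variable calculus.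
  The derivative of grad u . v is taken term by term in its finite sum, so no interchange of mixed
  derivatives enters.\<close>

lemma C21_line:
  assumes "C21 u" "0 < t"
  shows "((\<lambda>s. u (x + s *\<^sub>R v, t)) has_real_derivative grad u (x + s *\<^sub>R v, t) \<bullet> v) (at s)"
    and "((\<lambda>s. grad u (x + s *\<^sub>R v, t) \<bullet> v) has_real_derivative
           qform (hess u (x + s *\<^sub>R v, t)) v) (at s)"
proof -
  show "((\<lambda>s. u (x + s *\<^sub>R v, t)) has_real_derivative grad u (x + s *\<^sub>R v, t) \<bullet> v) (at s)"
    by (rule has_derivative_line) (rule C21_D[OF assms])
  have "((\<lambda>s. dx j u (x + s *\<^sub>R v, t)) has_real_derivative
           grad (dx j u) (x + s *\<^sub>R v, t) \<bullet> v) (at s)" for j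
    by (rule has_derivative_line) (rule C21_D[OF assms])
  then have "((\<lambda>s. \<Sum>j\<in>UNIV. dx j u (x + s *\<^sub>R v, t) * v $ j) has_real_derivative
         (\<Sum>j\<in>UNIV. grad (dx j u) (x + s *\<^sub>R v, t) \<bullet> v * v $ j)) (at s)"
    by (intro DERIV_sum) (rule DERIV_cmult_right)
  also have "(\<lambda>s. \<Sum>j\<in>UNIV. dx j u (x + s *\<^sub>R v, t) * v $ j) =
      (\<lambda>s. grad u (x + s *\<^sub>R v, t) \<bullet> v)"
    by (simp add: inner_vec_def grad_def)
  also have "(\<Sum>j\<in>UNIV. grad (dx j u) (x + s *\<^sub>R v, t) \<bullet> v * v $ j) =
      qform (hess u (x + s *\<^sub>R v, t)) v"
    unfolding qform_def inner_vec_def grad_def sum_distrib_right hess_def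
    by (subst sum.swap) (simp add: mult_ac)
  finally show "((\<lambda>s. grad u (x + s *\<^sub>R v, t) \<bullet> v) has_real_derivative
           qform (hess u (x + s *\<^sub>R v, t)) v) (at s)" .
qed

definition superjet ::
  "((real ^ 'n::finite) \<times> real \<Rightarrow> real) \<Rightarrow> real ^ 'n \<Rightarrow> real \<Rightarrow> real \<Rightarrow> real ^ 'n \<Rightarrow>
   ('n \<Rightarrow> 'n \<Rightarrow> real) \<Rightarrow> bool" where
  "superjet w x t a p X \<longleftrightarrow>
     (\<forall>\<gamma>>0. \<forall>\<^sub>F (y, s) in nhds (x, t).
        w (y, s) \<le> w (x, t) + p \<bullet> (y - x) + qform X (y - x) / 2 + a * (s - t)
                   + \<gamma> * ((norm (y - x))\<^sup>2 + \<bar>s - t\<bar>))"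

lemma abs_qform_le:
  fixes v :: "real ^ 'n::finite"
  assumes "\<And>i j. \<bar>H i j\<bar> \<le> B"
  shows "\<bar>qform H v\<bar> \<le> (real CARD('n))\<^sup>2 * B * (norm v)\<^sup>2"
proof -
  have "\<bar>qform H v\<bar> \<le> (\<Sum>i\<in>UNIV. \<Sum>j\<in>UNIV. \<bar>v $ i * v $ j * H i j\<bar>)"
    unfolding qform_def by (rule order.trans[OF sum_abs]) (intro sum_mono sum_abs)
  also have "\<dots> \<le> (\<Sum>i\<in>(UNIV::'n set). \<Sum>j\<in>(UNIV::'n set). norm v * norm v * B)"
    unfolding abs_mult by (intro sum_mono mult_mono assms component_le_norm_cart) auto
  finally show ?thesis by (simp add: power2_eq_square mult_ac)
qed

lemma dist_Pair_le: "dist (y, s) (x, t) \<le> dist y x + dist s t"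
  unfolding dist_Pair_Pair by (rule sqrt_sum_squares_le_sum) auto

text \<open>Move in time first, at the fixed point y, by the mean value theorem, then in space at
  the fixed time t by a second order Taylor formula. Continuity of \<open>dt u\<close> and of the
  Hessian entries makes both remainders small; dividing the entrywise tolerance by n^2 compensates
  the constant in \<open>abs_qform_le\<close>.\<close>

lemma C21_superjet:
  fixes u :: "(real ^ 'n::finite) \<times> real \<Rightarrow> real"
  assumes u: "C21 u" and t: "0 < t"
  shows "superjet u x t (dt u (x, t)) (grad u (x, t)) (hess u (x, t))"
  unfolding superjet_def
proof (intro allI impI)
  fix \<gamma> :: real assume \<gamma>: "\<gamma> > 0"
  define N where "N = (real CARD('n))\<^sup>2"
  have N: "N > 0" by (simp add: N_def)
  have op: "open (UNIV \<times> {0<..} :: ((real ^ 'n) \<times> real) set)" by (intro open_Times) auto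
  have mem: "(x, t) \<in> UNIV \<times> {0<..}" using t by simp
  have "isCont (dt u) (x, t)"
    using u mem op by (simp add: C21_def continuous_on_eq_continuous_at)
  then have "\<forall>\<^sub>F z in nhds (x, t). z \<noteq> (x, t) \<longrightarrow> dist (dt u z) (dt u (x, t)) < \<gamma>"
    using \<gamma> by (simp add: isCont_def tendsto_iff eventually_at_filter)
  then have "\<forall>\<^sub>F z in nhds (x, t). dist (dt u z) (dt u (x, t)) < \<gamma>"
    using \<gamma> by (auto elim!: eventually_mono)
  moreover have "\<forall>\<^sub>F z in nhds (x, t). \<forall>i j. dist (hess u z i j) (hess u (x, t) i j) < \<gamma> / N"
  proof (intro eventually_all_finite)
    fix i j
    have "isCont (dx i (dx j u)) (x, t)"
      using u mem op by (simp add: C21_def continuous_on_eq_continuous_at)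
    then have "\<forall>\<^sub>F z in nhds (x, t). z \<noteq> (x, t) \<longrightarrow>
        dist (dx i (dx j u) z) (dx i (dx j u) (x, t)) < \<gamma> / N"
      using \<gamma> N by (simp add: isCont_def tendsto_iff eventually_at_filter)
    then show "\<forall>\<^sub>F z in nhds (x, t). dist (hess u z i j) (hess u (x, t) i j) < \<gamma> / N"
      using \<gamma> N by (auto elim!: eventually_mono simp: hess_def)
  qed
  moreover have "\<forall>\<^sub>F z in nhds (x, t). z \<in> UNIV \<times> {0<..}"
    using op mem by (rule eventually_nhds_in_open)
  ultimately have "\<forall>\<^sub>F z in nhds (x, t). dist (dt u z) (dt u (x, t)) < \<gamma> \<and>
      (\<forall>i j. dist (hess u z i j) (hess u (x, t) i j) < \<gamma> / N) \<and> z \<in> UNIV \<times> {0<..}"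
    by eventually_elim simp
  then obtain d where d: "d > 0" and db: "\<And>z. dist z (x, t) < d \<Longrightarrow>
      dist (dt u z) (dt u (x, t)) < \<gamma> \<and>
      (\<forall>i j. dist (hess u z i j) (hess u (x, t) i j) < \<gamma> / N) \<and> z \<in> UNIV \<times> {0<..}"
    unfolding eventually_nhds_metric by blast
  have main: "u (y, s) \<le> u (x, t) + grad u (x, t) \<bullet> (y - x) + qform (hess u (x, t)) (y - x) / 2
      + dt u (x, t) * (s - t) + \<gamma> * ((norm (y - x))\<^sup>2 + \<bar>s - t\<bar>)"
    if "dist (y, s) (x, t) < d" for y s
  proof -
    \<comment> \<open>All intermediate times at the same y are at least as close to (x, t) as (y,
      s), so the mean value point lies in the good neighbourhood.\<close>
    have near: "dist (y, s') (x, t) < d" if "\<bar>s' - t\<bar> \<le> \<bar>s - t\<bar>" for s'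
    proof -
      have "dist (y, s') (x, t) \<le> dist (y, s) (x, t)"
        unfolding dist_Pair_Pair using that
        by (intro real_sqrt_le_mono add_left_mono power_mono) (auto simp: dist_norm)
      then show ?thesis using \<open>dist (y, s) (x, t) < d\<close> by simp
    qed
    have time: "u (y, s) - u (y, t) \<le> dt u (x, t) * (s - t) + \<gamma> * \<bar>s - t\<bar>"
    proof (cases "s = t")
      case False
      define l where "l = min s t"
      define r where "r = max s t"
      have lr: "l < r" using False by (auto simp: l_def r_def)
      have btw: "\<bar>s' - t\<bar> \<le> \<bar>s - t\<bar>" if "l \<le> s'" "s' \<le> r" for s'
        using that by (auto simp: l_def r_def min_def max_def split: if_splits)
      have "\<exists>z>l. z < r \<and> u (y, r) - u (y, l) = (r - l) * dt u (y, z)"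
        by (rule MVT2[OF lr]) (use C21_D(3)[OF u] db[OF near[OF btw]] in auto)
      then obtain z where z: "l < z" "z < r" "u (y, r) - u (y, l) = (r - l) * dt u (y, z)" by blast
      have "u (y, s) - u (y, t) = (s - t) * dt u (y, z)"
        using z(3) by (auto simp: l_def r_def min_def max_def algebra_simps split: if_splits)
      also have "\<dots> = dt u (x, t) * (s - t) + (s - t) * (dt u (y, z) - dt u (x, t))"
        by (simp add: algebra_simps)
      also have "(s - t) * (dt u (y, z) - dt u (x, t)) \<le> \<bar>s - t\<bar> * \<bar>dt u (y, z) - dt u (x, t)\<bar>"
        by (metis abs_ge_self abs_mult)
      also have "\<dots> \<le> \<bar>s - t\<bar> * \<gamma>"
        using db[OF near[OF btw[of z]]] z by (intro mult_left_mono) (auto simp: dist_norm)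
      finally show ?thesis by (simp add: mult.commute)
    qed simp
    have space: "u (y, t) \<le> u (x, t) + grad u (x, t) \<bullet> (y - x) + qform (hess u (x, t)) (y - x) / 2
        + \<gamma> / 2 * (norm (y - x))\<^sup>2"
    proof -
      define v where "v = y - x"
      \<comment> \<open>The successive derivatives along the segment from x to y; the Taylor formula
        of order 2 reads only the indices 0, 1 and 2.\<close>
      define D :: "nat \<Rightarrow> real \<Rightarrow> real" where
        "D = (\<lambda>m s. if m = 0 then u (x + s *\<^sub>R v, t)
           else if m = 1 then grad u (x + s *\<^sub>R v, t) \<bullet> v else qform (hess u (x + s *\<^sub>R v, t)) v)"
      have "\<exists>\<theta>>0. \<theta> < 1 \<and> D 0 1 = (\<Sum>m<2. D m 0 / fact m * 1 ^ m) + D 2 \<theta> / fact 2 * 1 ^ 2"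
      proof (rule Maclaurin)
        show "\<forall>m s. m < 2 \<and> 0 \<le> s \<and> s \<le> 1 \<longrightarrow> DERIV (D m) s :> D (Suc m) s"
          using C21_line[OF u t, of x v] by (auto simp: D_def less_2_cases_iff)
      qed auto
      then obtain \<theta> where \<theta>: "\<theta> > 0" "\<theta> < 1"
        and eq: "u (y, t) = u (x, t) + grad u (x, t) \<bullet> v + qform (hess u (x + \<theta> *\<^sub>R v, t)) v / 2"
        by (auto simp: D_def v_def numeral_2_eq_2)
      have "dist (x + \<theta> *\<^sub>R v, t) (x, t) \<le> dist (y, t) (x, t)"
        using \<theta> by (simp add: dist_Pair_Pair dist_norm v_def mult_left_le_one_le)
      also have "\<dots> < d" by (rule near) simp
      finally have h: "\<forall>i j. dist (hess u (x + \<theta> *\<^sub>R v, t) i j) (hess u (x, t) i j) < \<gamma> / N"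
        using db by blast
      have "\<bar>qform (\<lambda>i j. hess u (x + \<theta> *\<^sub>R v, t) i j - hess u (x, t) i j) v\<bar>
          \<le> (real CARD('n))\<^sup>2 * (\<gamma> / N) * (norm v)\<^sup>2"
        by (rule abs_qform_le) (use h in \<open>auto simp: dist_norm intro: less_imp_le\<close>)
      also have "\<dots> = \<gamma> * (norm v)\<^sup>2" using N by (simp add: N_def)
      finally show ?thesis using eq unfolding v_def[symmetric] by (simp add: qform_diff)
    qed
    have "\<gamma> / 2 * (norm (y - x))\<^sup>2 \<le> \<gamma> * (norm (y - x))\<^sup>2"
      using \<gamma> by (intro mult_right_mono) auto
    then show ?thesis using time space by (simp add: distrib_left)
  qed
  then show "\<forall>\<^sub>F (y, s) in nhds (x, t). u (y, s) \<le> u (x, t) + grad u (x, t) \<bullet> (y - x)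
      + qform (hess u (x, t)) (y - x) / 2 + dt u (x, t) * (s - t)
      + \<gamma> * ((norm (y - x))\<^sup>2 + \<bar>s - t\<bar>)"
    unfolding eventually_nhds_metric using d by (intro exI[of _ d]) auto
qed

lemma superjet_touch:
  assumes "superjet \<eta> x t a p X" "local_max_at (\<lambda>z. w z - \<eta> z) (x, t)"
  shows "superjet w x t a p X"
  unfolding superjet_def
proof (intro allI impI)
  fix \<gamma> :: real assume "\<gamma> > 0"
  then have "\<forall>\<^sub>F (y, s) in nhds (x, t). \<eta> (y, s) \<le> \<eta> (x, t) + p \<bullet> (y - x)
      + qform X (y - x) / 2 + a * (s - t) + \<gamma> * ((norm (y - x))\<^sup>2 + \<bar>s - t\<bar>)"
    using assms(1) by (simp add: superjet_def)
  with assms(2) show "\<forall>\<^sub>F (y, s) in nhds (x, t). w (y, s) \<le> w (x, t) + p \<bullet> (y - x)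
      + qform X (y - x) / 2 + a * (s - t) + \<gamma> * ((norm (y - x))\<^sup>2 + \<bar>s - t\<bar>)"
    unfolding local_max_at_def by eventually_elim auto
qed

lemma eventually_nhds_line:
  fixes x :: "'a::real_normed_vector" and t :: real
  assumes "\<forall>\<^sub>F z in nhds (x, t). P z"
  shows "\<forall>\<^sub>F s in nhds 0. P (x + s *\<^sub>R v, t)"
proof -
  have "((\<lambda>s. (x + s *\<^sub>R v, t)) \<longlongrightarrow> (x + 0 *\<^sub>R v, t)) (nhds 0)"
    by (intro tendsto_intros filterlim_ident)
  then have "filterlim (\<lambda>s. (x + s *\<^sub>R v, t)) (nhds (x, t)) (nhds 0)" by simp
  from eventually_compose_filterlim[OF assms this] show ?thesis .
qed

lemma eventually_nhds_time:
  fixes x :: "'a::real_normed_vector" and t :: real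
  assumes "\<forall>\<^sub>F z in nhds (x, t). P z"
  shows "\<forall>\<^sub>F s in nhds t. P (x, s)"
proof -
  have "filterlim (\<lambda>s. (x, s)) (nhds (x, t)) (nhds t)"
    by (intro tendsto_intros filterlim_ident)
  from eventually_compose_filterlim[OF assms this] show ?thesis .
qed

text \<open>Restricting the jet inequality to the time axis and to every spatial line through x
  reduces the claim to the one-dimensional tests. The Hessian is only dominated by \<open>X\<close>,
  since the jet bounds u from above.\<close>

lemma C21_superjet_compare:
  assumes u: "C21 u" and t: "0 < t" and J: "superjet u x t a p X"
  shows "dt u (x, t) = a" "grad u (x, t) = p" "qform (hess u (x, t)) v \<le> qform X v"
proof -
  have ev: "\<forall>\<^sub>F z in nhds (x, t). u z \<le> u (x, t) + p \<bullet> (fst z - x)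
      + qform X (fst z - x) / 2 + a * (snd z - t) + \<gamma> * ((norm (fst z - x))\<^sup>2 + \<bar>snd z - t\<bar>)"
    if "\<gamma> > 0" for \<gamma>
    using J[unfolded superjet_def case_prod_unfold, rule_format, OF that] by simp
  show "dt u (x, t) = a"
    by (rule derivative_eq_of_upper_bound[OF C21_D(3)[OF u t]])
      (use eventually_nhds_time[OF ev] in simp)
  have line: "\<forall>\<^sub>F s in nhds 0. u (x + s *\<^sub>R v, t) \<le> u (x, t) + (p \<bullet> v) * s
      + (qform X v / 2 + \<gamma>) * s\<^sup>2" if "\<gamma> > 0" for \<gamma> v
  proof -
    \<comment> \<open>Chosen so that \<gamma>' |v|^2 \<le> \<gamma>; the summand 1 covers v =
      0.\<close>
    define \<gamma>' where "\<gamma>' = \<gamma> / ((norm v)\<^sup>2 + 1)"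
    have \<gamma>': "\<gamma>' > 0" using that by (simp add: \<gamma>'_def add_nonneg_pos)
    have "\<gamma>' * (norm v)\<^sup>2 = \<gamma> * ((norm v)\<^sup>2 / ((norm v)\<^sup>2 + 1))" by (simp add: \<gamma>'_def)
    also have "\<dots> \<le> \<gamma> * 1"
      using that by (intro mult_left_mono) (auto simp: divide_simps add_nonneg_pos)
    finally have "\<gamma>' * (norm v)\<^sup>2 \<le> \<gamma>" by simp
    then have le: "\<gamma>' * (norm v)\<^sup>2 * s\<^sup>2 \<le> \<gamma> * s\<^sup>2" for s :: real by (rule mult_right_mono) simp
    show ?thesis using eventually_nhds_line[OF ev[OF \<gamma>'], of v]
    proof eventually_elim
      case (elim s)
      then show ?case using le[of s]
        by (simp add: qform_scale power_mult_distrib algebra_simps)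
    qed
  qed
  have gv: "grad u (x, t) \<bullet> v = p \<bullet> v" for v
  proof -
    have "((\<lambda>s. u (x + s *\<^sub>R v, t)) has_real_derivative grad u (x, t) \<bullet> v) (at 0)"
      using C21_line(1)[OF u t, of x v 0] by simp
    then show ?thesis
    proof (rule derivative_eq_of_upper_bound)
      fix \<gamma> :: real assume \<gamma>: "\<gamma> > 0"
      \<comment> \<open>The quadratic coefficient of \<open>line\<close> at error 1. Near 0 the term
        c s^2 is absorbed into \<gamma> |s|, which is all that a first order test requires.\<close>
      define c where "c = qform X v / 2 + 1"
      have "((\<lambda>s. c * \<bar>s\<bar>) \<longlongrightarrow> c * \<bar>0\<bar>) (nhds 0)"
        by (intro tendsto_intros filterlim_ident)
      then have "\<forall>\<^sub>F s in nhds 0. c * \<bar>s\<bar> < \<gamma>"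
        by (rule order_tendstoD) (use \<gamma> in simp)
      with line[of 1 v, OF zero_less_one] show "\<forall>\<^sub>F s in nhds 0. u (x + s *\<^sub>R v, t)
          \<le> u (x + 0 *\<^sub>R v, t) + p \<bullet> v * (s - 0) + \<gamma> * \<bar>s - 0\<bar>"
      proof eventually_elim
        case (elim s)
        have "c * s\<^sup>2 = (c * \<bar>s\<bar>) * \<bar>s\<bar>" by (simp add: power2_eq_square)
        also have "\<dots> \<le> \<gamma> * \<bar>s\<bar>" using elim by (intro mult_right_mono) auto
        finally show ?case using elim by (simp add: c_def)
      qed
    qed
  qed
  then show "grad u (x, t) = p" using vector_eq_rdot[of "grad u (x, t)" p] by blast
  show "qform (hess u (x, t)) v \<le> qform X v"
  proof (rule second_derivative_le_of_upper_bound)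
    show "((\<lambda>s. u (x + s *\<^sub>R v, t)) has_real_derivative grad u (x + s *\<^sub>R v, t) \<bullet> v) (at s)" for s
      by (rule C21_line[OF u t])
    show "((\<lambda>s. grad u (x + s *\<^sub>R v, t) \<bullet> v) has_real_derivative qform (hess u (x, t)) v) (at 0)"
      using C21_line(2)[OF u t, of x v 0] by simp
    show "\<forall>\<^sub>F s in nhds 0. u (x + s *\<^sub>R v, t) \<le> u (x + 0 *\<^sub>R v, t)
        + grad u (x + 0 *\<^sub>R v, t) \<bullet> v * s + (qform X v / 2 + \<gamma>) * s\<^sup>2" if "\<gamma> > 0" for \<gamma>
      using line[OF that, of v] by (simp add: gv)
  qed
qed

section \<open>Smooth functions\<close>

lemma C_k_SucI:
  assumes "\<And>x. (f has_derivative f' x) (at x)" "\<And>b. b \<in> Basis \<Longrightarrow> C_k k (\<lambda>x. f' x b)"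
  shows "C_k (Suc k) f"
proof -
  have "frechet_derivative f (at x) = f' x" for x
    using frechet_derivative_at[OF assms(1)] by simp
  then show ?thesis using assms by (auto simp: differentiable_def)
qed

lemma C_k_SucD:
  assumes "C_k (Suc k) f"
  shows "(f has_derivative frechet_derivative f (at x)) (at x)"
    and "b \<in> Basis \<Longrightarrow> C_k k (\<lambda>x. frechet_derivative f (at x) b)"
  using assms by (auto simp: frechet_derivative_works)

lemma C_k_Suc_imp: "C_k (Suc k) f \<Longrightarrow> C_k k f"
proof (induction k arbitrary: f)
  case 0
  then show ?case
    by (auto intro!: continuous_at_imp_continuous_on differentiable_imp_continuous_within)
next
  case (Suc k)
  then show ?case by (metis C_k.simps(2))
qed

lemma C_k_imp_continuous: "C_k k f \<Longrightarrow> continuous_on UNIV f"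
  by (induction k) (auto dest!: C_k_Suc_imp simp del: C_k.simps(2))

lemma C_k_const: "C_k k (\<lambda>_. c)"
proof (induction k arbitrary: c)
  case (Suc k)
  show ?case by (rule C_k_SucI[OF has_derivative_const Suc])
qed simp

lemma C_k_add:
  assumes "C_k k f" "C_k k g"
  shows "C_k k (\<lambda>x. f x + g x)"
  using assms
proof (induction k arbitrary: f g)
  case 0
  then show ?case by (auto intro: continuous_intros)
next
  case (Suc k)
  show ?case
    by (rule C_k_SucI[OF has_derivative_add[OF C_k_SucD(1)[OF Suc.prems(1)] C_k_SucD(1)[OF Suc.prems(2)]]])
      (intro Suc.IH C_k_SucD(2)[OF Suc.prems(1)] C_k_SucD(2)[OF Suc.prems(2)])
qed

lemma C_k_mult:
  assumes "C_k k f" "C_k k g"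
  shows "C_k k (\<lambda>x. f x * g x)"
  using assms
proof (induction k arbitrary: f g)
  case 0
  then show ?case by (auto intro: continuous_intros)
next
  case (Suc k)
  show ?case
    by (rule C_k_SucI[OF has_derivative_mult[OF C_k_SucD(1)[OF Suc.prems(1)] C_k_SucD(1)[OF Suc.prems(2)]]])
      (intro C_k_add Suc.IH C_k_SucD(2)[OF Suc.prems(1)] C_k_SucD(2)[OF Suc.prems(2)]
        C_k_Suc_imp[OF Suc.prems(1)] C_k_Suc_imp[OF Suc.prems(2)])
qed

lemma C_k_bounded_linear:
  assumes "bounded_linear f"
  shows "C_k k f"
proof (cases k)
  case 0
  then show ?thesis using linear_continuous_on[OF assms] by simp
next
  case (Suc k)
  show ?thesis unfolding Suc
    by (rule C_k_SucI[OF bounded_linear_imp_has_derivative[OF assms] C_k_const])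
qed

lemma smooth_const: "smooth (\<lambda>_. c)"
  by (simp add: smooth_def C_k_const)

lemma smooth_add: "smooth f \<Longrightarrow> smooth g \<Longrightarrow> smooth (\<lambda>x. f x + g x)"
  by (simp add: smooth_def C_k_add)

lemma smooth_mult: "smooth f \<Longrightarrow> smooth g \<Longrightarrow> smooth (\<lambda>x. f x * g x)"
  by (simp add: smooth_def C_k_mult)

lemma smooth_bounded_linear: "bounded_linear f \<Longrightarrow> smooth f"
  by (simp add: smooth_def C_k_bounded_linear)

lemma smooth_minus: "smooth f \<Longrightarrow> smooth (\<lambda>x. - f x)"
  using smooth_mult[OF smooth_const[of "- 1"], of f] by simp

lemma smooth_sum: "(\<And>i. i \<in> I \<Longrightarrow> smooth (f i)) \<Longrightarrow> smooth (\<lambda>x. \<Sum>i\<in>I. f i x)"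
  by (induction I rule: infinite_finite_induct) (auto intro: smooth_const smooth_add)

lemma slice_derivatives:
  fixes f :: "(real ^ 'n::finite) \<times> real \<Rightarrow> real"
  assumes "(f has_derivative D) (at (x, t))"
  shows "((\<lambda>y. f (y, t)) has_derivative (\<lambda>v. D (v, 0))) (at x)"
    and "((\<lambda>s. f (x, s)) has_real_derivative D (0, 1)) (at t)"
proof -
  have "((\<lambda>y. (y, t)) has_derivative (\<lambda>v. (v, 0))) (at x)"
    by (auto intro!: derivative_eq_intros)
  from has_derivative_compose[OF this assms]
  show "((\<lambda>y. f (y, t)) has_derivative (\<lambda>v. D (v, 0))) (at x)" by simp
  have "((\<lambda>s. (x, s)) has_derivative (\<lambda>h. (0, h))) (at t)"
    by (auto intro!: derivative_eq_intros)
  from has_derivative_compose[OF this assms]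
  have "((\<lambda>s. f (x, s)) has_derivative (\<lambda>h. D (0, h))) (at t)" by simp
  moreover have "D (0, h) = D (0, 1) * h" for h
    using linear_cmul[OF has_derivative_linear[OF assms], of h "(0, 1)"] by simp
  then have "(\<lambda>h. D (0, h)) = (*) (D (0, 1))" by (rule ext)
  ultimately show "((\<lambda>s. f (x, s)) has_real_derivative D (0, 1)) (at t)"
    unfolding has_field_derivative_def by (simp only:)
qed

text \<open>\<open>C_k\<close> differentiates along the basis of the product space, whereas
  \<open>dx\<close> and \<open>dt\<close> differentiate slices. They agree because (axis i 1, 0) and
  (0, 1) are basis vectors of that product.\<close>

lemma C_k_dx_dt:
  fixes f :: "(real ^ 'n::finite) \<times> real \<Rightarrow> real"
  assumes "C_k (Suc k) f"
  shows "C_k k (dx i f)" "C_k k (dt f)"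
    and "(\<lambda>y. f (y, t)) differentiable (at x)" "(\<lambda>s. f (x, s)) differentiable (at t)"
proof -
  note D = slice_derivatives[OF C_k_SucD(1)[OF assms]]
  have "dx i f = (\<lambda>z. frechet_derivative f (at z) (axis i 1, 0))"
    using dx_eqI[OF D(1)] by auto
  moreover have "(axis i (1::real), 0::real) \<in> Basis"
    by (auto simp: Basis_prod_def Basis_vec_def)
  ultimately show "C_k k (dx i f)" using C_k_SucD(2)[OF assms] by simp
  have "dt f = (\<lambda>z. frechet_derivative f (at z) (0, 1))"
    using dt_eqI[OF D(2)] by auto
  moreover have "(0::real ^ 'n, 1::real) \<in> Basis"
    by (simp add: Basis_prod_def)
  ultimately show "C_k k (dt f)" using C_k_SucD(2)[OF assms] by simp
  show "(\<lambda>y. f (y, t)) differentiable (at x)" using D(1) by (auto simp: differentiable_def)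
  show "(\<lambda>s. f (x, s)) differentiable (at t)"
    using D(2) by (auto simp: differentiable_def has_field_derivative_def)
qed

lemma smooth_imp_C21:
  assumes "smooth f"
  shows "C21 f"
proof -
  have k: "C_k (Suc k) f" for k using assms unfolding smooth_def by blast
  have 2: "C_k (Suc 0) (dx i f)" for i by (rule C_k_dx_dt[OF k])
  have "continuous_on UNIV f" "continuous_on UNIV (dt f)" "continuous_on UNIV (dx i f)"
    "continuous_on UNIV (dx i (dx j f))" for i j
    by (rule C_k_imp_continuous[OF k] C_k_imp_continuous[OF C_k_dx_dt(2)[OF k]]
        C_k_imp_continuous[OF C_k_dx_dt(1)[OF k]] C_k_imp_continuous[OF C_k_dx_dt(1)[OF 2]])+
  then show ?thesis unfolding C21_def
    using C_k_dx_dt(3)[OF k] C_k_dx_dt(4)[OF k] C_k_dx_dt(3)[OF 2]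
    by (auto intro: continuous_on_subset)
qed

section \<open>Reflection\<close>

lemma dx_cong: "(\<And>y. f (y, t) = g (y, t)) \<Longrightarrow> dx i f (x, t) = dx i g (x, t)"
  by (simp add: dx_def)

lemma dx_minus:
  assumes "(\<lambda>y. f (y, t)) differentiable (at x)"
  shows "dx i (\<lambda>z. - f z) (x, t) = - dx i f (x, t)"
  using dx_eqI[OF has_derivative_minus[OF dx_has_derivative[OF assms]]]
    dx_eqI[OF dx_has_derivative[OF assms]] by simp

lemma C21_minus_derivs:
  assumes u: "C21 u" and t: "0 < t"
  shows "dx i (\<lambda>z. - u z) (x, t) = - dx i u (x, t)"
    and "grad (\<lambda>z. - u z) (x, t) = - grad u (x, t)"
    and "dx i (dx j (\<lambda>z. - u z)) (x, t) = - dx i (dx j u) (x, t)"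
    and "hess (\<lambda>z. - u z) (x, t) = (\<lambda>i j. - hess u (x, t) i j)"
    and "dt (\<lambda>z. - u z) (x, t) = - dt u (x, t)"
proof -
  show 1: "dx i (\<lambda>z. - u z) (x, t) = - dx i u (x, t)" for i x
    using u t by (intro dx_minus) (auto simp: C21_def)
  show "grad (\<lambda>z. - u z) (x, t) = - grad u (x, t)"
    by (simp add: grad_def 1 vec_eq_iff)
  have "dx i (dx j (\<lambda>z. - u z)) (x, t) = dx i (\<lambda>z. - dx j u z) (x, t)" for i j
    by (rule dx_cong) (rule 1)
  also have "dx i (\<lambda>z. - dx j u z) (x, t) = - dx i (dx j u) (x, t)" for i j
    using u t by (intro dx_minus) (auto simp: C21_def)
  finally show 2: "dx i (dx j (\<lambda>z. - u z)) (x, t) = - dx i (dx j u) (x, t)" for i j .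
  show "hess (\<lambda>z. - u z) (x, t) = (\<lambda>i j. - hess u (x, t) i j)"
    by (simp add: hess_def 2 fun_eq_iff)
  show "dt (\<lambda>z. - u z) (x, t) = - dt u (x, t)"
    by (rule dt_eqI) (rule DERIV_minus[OF C21_D(3)[OF u t]])
qed

lemma C21_minus:
  assumes u: "C21 u"
  shows "C21 (\<lambda>z. - u z)"
proof -
  have "(\<lambda>y. - u (y, t)) differentiable (at x)" "(\<lambda>y. dx i (\<lambda>z. - u z) (y, t)) differentiable (at x)"
    "(\<lambda>s. - u (x, s)) differentiable (at t)" if "t > 0" for x i t
    using u that by (auto simp: C21_def C21_minus_derivs[OF u that])
  moreover have "continuous_on (UNIV \<times> {0<..}) (dt (\<lambda>z. - u z)) \<longleftrightarrow>
      continuous_on (UNIV \<times> {0<..}) (\<lambda>z. - dt u z)"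
    by (intro continuous_on_cong) (auto simp: C21_minus_derivs[OF u])
  moreover have "continuous_on (UNIV \<times> {0<..}) (dx i (\<lambda>z. - u z)) \<longleftrightarrow>
      continuous_on (UNIV \<times> {0<..}) (\<lambda>z. - dx i u z)" for i
    by (intro continuous_on_cong) (auto simp: C21_minus_derivs[OF u])
  moreover have "continuous_on (UNIV \<times> {0<..}) (dx i (dx j (\<lambda>z. - u z))) \<longleftrightarrow>
      continuous_on (UNIV \<times> {0<..}) (\<lambda>z. - dx i (dx j u) z)" for i j
    by (intro continuous_on_cong) (auto simp: C21_minus_derivs[OF u])
  ultimately show ?thesis
    using u unfolding C21_def by (auto intro!: continuous_on_minus)
qed

section \<open>The penalization term and the reflection of classical solutions\<close>

lemma has_real_derivative_pos_part_pow4: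
  "((\<lambda>s::real. (max (s - b) 0) ^ 4) has_real_derivative 4 * (max (s - b) 0) ^ 3) (at s)"
proof -
  consider "s < b" | "s > b" | "s = b" by linarith
  then show ?thesis
  proof cases
    case 1
    have "((\<lambda>s::real. 0) has_real_derivative 0) (at s)" by simp
    then have "((\<lambda>s::real. (max (s - b) 0) ^ 4) has_real_derivative 0) (at s)"
      by (rule has_field_derivative_transform_within_open[of _ _ _ "{..<b}"]) (use 1 in auto)
    then show ?thesis using 1 by simp
  next
    case 2
    have "((\<lambda>s::real. (s - b) ^ 4) has_real_derivative 4 * (s - b) ^ 3) (at s)"
      by (auto intro!: derivative_eq_intros)
    then have "((\<lambda>s::real. (max (s - b) 0) ^ 4) has_real_derivative 4 * (s - b) ^ 3) (at s)"
      by (rule has_field_derivative_transform_within_open[of _ _ _ "{b<..}"]) (use 2 in auto)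
    then show ?thesis using 2 by simp
  next
    case 3
    \<comment> \<open>At the junction the difference quotient is itself the cube of the positive
      part, which tends to 0.\<close>
    have "max h 0 ^ 4 / h = max h 0 ^ 3" for h :: real
      by (auto simp: max_def eval_nat_numeral)
    moreover have "((\<lambda>h::real. max h 0 ^ 3) \<longlongrightarrow> max 0 0 ^ 3) (at 0)"
      by (intro tendsto_intros)
    ultimately show ?thesis by (simp add: 3 DERIV_def)
  qed
qed

text \<open>For \<epsilon> > 0 this form displays what is used later: the derivative is nonnegative
  above \<phi>, nonpositive below \<psi>, and nondecreasing in s.\<close>

lemma deriv_V:
  "deriv (V \<epsilon> \<phi> \<psi> x) s = 4 / \<epsilon> * ((max (s - \<psi> x) 0) ^ 3 - (max (\<phi> x - s) 0) ^ 3)"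
proof -
  have "((\<lambda>s. (max (- s - (- \<phi> x)) 0) ^ 4) has_real_derivative
      4 * (max (- s - (- \<phi> x)) 0) ^ 3 * (- 1)) (at s)"
    by (rule DERIV_chain2[OF has_real_derivative_pos_part_pow4]) (auto intro!: derivative_eq_intros)
  then have "((\<lambda>s. (max (\<phi> x - s) 0) ^ 4) has_real_derivative - 4 * (max (\<phi> x - s) 0) ^ 3) (at s)"
    by simp
  then have "(V \<epsilon> \<phi> \<psi> x has_real_derivative
      1 / \<epsilon> * (- 4 * (max (\<phi> x - s) 0) ^ 3) + 1 / \<epsilon> * (4 * (max (s - \<psi> x) 0) ^ 3)) (at s)"
    unfolding V_def by (intro DERIV_add DERIV_cmult has_real_derivative_pos_part_pow4)
  from DERIV_imp_deriv[OF this] show ?thesis by (simp add: right_diff_distrib)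
qed

lemma classical_solution_eq:
  assumes "classical_solution \<epsilon> \<phi> \<psi> g u" "0 < t"
  shows "dt u (x, t) = curv (grad u (x, t) /\<^sub>R norm_eps \<epsilon> (grad u (x, t))) (hess u (x, t))
           - norm_eps \<epsilon> (grad u (x, t)) * deriv (V \<epsilon> \<phi> \<psi> x) (u (x, t))"
  using assms unfolding classical_solution_def contract_hessian_def curv_def
  by (simp add: grad_def hess_def power2_eq_square field_simps)

lemma periodic_minus: "periodic (\<lambda>x. - f x) \<longleftrightarrow> periodic f"
  by (simp add: periodic_def)

text \<open>The second order part is odd in u, because its coefficients are even in the gradient.
  The derivative of the penalization changes sign when the obstacles are negated and
  exchanged.\<close>

lemma classical_solution_minus:
  assumes u: "classical_solution \<epsilon> \<phi> \<psi> g u"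
  shows "classical_solution \<epsilon> (\<lambda>x. - \<psi> x) (\<lambda>x. - \<phi> x) (\<lambda>x. - g x) (\<lambda>z. - u z)"
proof -
  have C: "C21 u" using u by (simp add: classical_solution_def)
  have ch: "contract_hessian A (\<lambda>z. - u z) (x, t) = - contract_hessian A u (x, t)"
    if "t > 0" for A x t
    by (simp add: contract_hessian_def C21_minus_derivs[OF C that] sum_negf)
  have dV: "deriv (V \<epsilon> (\<lambda>x. - \<psi> x) (\<lambda>x. - \<phi> x) x) (- s) = - deriv (V \<epsilon> \<phi> \<psi> x) s" for x s
    unfolding deriv_V by (simp add: algebra_simps)
  show ?thesis
    using u unfolding classical_solution_def
    by (auto simp: periodic_minus C21_minus_derivs[OF C] ch dV
        intro!: continuous_on_minus C21_minus)
qed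

section \<open>Subsolutions in terms of superjets\<close>

text \<open>For \<open>\<epsilon> > 0\<close> these are the viscosity subsolutions of the equation with \<open>|\<nabla>u|\<^sub>\<epsilon>\<close> in place of
  \<open>|\<nabla>u|\<close>, tested only above the lower obstacle; \<open>\<epsilon> = 0\<close> gives the level set equation.\<close>

definition sub_jet ::
  "real \<Rightarrow> (real ^ 'n::finite \<Rightarrow> real) \<Rightarrow> ((real ^ 'n) \<times> real \<Rightarrow> real) \<Rightarrow> bool" where
  "sub_jet \<epsilon> \<phi> w \<longleftrightarrow>
     (\<forall>x t a p X. t > 0 \<and> w (x, t) > \<phi> x \<and> superjet w x t a p X \<longrightarrow>
        (\<exists>\<zeta>. norm \<zeta> \<le> 1 \<and> (p \<noteq> 0 \<longrightarrow> \<zeta> = p /\<^sub>R norm_eps \<epsilon> p) \<and> a \<le> curv \<zeta> X))"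

text \<open>Both gradient cases share one existential \<open>\<zeta>\<close>, prescribed if the
  gradient is nonzero and free in the unit ball otherwise. In this form the condition passes to
  limits by compactness of the ball.\<close>

definition sub_test ::
  "real \<Rightarrow> (real ^ 'n::finite \<Rightarrow> real) \<Rightarrow> ((real ^ 'n) \<times> real \<Rightarrow> real) \<Rightarrow> bool" where
  "sub_test \<epsilon> \<phi> w \<longleftrightarrow>
     (\<forall>\<eta> x t. smooth \<eta> \<and> t > 0 \<and> local_max_at (\<lambda>z. w z - \<eta> z) (x, t) \<and> w (x, t) > \<phi> x \<longrightarrow>
        (\<exists>\<zeta>. norm \<zeta> \<le> 1 \<and>
           (grad \<eta> (x, t) \<noteq> 0 \<longrightarrow> \<zeta> = grad \<eta> (x, t) /\<^sub>R norm_eps \<epsilon> (grad \<eta> (x, t))) \<and>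
           dt \<eta> (x, t) \<le> curv \<zeta> (hess \<eta> (x, t))))"

lemma sub_jet_imp_sub_test: "sub_jet \<epsilon> \<phi> w \<Longrightarrow> sub_test \<epsilon> \<phi> w"
  unfolding sub_test_def sub_jet_def
  by (blast intro: superjet_touch C21_superjet smooth_imp_C21)

lemma viscosity_subsolution_iff:
  "viscosity_subsolution \<phi> \<psi> u \<longleftrightarrow> admissible \<phi> \<psi> u \<and> sub_test 0 \<phi> u"
proof -
  have 1: "contract_hessian (\<lambda>i j. kron i j - dx i \<eta> z * dx j \<eta> z / (norm (grad \<eta> z))\<^sup>2) \<eta> z
      = curv (grad \<eta> z /\<^sub>R norm_eps 0 (grad \<eta> z)) (hess \<eta> z)"
    for \<eta> :: "(real ^ 'n) \<times> real \<Rightarrow> real" and z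
    unfolding contract_hessian_def curv_def
    by (simp add: grad_def hess_def power2_eq_square field_simps)
  have 2: "contract_hessian (\<lambda>i j. kron i j - \<zeta> $ i * \<zeta> $ j) \<eta> z = curv \<zeta> (hess \<eta> z)"
    for \<eta> :: "(real ^ 'n) \<times> real \<Rightarrow> real" and z \<zeta>
    unfolding contract_hessian_def curv_def by (simp add: hess_def)
  have 3: "(p \<noteq> 0 \<longrightarrow> a \<le> curv (p /\<^sub>R norm_eps 0 p) X) \<and> (p = 0 \<longrightarrow> (\<exists>\<zeta>. norm \<zeta> \<le> 1 \<and> a \<le> curv \<zeta> X))
      \<longleftrightarrow> (\<exists>\<zeta>. norm \<zeta> \<le> 1 \<and> (p \<noteq> 0 \<longrightarrow> \<zeta> = p /\<^sub>R norm_eps 0 p) \<and> a \<le> curv \<zeta> X)"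
    for p :: "real ^ 'n" and a X
    using norm_unit_eps[of 0 p] by (cases "p = 0") auto
  show ?thesis
    unfolding viscosity_subsolution_def sub_test_def 1 2 3 ..
qed

lemma admissible_minus:
  "admissible (\<lambda>x. - \<psi> x) (\<lambda>x. - \<phi> x) (\<lambda>z. - u z) \<longleftrightarrow> admissible \<phi> \<psi> u"
proof -
  have "continuous_on A (\<lambda>z. - u z) \<longleftrightarrow> continuous_on A u" for A
    using continuous_on_minus[of A u] continuous_on_minus[of A "\<lambda>z. - u z"] by auto
  moreover have "bounded ((\<lambda>z. - u z) ` A) \<longleftrightarrow> bounded (u ` A)" for A
    by (simp add: bounded_iff)
  ultimately show ?thesis by (auto simp: admissible_def periodic_minus)
qed

text \<open>Testing with - \<eta> turns minima into maxima, and the operator is odd in the second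
  derivatives and even in the gradient. Every result on subsolutions thus applies to
  supersolutions.\<close>

lemma viscosity_supersolution_iff:
  fixes \<phi> \<psi> :: "real ^ 'n::finite \<Rightarrow> real"
  shows "viscosity_supersolution \<phi> \<psi> u \<longleftrightarrow>
         viscosity_subsolution (\<lambda>x. - \<psi> x) (\<lambda>x. - \<phi> x) (\<lambda>z. - u z)"
proof -
  note adm = admissible_minus[of \<psi> \<phi> u, symmetric]
  have ch: "contract_hessian A (\<lambda>z. - \<eta> z) (x, t) = - contract_hessian A \<eta> (x, t)"
    if "smooth \<eta>" "t > 0" for A x t and \<eta> :: "(real ^ 'n) \<times> real \<Rightarrow> real"
    by (simp add: contract_hessian_def C21_minus_derivs[OF smooth_imp_C21[OF that(1)] that(2)] sum_negf)
  have loc: "local_max_at (\<lambda>z. - u z - - \<eta> z) z \<longleftrightarrow> local_min_at (\<lambda>z. u z - \<eta> z) z"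
    "local_min_at (\<lambda>z. u z - - \<eta> z) z \<longleftrightarrow> local_max_at (\<lambda>z. - u z - \<eta> z) z" for \<eta> z
    by (auto simp: local_max_at_def local_min_at_def intro: eventually_mono)
  note D = C21_minus_derivs[OF smooth_imp_C21]
  show ?thesis
  proof
    assume S: "viscosity_supersolution \<phi> \<psi> u"
    show "viscosity_subsolution (\<lambda>x. - \<psi> x) (\<lambda>x. - \<phi> x) (\<lambda>z. - u z)"
      unfolding viscosity_subsolution_def
    proof (intro conjI allI impI; (elim conjE)?)
      show "admissible (\<lambda>x. - \<psi> x) (\<lambda>x. - \<phi> x) (\<lambda>z. - u z)"
        using S adm by (simp add: viscosity_supersolution_def)
    next
      fix \<eta> x t
      assume *: "smooth \<eta>" "0 < t" "local_max_at (\<lambda>z. - u z - \<eta> z) (x, t)" "- \<psi> x < - u (x, t)"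
      have min: "smooth (\<lambda>z. - \<eta> z) \<and> 0 < t \<and> local_min_at (\<lambda>z. u z - - \<eta> z) (x, t) \<and> u (x, t) < \<psi> x"
        using * loc by (auto intro: smooth_minus)
      note S' = S[unfolded viscosity_supersolution_def, THEN conjunct2, rule_format, OF min]
      show "dt \<eta> (x, t) \<le> contract_hessian
          (\<lambda>i j. kron i j - dx i \<eta> (x, t) * dx j \<eta> (x, t) / (norm (grad \<eta> (x, t)))\<^sup>2) \<eta> (x, t)"
        if "grad \<eta> (x, t) \<noteq> 0"
        using S' that by (simp add: D[OF *(1,2)] ch[OF *(1,2)])
      show "\<exists>\<zeta>. norm \<zeta> \<le> 1 \<and>
          dt \<eta> (x, t) \<le> contract_hessian (\<lambda>i j. kron i j - \<zeta> $ i * \<zeta> $ j) \<eta> (x, t)"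
        if "grad \<eta> (x, t) = 0"
        using S' that by (simp add: D[OF *(1,2)] ch[OF *(1,2)])
    qed
  next
    assume S: "viscosity_subsolution (\<lambda>x. - \<psi> x) (\<lambda>x. - \<phi> x) (\<lambda>z. - u z)"
    show "viscosity_supersolution \<phi> \<psi> u"
      unfolding viscosity_supersolution_def
    proof (intro conjI allI impI; (elim conjE)?)
      show "admissible \<phi> \<psi> u"
        using S adm by (simp add: viscosity_subsolution_def)
    next
      fix \<eta> x t
      assume *: "smooth \<eta>" "0 < t" "local_min_at (\<lambda>z. u z - \<eta> z) (x, t)" "u (x, t) < \<psi> x"
      have max: "smooth (\<lambda>z. - \<eta> z) \<and> 0 < t \<and> local_max_at (\<lambda>z. - u z - - \<eta> z) (x, t)
          \<and> - \<psi> x < - u (x, t)"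
        using * loc by (auto intro: smooth_minus)
      note S' = S[unfolded viscosity_subsolution_def, THEN conjunct2, rule_format, OF max]
      show "contract_hessian
          (\<lambda>i j. kron i j - dx i \<eta> (x, t) * dx j \<eta> (x, t) / (norm (grad \<eta> (x, t)))\<^sup>2) \<eta> (x, t)
          \<le> dt \<eta> (x, t)"
        if "grad \<eta> (x, t) \<noteq> 0"
        using S' that by (simp add: D[OF *(1,2)] ch[OF *(1,2)])
      show "\<exists>\<zeta>. norm \<zeta> \<le> 1 \<and>
          contract_hessian (\<lambda>i j. kron i j - \<zeta> $ i * \<zeta> $ j) \<eta> (x, t) \<le> dt \<eta> (x, t)"
        if "grad \<eta> (x, t) = 0"
        using S' that by (simp add: D[OF *(1,2)] ch[OF *(1,2)])
    qed
  qed
qed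

text \<open>Where u > \<phi> only the upper penalization can act. It pushes u down, so dropping it
  leaves the required inequality; replacing the Hessian by the larger \<open>X\<close> preserves
  it.\<close>

lemma classical_sub_jet:
  assumes u: "classical_solution \<epsilon> \<phi> \<psi> g u" and \<epsilon>: "0 < \<epsilon>"
  shows "sub_jet \<epsilon> \<phi> u"
  unfolding sub_jet_def
proof (intro allI impI, elim conjE)
  fix x t a p X
  assume t: "0 < t" and gt: "\<phi> x < u (x, t)" and J: "superjet u x t a p X"
  have C: "C21 u" using u by (simp add: classical_solution_def)
  note cmp = C21_superjet_compare[OF C t J]
  have "0 \<le> deriv (V \<epsilon> \<phi> \<psi> x) (u (x, t))"
    unfolding deriv_V using \<epsilon> gt by simp
  then have "0 \<le> norm_eps \<epsilon> p * deriv (V \<epsilon> \<phi> \<psi> x) (u (x, t))"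
    using norm_eps_pos[OF \<epsilon>, of p] by simp
  then have "a \<le> curv (p /\<^sub>R norm_eps \<epsilon> p) (hess u (x, t))"
    using classical_solution_eq[OF u t, of x] by (simp add: cmp(1,2))
  also have "\<dots> \<le> curv (p /\<^sub>R norm_eps \<epsilon> p) X"
    by (intro curv_mono norm_unit_eps cmp)
  finally show "\<exists>\<zeta>. norm \<zeta> \<le> 1 \<and> (p \<noteq> 0 \<longrightarrow> \<zeta> = p /\<^sub>R norm_eps \<epsilon> p) \<and> a \<le> curv \<zeta> X"
    using norm_unit_eps by blast
qed

section \<open>Stability under locally uniform limits\<close>

definition paraboloid ::
  "real ^ 'n::finite \<Rightarrow> real \<Rightarrow> real ^ 'n \<Rightarrow> ('n \<Rightarrow> 'n \<Rightarrow> real) \<Rightarrow> real \<Rightarrow> real \<Rightarrow>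
   (real ^ 'n) \<times> real \<Rightarrow> real" where
  "paraboloid x t p M a b z =
     p \<bullet> (fst z - x) + qform M (fst z - x) / 2 + a * (snd z - t) + b * (snd z - t)\<^sup>2"

lemma smooth_paraboloid: "smooth (paraboloid x t p M a b)"
proof -
  have c: "smooth (\<lambda>z. (fst z - x) $ i)" for i
    using smooth_add[OF smooth_bounded_linear[OF
          bounded_linear_compose[OF bounded_linear_vec_nth bounded_linear_fst]] smooth_const[of "- x $ i"]]
    by simp
  have s: "smooth (\<lambda>z. snd z - t)"
    using smooth_add[OF smooth_bounded_linear[OF bounded_linear_snd] smooth_const[of "- t"]] by simp
  have eq: "paraboloid x t p M a b = (\<lambda>z. (\<Sum>i\<in>UNIV. p $ i * (fst z - x) $ i)
      + (\<Sum>i\<in>UNIV. \<Sum>j\<in>UNIV. (fst z - x) $ i * (fst z - x) $ j * M i j) * (1 / 2)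
      + a * (snd z - t) + b * ((snd z - t) * (snd z - t)))"
    by (simp add: paraboloid_def inner_vec_def qform_def power2_eq_square fun_eq_iff)
  show ?thesis
    unfolding eq by (intro smooth_add smooth_mult smooth_sum smooth_const c s)
qed

lemma has_derivative_vec_nth: "((\<lambda>y. y $ i) has_derivative (\<lambda>v. v $ i)) (at y)"
  by (rule bounded_linear_imp_has_derivative[OF bounded_linear_vec_nth])

lemma grad_paraboloid:
  fixes x :: "real ^ 'n::finite"
  assumes M: "\<And>i j. M i j = M j i"
  shows "grad (paraboloid x t p M a b) (y, s) = p + (\<chi> i. \<Sum>j\<in>UNIV. M i j * (y - x) $ j)"
proof (rule grad_eqI)
  have c: "((\<lambda>y. (y - x) $ i) has_derivative (\<lambda>v. v $ i)) (at y)" for i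
    using has_derivative_diff[OF has_derivative_vec_nth has_derivative_const, of i "x $ i" y] by simp
  have q: "((\<lambda>y. qform M (y - x)) has_derivative
      (\<lambda>v. \<Sum>i\<in>UNIV. \<Sum>j\<in>UNIV. ((y - x) $ i * v $ j + v $ i * (y - x) $ j) * M i j)) (at y)"
    unfolding qform_def
    by (intro has_derivative_sum has_derivative_mult_left has_derivative_mult c)
  have eq: "(\<Sum>i\<in>UNIV. \<Sum>j\<in>UNIV. ((y - x) $ i * v $ j + v $ i * (y - x) $ j) * M i j)
      = 2 * ((\<chi> i. \<Sum>j\<in>UNIV. M i j * (y - x) $ j) \<bullet> v)" for v
  proof -
    have "(\<Sum>i\<in>UNIV. \<Sum>j\<in>UNIV. (y - x) $ i * v $ j * M i j)
        = (\<Sum>i\<in>UNIV. \<Sum>j\<in>UNIV. v $ i * (y - x) $ j * M i j)"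
      by (subst sum.swap) (simp add: M mult_ac)
    moreover have "(\<Sum>i\<in>UNIV. \<Sum>j\<in>UNIV. v $ i * (y - x) $ j * M i j)
        = (\<chi> i. \<Sum>j\<in>UNIV. M i j * (y - x) $ j) \<bullet> v"
      by (simp add: inner_vec_def sum_distrib_left mult_ac)
    ultimately show ?thesis by (simp add: distrib_right sum.distrib)
  qed
  show "((\<lambda>y. paraboloid x t p M a b (y, s)) has_derivative
      (\<lambda>v. (p + (\<chi> i. \<Sum>j\<in>UNIV. M i j * (y - x) $ j)) \<bullet> v)) (at y)"
    unfolding paraboloid_def fst_conv snd_conv using q[unfolded eq]
    by (auto intro!: derivative_eq_intros simp: inner_add_left)
qed

lemma hess_paraboloid:
  fixes x :: "real ^ 'n::finite"
  assumes M: "\<And>i j. M i j = M j i"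
  shows "hess (paraboloid x t p M a b) (y, s) = M"
proof -
  have "dx i (dx j (paraboloid x t p M a b)) (y, s) = M i j" for i j
  proof -
    have dx: "dx j (paraboloid x t p M a b) (y, s) = p $ j + (\<Sum>k\<in>UNIV. M j k * (y - x) $ k)" for y
      using arg_cong[where f = "\<lambda>v. v $ j", OF grad_paraboloid[OF M, where x = x and t = t and p = p and a = a and b = b and y = y and s = s]]
      by (simp add: grad_def)
    have "((\<lambda>y. dx j (paraboloid x t p M a b) (y, s)) has_derivative
        (\<lambda>v. \<Sum>k\<in>UNIV. M j k * v $ k)) (at y)"
      unfolding dx by (auto intro!: derivative_eq_intros has_derivative_vec_nth)
    from dx_eqI[OF this]
    have "dx i (dx j (paraboloid x t p M a b)) (y, s) = (\<Sum>k\<in>UNIV. M j k * axis i 1 $ k)" .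
    also have "\<dots> = M j i" by (simp add: axis_def if_distrib cong: if_cong)
    finally show ?thesis using M by simp
  qed
  then show ?thesis by (simp add: hess_def fun_eq_iff)
qed

lemma dt_paraboloid: "dt (paraboloid x t p M a b) (y, s) = a + 2 * b * (s - t)"
  by (rule dt_eqI) (auto simp: paraboloid_def intro!: derivative_eq_intros)

text \<open>Jets carry arbitrary matrices, while the Hessian of a paraboloid equals its coefficient
  matrix when that matrix is symmetric. Passing to the symmetric part leaves the jet inequality
  unchanged.\<close>

lemma qform_symmetrize: "qform (\<lambda>i j. (X i j + X j i) / 2) v = qform X v"
proof -
  have "qform (\<lambda>i j. X j i) v = qform X v"
    unfolding qform_def by (subst sum.swap) (simp add: mult_ac)
  moreover have "qform (\<lambda>i j. (X i j + X j i) / 2) v = qform (\<lambda>i j. X i j + X j i) v / 2"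
    by (simp add: qform_def sum_divide_distrib)
  ultimately show ?thesis by (simp add: qform_add)
qed

lemma continuous_on_half_space_isCont:
  fixes w :: "(real ^ 'n::finite) \<times> real \<Rightarrow> real"
  assumes "continuous_on (UNIV \<times> {0<..}) w" "0 < t"
  shows "isCont w (x, t)"
proof -
  have "open (UNIV \<times> {0<..} :: ((real ^ 'n) \<times> real) set)" by (intro open_Times) auto
  then show ?thesis using assms by (simp add: continuous_on_eq_continuous_at)
qed

lemma eventually_nhds_less_of_isCont:
  fixes f :: "'a::t2_space \<Rightarrow> real"
  assumes "isCont f z" "f z < c"
  shows "\<forall>\<^sub>F y in nhds z. f y < c"
proof -
  have "(f \<longlongrightarrow> f z) (nhds z)"
    using assms(1) unfolding isCont_def tendsto_at_iff_tendsto_nhds .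
  then show ?thesis by (rule order_tendstoD(2)[OF _ assms(2)])
qed

text \<open>The test functions are the second order expansions of the jet with the admissible error
  \<open>\<gamma> (|\<xi>|\<^sup>2 + |\<tau>|)\<close> replaced by the smooth \<open>\<gamma> |\<xi>|\<^sup>2 + \<tau>\<^sup>2 / \<mu>\<close>. As \<open>\<mu> \<rightarrow> 0\<close> the touching point
  converges, while \<open>|\<tau>| \<le> 2 \<gamma> \<mu>\<close> keeps the time derivative within \<open>4 \<gamma>\<close> of that of the jet.\<close>

lemma perturbed_jet:
  fixes w :: "(real ^ 'n::finite) \<times> real \<Rightarrow> real"
  assumes sub: "\<And>k. sub_test (\<epsilon> k) \<phi> (wk k)"
    and cont_wk: "\<And>k. continuous_on (UNIV \<times> {0<..}) (wk k)"
    and cont_w: "continuous_on (UNIV \<times> {0<..}) w" and cont_\<phi>: "continuous_on UNIV \<phi>"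
    and unif: "\<And>K. compact K \<Longrightarrow> K \<subseteq> UNIV \<times> {0<..} \<Longrightarrow> uniform_limit K wk w sequentially"
    and t: "0 < t" and gt: "\<phi> x < w (x, t)" and J: "superjet w x t a p X" and \<gamma>: "0 < \<gamma>"
  shows "\<exists>k\<ge>N. \<exists>\<zeta> q. norm \<zeta> \<le> 1 \<and> norm (q - p) \<le> \<gamma> \<and> (q \<noteq> 0 \<longrightarrow> \<zeta> = q /\<^sub>R norm_eps (\<epsilon> k) q)
           \<and> a - 4 * \<gamma> \<le> curv \<zeta> X + 2 * \<gamma> * real CARD('n)"
proof -
  \<comment> \<open>Half of the form of \<open>M\<close> is half of that of \<open>X\<close> plus
    \<gamma> |v|^2. The jet is used below with error \<gamma>/2, so a strict margin of
    (\<gamma>/2)|v|^2 remains.\<close>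
  define M where "M i j = (X i j + X j i) / 2 + 2 * \<gamma> * kron i j" for i j
  have M: "M i j = M j i" for i j by (auto simp: M_def kron_def)
  have qM: "qform M v = qform X v + 2 * \<gamma> * (norm v)\<^sup>2" for v
    unfolding M_def qform_add by (simp add: qform_symmetrize qform_kron)
  have cM: "curv \<zeta> M \<le> curv \<zeta> X + 2 * \<gamma> * real CARD('n)" for \<zeta>
  proof -
    have "curv \<zeta> M = curv \<zeta> X + 2 * \<gamma> * real CARD('n) - 2 * \<gamma> * (norm \<zeta>)\<^sup>2"
      unfolding curv_eq qM by (simp add: M_def sum.distrib kron_def)
    moreover have "0 \<le> 2 * \<gamma> * (norm \<zeta>)\<^sup>2" using \<gamma> by simp
    ultimately show ?thesis by linarith
  qed
  define G where "G y = p + (\<chi> i. \<Sum>j\<in>UNIV. M i j * (y - x) $ j)" for y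
  define d where "d = (w (x, t) - \<phi> x) / 2"
  have d: "d > 0" "\<phi> x - w (x, t) = - (2 * d)" using gt by (simp_all add: d_def field_simps)
  have isw: "isCont w (x, t)" by (rule continuous_on_half_space_isCont[OF cont_w t])
  have is\<phi>: "isCont (\<lambda>z. \<phi> (fst z)) (x, t)"
    by (rule isCont_o2[where g = \<phi>])
      (use cont_\<phi> in \<open>auto simp: continuous_on_eq_continuous_at intro: isCont_fst\<close>)
  have "\<forall>\<^sub>F z in nhds (x, t). w z \<le> w (x, t) + p \<bullet> (fst z - x) + qform X (fst z - x) / 2
      + a * (snd z - t) + \<gamma> / 2 * ((norm (fst z - x))\<^sup>2 + \<bar>snd z - t\<bar>)"
    using J[unfolded superjet_def case_prod_unfold, rule_format, of "\<gamma> / 2"] \<gamma> by simp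
  moreover have "\<forall>\<^sub>F z in nhds (x, t). norm (G (fst z) - p) < \<gamma>"
  proof (rule eventually_nhds_less_of_isCont)
    show "isCont (\<lambda>z. norm (G (fst z) - p)) (x, t)"
      unfolding G_def isCont_def by (intro tendsto_intros)
    show "norm (G (fst (x, t)) - p) < \<gamma>" using \<gamma> by (simp add: G_def zero_vec_def[symmetric])
  qed
  moreover have "\<forall>\<^sub>F z in nhds (x, t). \<phi> (fst z) - w z < - d"
    by (rule eventually_nhds_less_of_isCont) (use isw is\<phi> d in \<open>auto intro!: continuous_intros\<close>)
  moreover have "\<forall>\<^sub>F z in nhds (x, t). - snd z < 0"
    by (rule eventually_nhds_less_of_isCont) (use t in \<open>auto intro!: continuous_intros\<close>)
  ultimately have "\<forall>\<^sub>F z in nhds (x, t). w z \<le> w (x, t) + p \<bullet> (fst z - x) + qform X (fst z - x) / 2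
      + a * (snd z - t) + \<gamma> / 2 * ((norm (fst z - x))\<^sup>2 + \<bar>snd z - t\<bar>)
      \<and> norm (G (fst z) - p) < \<gamma> \<and> \<phi> (fst z) - w z < - d \<and> - snd z < 0"
    by eventually_elim simp
  then obtain R where R: "R > 0" and near: "\<And>z. dist z (x, t) < R \<Longrightarrow>
      w z \<le> w (x, t) + p \<bullet> (fst z - x) + qform X (fst z - x) / 2
      + a * (snd z - t) + \<gamma> / 2 * ((norm (fst z - x))\<^sup>2 + \<bar>snd z - t\<bar>)
      \<and> norm (G (fst z) - p) < \<gamma> \<and> \<phi> (fst z) - w z < - d \<and> - snd z < 0"
    unfolding eventually_nhds_metric by blast
  define \<rho> where "\<rho> = R / 2"
  have \<rho>: "\<rho> > 0" "\<rho> < R" using R by (auto simp: \<rho>_def)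
  \<comment> \<open>Anticipates the bounds |\<tau>| \<le> 2\<gamma>\<mu> and |\<xi>|^2 \<le>
    6\<gamma>\<mu> derived below: both displacements then stay below \<rho>/2, and the maximum lies
    in the interior of the ball.\<close>
  define \<mu> where "\<mu> = min (\<rho> / (8 * \<gamma>)) (\<rho>\<^sup>2 / (32 * \<gamma>))"
  have \<mu>: "\<mu> > 0" using \<rho> \<gamma> by (simp add: \<mu>_def)
  have "\<mu> \<le> \<rho> / (8 * \<gamma>)" "\<mu> \<le> \<rho>\<^sup>2 / (32 * \<gamma>)" by (auto simp: \<mu>_def)
  then have \<mu>1: "\<gamma> * \<mu> \<le> \<rho> / 8" and \<mu>2: "\<gamma> * \<mu> \<le> \<rho>\<^sup>2 / 32"
    using \<gamma> by (auto simp: field_simps)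
  \<comment> \<open>Replacing \<open>wk k\<close> by w at the two points costs 2\<kappa> \<le>
    \<gamma>^2 \<mu>, and \<kappa> \<le> d keeps \<open>wk k\<close> above the obstacle, since w
    exceeds \<phi> by more than d on the ball.\<close>
  define \<kappa> where "\<kappa> = min (\<gamma>\<^sup>2 * \<mu> / 2) d"
  have \<kappa>: "\<kappa> > 0" "\<kappa> \<le> \<gamma>\<^sup>2 * \<mu> / 2" "\<kappa> \<le> d" using \<gamma> \<mu> d by (auto simp: \<kappa>_def)
  define B where "B = cball (x, t) \<rho>"
  have nearB: "dist z (x, t) < R" if "z \<in> B" for z
    using that \<rho> by (simp add: B_def dist_commute)
  have Bsub: "B \<subseteq> UNIV \<times> {0<..}"
  proof
    fix z assume "z \<in> B"
    from near[OF nearB[OF this]] show "z \<in> UNIV \<times> {0<..}" by (cases z) simp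
  qed
  have Bc: "compact B" by (simp add: B_def)
  have "\<forall>\<^sub>F k in sequentially. (\<forall>z\<in>B. dist (wk k z) (w z) < \<kappa>) \<and> k \<ge> N"
    using unif[OF Bc Bsub] \<kappa> by (intro eventually_conj eventually_ge_at_top) (auto simp: uniform_limit_iff)
  then obtain k where k: "\<And>z. z \<in> B \<Longrightarrow> dist (wk k z) (w z) < \<kappa>" "k \<ge> N"
    using eventually_happens'[OF sequentially_bot] by blast
  define P where "P = paraboloid x t p M a (1 / \<mu>)"
  have smP: "smooth P" unfolding P_def by (rule smooth_paraboloid)
  have "continuous_on B (\<lambda>z. wk k z - P z)"
    using continuous_on_subset[OF cont_wk Bsub] smP[unfolded smooth_def, rule_format, of 0]
    by (intro continuous_on_diff) (auto intro: continuous_on_subset)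
  moreover have x_in: "(x, t) \<in> B" using \<rho> by (simp add: B_def)
  ultimately obtain z1 where z1: "z1 \<in> B" and max: "\<And>z. z \<in> B \<Longrightarrow> wk k z - P z \<le> wk k z1 - P z1"
    using continuous_attains_sup[OF Bc] by blast
  obtain x1 t1 where z1e: "z1 = (x1, t1)" by fastforce
  define \<xi> where "\<xi> = x1 - x"
  define \<tau> where "\<tau> = t1 - t"
  note n1 = near[OF nearB[OF z1], unfolded z1e fst_conv snd_conv, folded \<xi>_def \<tau>_def]
  have Pz1: "P (x1, t1) = p \<bullet> \<xi> + qform X \<xi> / 2 + \<gamma> * (norm \<xi>)\<^sup>2 + a * \<tau> + \<tau>\<^sup>2 / \<mu>"
    by (simp add: P_def paraboloid_def qM \<xi>_def \<tau>_def)
  have P0: "P (x, t) = 0" by (simp add: P_def paraboloid_def)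
  have w1: "\<bar>wk k (x1, t1) - w (x1, t1)\<bar> < \<kappa>" "\<bar>wk k (x, t) - w (x, t)\<bar> < \<kappa>"
    using k(1)[OF z1] k(1)[OF x_in] by (auto simp: dist_norm z1e)
  \<comment> \<open>Maximality gives a lower bound for w - P at the touching point, the jet an upper
    one; comparing them leaves only the margins in \<xi> and \<tau>.\<close>
  have key: "\<gamma> / 2 * (norm \<xi>)\<^sup>2 + \<tau>\<^sup>2 / \<mu> \<le> \<gamma> / 2 * \<bar>\<tau>\<bar> + \<gamma>\<^sup>2 * \<mu>"
  proof -
    have "w (x1, t1) - P (x1, t1) \<ge> w (x, t) - 2 * \<kappa>"
      using max[OF x_in] w1 P0 unfolding z1e by linarith
    moreover have "w (x1, t1) \<le> w (x, t) + p \<bullet> \<xi> + qform X \<xi> / 2 + a * \<tau> + \<gamma> / 2 * (norm \<xi>)\<^sup>2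
        + \<gamma> / 2 * \<bar>\<tau>\<bar>" using n1 by (simp add: distrib_left)
    moreover have "\<gamma> * (norm \<xi>)\<^sup>2 = \<gamma> / 2 * (norm \<xi>)\<^sup>2 + \<gamma> / 2 * (norm \<xi>)\<^sup>2" by simp
    ultimately show ?thesis using \<kappa>(2) unfolding Pz1 by linarith
  qed
  \<comment> \<open>For |\<tau>| > 2\<gamma>\<mu> the term \<tau>^2/\<mu> is at least
    2\<gamma>|\<tau>|, which dominates the right-hand side of \<open>key\<close>.\<close>
  have \<tau>: "\<bar>\<tau>\<bar> \<le> 2 * \<gamma> * \<mu>"
  proof (rule ccontr)
    assume "\<not> \<bar>\<tau>\<bar> \<le> 2 * \<gamma> * \<mu>"
    then have big: "2 * \<gamma> * \<mu> < \<bar>\<tau>\<bar>" by simp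
    have "\<tau>\<^sup>2 / \<mu> = \<bar>\<tau>\<bar> * (\<bar>\<tau>\<bar> / \<mu>)" by (simp add: power2_eq_square)
    also have "\<dots> \<ge> \<bar>\<tau>\<bar> * (2 * \<gamma>)" using big \<mu> by (intro mult_left_mono) (auto simp: field_simps)
    finally have "\<bar>\<tau>\<bar> * (2 * \<gamma>) \<le> \<gamma> / 2 * \<bar>\<tau>\<bar> + \<gamma>\<^sup>2 * \<mu>"
      using key \<gamma> zero_le_power2[of "norm \<xi>"] mult_nonneg_nonneg[of "\<gamma> / 2" "(norm \<xi>)\<^sup>2"] by linarith
    then have "\<gamma> * (2 * \<bar>\<tau>\<bar>) \<le> \<gamma> * (\<bar>\<tau>\<bar> / 2 + \<gamma> * \<mu>)"
      by (simp add: power2_eq_square distrib_left mult_ac)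
    then have "2 * \<bar>\<tau>\<bar> \<le> \<bar>\<tau>\<bar> / 2 + \<gamma> * \<mu>"
      using \<gamma> by (rule mult_left_le_imp_le)
    then have "\<bar>\<tau>\<bar> \<le> \<gamma> * \<mu>" by linarith
    moreover have "\<gamma> * \<mu> > 0" using \<gamma> \<mu> by simp
    ultimately show False using big by simp
  qed
  have \<xi>: "(norm \<xi>)\<^sup>2 \<le> 6 * (\<gamma> * \<mu>)"
  proof -
    have "\<gamma> / 2 * \<bar>\<tau>\<bar> \<le> \<gamma> / 2 * (2 * \<gamma> * \<mu>)" using \<tau> \<gamma> by (intro mult_left_mono) auto
    moreover have "\<tau>\<^sup>2 / \<mu> \<ge> 0" using \<mu> by simp
    ultimately have "\<gamma> / 2 * (norm \<xi>)\<^sup>2 \<le> \<gamma> / 2 * (2 * \<gamma> * \<mu>) + \<gamma>\<^sup>2 * \<mu>" using key by linarith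
    also have "\<dots> = \<gamma> / 2 * (4 * (\<gamma> * \<mu>))" by (simp add: power2_eq_square algebra_simps)
    finally have "(norm \<xi>)\<^sup>2 \<le> 4 * (\<gamma> * \<mu>)" using \<gamma> by simp
    moreover have "\<gamma> * \<mu> > 0" using \<gamma> \<mu> by simp
    ultimately show ?thesis by linarith
  qed
  have "dist z1 (x, t) < \<rho>"
  proof -
    have "(norm \<xi>)\<^sup>2 < (\<rho> / 2)\<^sup>2"
    proof -
      have "6 * (\<gamma> * \<mu>) < \<rho>\<^sup>2 / 4" using \<mu>2 zero_less_power[OF \<rho>(1), of 2] by linarith
      then show ?thesis using \<xi> by (simp add: power_divide)
    qed
    then have "norm \<xi> < \<rho> / 2" by (rule power_less_imp_less_base) (use \<rho>(1) in simp)
    moreover have "\<bar>\<tau>\<bar> < \<rho> / 2" using \<tau> \<mu>1 \<rho>(1) by linarith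
    ultimately show ?thesis
      using dist_Pair_le[of x1 t1 x t] by (simp add: z1e dist_norm \<xi>_def \<tau>_def)
  qed
  then have "\<forall>\<^sub>F z in nhds z1. z \<in> ball (x, t) \<rho>"
    by (intro eventually_nhds_in_open) (auto simp: dist_commute)
  then have loc: "local_max_at (\<lambda>z. wk k z - P z) (x1, t1)"
    unfolding local_max_at_def z1e using max unfolding z1e
    by (auto elim!: eventually_mono simp: B_def)
  have "\<phi> x1 < wk k (x1, t1)" using n1 w1 \<kappa>(3) by linarith
  moreover have "0 < t1" using n1 by (simp add: \<tau>_def)
  ultimately obtain \<zeta> where \<zeta>: "norm \<zeta> \<le> 1"
    "grad P (x1, t1) \<noteq> 0 \<longrightarrow> \<zeta> = grad P (x1, t1) /\<^sub>R norm_eps (\<epsilon> k) (grad P (x1, t1))"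
    "dt P (x1, t1) \<le> curv \<zeta> (hess P (x1, t1))"
    using sub[of k] smP loc unfolding sub_test_def by blast
  have gP: "grad P (x1, t1) = G x1" unfolding P_def G_def by (rule grad_paraboloid[OF M])
  have "2 * (1 / \<mu>) * \<tau> \<ge> - (4 * \<gamma>)"
  proof -
    have "- (2 * \<gamma> * \<mu>) \<le> \<tau>" using \<tau> by linarith
    then show ?thesis using \<mu> by (simp add: field_simps)
  qed
  then have "a - 4 * \<gamma> \<le> dt P (x1, t1)" unfolding P_def dt_paraboloid \<tau>_def[symmetric] by linarith
  also have "\<dots> \<le> curv \<zeta> M" using \<zeta>(3) unfolding P_def hess_paraboloid[OF M] .
  also note cM[of \<zeta>]
  finally have "a - 4 * \<gamma> \<le> curv \<zeta> X + 2 * \<gamma> * real CARD('n)" .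
  then show ?thesis using \<zeta> k(2) n1 unfolding gP by (metis less_imp_le)
qed

text \<open>Perturbed jets with \<gamma> -> 0 yield gradients q -> p and directions in the unit
  ball; a subsequence of the directions converges. If p is nonzero the q are eventually nonzero, so
  the limit direction is p/|p|. The conclusion concerns jets although the assumption concerns smooth
  tests, so even a constant sequence gives something new.\<close>

lemma sub_test_limit:
  fixes w :: "(real ^ 'n::finite) \<times> real \<Rightarrow> real"
  assumes sub: "\<And>k. sub_test (\<epsilon> k) \<phi> (wk k)" and \<epsilon>: "\<epsilon> \<longlonglongrightarrow> 0"
    and cont_wk: "\<And>k. continuous_on (UNIV \<times> {0<..}) (wk k)"
    and cont_w: "continuous_on (UNIV \<times> {0<..}) w" and cont_\<phi>: "continuous_on UNIV \<phi>"
    and unif: "\<And>K. compact K \<Longrightarrow> K \<subseteq> UNIV \<times> {0<..} \<Longrightarrow> uniform_limit K wk w sequentially"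
  shows "sub_jet 0 \<phi> w"
  unfolding sub_jet_def
proof (intro allI impI, elim conjE)
  fix x t a p X
  assume t: "0 < t" and gt: "\<phi> x < w (x, t)" and J: "superjet w x t a p X"
  define \<gamma> :: "nat \<Rightarrow> real" where "\<gamma> m = inverse (real (Suc m))" for m
  have \<gamma>: "\<gamma> m > 0" for m by (simp add: \<gamma>_def)
  have \<gamma>0: "\<gamma> \<longlonglongrightarrow> 0" unfolding \<gamma>_def by (rule LIMSEQ_inverse_real_of_nat)
  have "\<forall>m. \<exists>k \<zeta> q. k \<ge> m \<and> norm \<zeta> \<le> 1 \<and> norm (q - p) \<le> \<gamma> m
      \<and> (q \<noteq> 0 \<longrightarrow> \<zeta> = q /\<^sub>R norm_eps (\<epsilon> k) q)
      \<and> a - 4 * \<gamma> m \<le> curv \<zeta> X + 2 * \<gamma> m * real CARD('n)"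
    using perturbed_jet[OF sub cont_wk cont_w cont_\<phi> unif t gt J \<gamma>] by blast
  then obtain k \<zeta> q where *: "\<And>m. k m \<ge> m" "\<And>m. norm (\<zeta> m) \<le> 1" "\<And>m. norm (q m - p) \<le> \<gamma> m"
    "\<And>m. q m \<noteq> 0 \<Longrightarrow> \<zeta> m = q m /\<^sub>R norm_eps (\<epsilon> (k m)) (q m)"
    "\<And>m. a - 4 * \<gamma> m \<le> curv (\<zeta> m) X + 2 * \<gamma> m * real CARD('n)"
    by metis
  have q: "q \<longlonglongrightarrow> p"
  proof (rule Lim_null[THEN iffD2], rule Lim_null_comparison)
    show "\<forall>\<^sub>F m in sequentially. norm (q m - p) \<le> \<gamma> m" using *(3) by simp
  qed (rule \<gamma>0)
  have \<epsilon>k: "(\<lambda>m. \<epsilon> (k m)) \<longlonglongrightarrow> 0"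
    by (rule filterlim_compose[OF \<epsilon>]) (use *(1) in \<open>auto intro: filterlim_at_top_mono filterlim_ident\<close>)
  have "\<forall>m. \<zeta> m \<in> cball 0 1" using *(2) by simp
  then obtain l r where l: "l \<in> cball 0 1" and r: "strict_mono r" and lim: "(\<zeta> \<circ> r) \<longlonglongrightarrow> l"
    using compact_cball[of "0 :: real ^ 'n" 1] unfolding compact_def by metis
  have lim1: "(\<lambda>m. curv ((\<zeta> \<circ> r) m) X + 2 * (\<gamma> \<circ> r) m * real CARD('n)) \<longlonglongrightarrow>
      curv l X + 2 * 0 * real CARD('n)"
    unfolding curv_def using lim LIMSEQ_subseq_LIMSEQ[OF \<gamma>0 r] by (intro tendsto_intros)
  have lim2: "(\<lambda>m. a - 4 * (\<gamma> \<circ> r) m) \<longlonglongrightarrow> a - 4 * 0"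
    using LIMSEQ_subseq_LIMSEQ[OF \<gamma>0 r] by (intro tendsto_intros)
  have "a - 4 * 0 \<le> curv l X + 2 * 0 * real CARD('n)"
    by (rule LIMSEQ_le[OF lim2 lim1]) (use *(5) in auto)
  moreover have "l = p /\<^sub>R norm_eps 0 p" if "p \<noteq> 0"
  proof -
    have "(\<lambda>m. norm_eps (\<epsilon> (k m)) (q m)) \<longlonglongrightarrow> norm_eps 0 p"
      unfolding norm_eps_def by (intro tendsto_intros \<epsilon>k q)
    then have "(\<lambda>m. q m /\<^sub>R norm_eps (\<epsilon> (k m)) (q m)) \<longlonglongrightarrow> p /\<^sub>R norm_eps 0 p"
      using that q by (intro tendsto_intros) auto
    moreover have "\<forall>\<^sub>F m in sequentially. q m \<noteq> 0"
      using tendsto_imp_eventually_ne[OF q that] .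
    then have "\<forall>\<^sub>F m in sequentially. q m /\<^sub>R norm_eps (\<epsilon> (k m)) (q m) = \<zeta> m"
      using *(4) by (auto elim!: eventually_mono)
    ultimately have "\<zeta> \<longlonglongrightarrow> p /\<^sub>R norm_eps 0 p" by (rule Lim_transform_eventually)
    from LIMSEQ_subseq_LIMSEQ[OF this r] lim show ?thesis by (blast intro: LIMSEQ_unique)
  qed
  ultimately show "\<exists>\<zeta>. norm \<zeta> \<le> 1 \<and> (p \<noteq> 0 \<longrightarrow> \<zeta> = p /\<^sub>R norm_eps 0 p) \<and> a \<le> curv \<zeta> X"
    using l by auto
qed

section \<open>Maxima of periodic functions\<close>

lemma lattice_representative:
  fixes x :: "real ^ 'n::finite"
  obtains k :: "real ^ 'n" where "\<And>i. k $ i \<in> \<int>" "x + k \<in> cbox 0 1"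
proof
  show "(\<chi> i. - of_int \<lfloor>x $ i\<rfloor>) $ i \<in> \<int>" for i :: 'n by simp
  have "0 \<le> x $ i - of_int \<lfloor>x $ i\<rfloor>" "x $ i - of_int \<lfloor>x $ i\<rfloor> \<le> 1" for i by linarith+
  then show "x + (\<chi> i. - of_int \<lfloor>x $ i\<rfloor>) \<in> cbox 0 1" by (simp add: mem_box_cart)
qed

lemma periodicD: "periodic f \<Longrightarrow> (\<And>i. k $ i \<in> \<int>) \<Longrightarrow> f (x + k) = f x"
  by (simp add: periodic_def)

text \<open>Periodicity brings x into the unit cube, and \<open>far\<close> confines s to a ball,
  enlarged if necessary to contain s0. What remains is a continuous function on a compact
  set.\<close>

lemma periodic_attains_max:
  fixes F :: "(real ^ 'n::finite) \<times> 'b::euclidean_space \<Rightarrow> real"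
  assumes S: "closed S" "s0 \<in> S" and cont: "continuous_on (UNIV \<times> S) F"
    and per: "\<And>s. s \<in> S \<Longrightarrow> periodic (\<lambda>x. F (x, s))"
    and far: "\<And>x s. s \<in> S \<Longrightarrow> R < norm s \<Longrightarrow> F (x, s) \<le> F (0, s0)"
  obtains x s where "s \<in> S" "\<And>y s'. s' \<in> S \<Longrightarrow> F (y, s') \<le> F (x, s)"
proof -
  define Q where "Q = (cbox 0 1 :: (real ^ 'n) set) \<times> (S \<inter> cball 0 (max R (norm s0)))"
  have "compact Q" unfolding Q_def
    by (intro compact_Times compact_cbox closed_Int_compact S compact_cball)
  moreover have mem0: "(0, s0) \<in> Q" using S by (simp add: Q_def mem_box_cart)
  moreover have "continuous_on Q F" by (rule continuous_on_subset[OF cont]) (auto simp: Q_def)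
  ultimately obtain z where z: "z \<in> Q" and max: "\<And>y. y \<in> Q \<Longrightarrow> F y \<le> F z"
    using continuous_attains_sup[of Q F] by blast
  have "F (y, s') \<le> F z" if s': "s' \<in> S" for y s'
  proof (cases "norm s' \<le> max R (norm s0)")
    case True
    obtain k :: "real ^ 'n" where k: "\<And>i. k $ i \<in> \<int>" "y + k \<in> cbox 0 1"
      using lattice_representative[of y] by blast
    have "F (y, s') = F (y + k, s')" using periodicD[OF per[OF s'] k(1)] by simp
    also have "\<dots> \<le> F z" using k(2) s' True by (intro max) (simp add: Q_def)
    finally show ?thesis .
  next
    case False
    then have "F (y, s') \<le> F (0, s0)" using s' by (intro far) auto
    also have "\<dots> \<le> F z" using mem0 by (rule max)
    finally show ?thesis .
  qed
  moreover have "snd z \<in> S" using z by (auto simp: Q_def)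
  ultimately show ?thesis using that[of "snd z" "fst z"] by simp
qed

lemma periodic_bounded:
  fixes f :: "real ^ 'n::finite \<Rightarrow> real"
  assumes "periodic f" "continuous_on UNIV f"
  obtains B where "\<And>x. \<bar>f x\<bar> \<le> B"
proof -
  have "compact (f ` cbox 0 1)"
    using assms(2) by (intro compact_continuous_image compact_cbox continuous_on_subset[OF assms(2)]) auto
  from compact_imp_bounded[OF this] obtain B where B: "\<And>x. x \<in> cbox 0 1 \<Longrightarrow> \<bar>f x\<bar> \<le> B"
    by (auto simp: bounded_iff)
  have "\<bar>f x\<bar> \<le> B" for x
  proof -
    obtain k :: "real ^ 'n" where k: "\<And>i. k $ i \<in> \<int>" "x + k \<in> cbox 0 1"
      using lattice_representative[of x] by blast
    then show ?thesis using B[OF k(2)] periodicD[OF assms(1) k(1)] by simp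
  qed
  then show ?thesis using that by blast
qed

text \<open>Uniform continuity handles nearby points. At distance at least e the penalty K e^4
  already outweighs the oscillation, which is at most 2B.\<close>

lemma periodic_quartic_modulus:
  fixes f :: "real ^ 'n::finite \<Rightarrow> real"
  assumes per: "periodic f" and cont: "continuous_on UNIV f" and \<eta>: "0 < \<eta>"
  obtains K0 where "0 < K0" "\<And>K x y. K0 \<le> K \<Longrightarrow> f x - f y - K * norm (x - y) ^ 4 \<le> \<eta>"
proof -
  obtain B where B: "\<And>x. \<bar>f x\<bar> \<le> B" using periodic_bounded[OF per cont] by blast
  have B0: "0 \<le> B" using B[of 0] by linarith
  \<comment> \<open>A ball containing the unit cube and all points within distance 1 of it: only x
    is moved into the cube, and y follows by the same lattice vector.\<close>
  define C where "C = (cball 0 (norm (1 :: real ^ 'n) + 1) :: (real ^ 'n) set)"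
  have "uniformly_continuous_on C f"
    by (rule compact_uniformly_continuous) (auto simp: C_def intro: continuous_on_subset[OF cont])
  then obtain d where d: "d > 0" "\<And>x y. x \<in> C \<Longrightarrow> y \<in> C \<Longrightarrow> dist x y < d \<Longrightarrow> dist (f x) (f y) < \<eta>"
    using \<eta> unfolding uniformly_continuous_on_def by metis
  define e where "e = min d 1"
  have e: "0 < e" using d by (simp add: e_def)
  have near: "f x - f y \<le> \<eta>" if "norm (x - y) < e" for x y
  proof -
    obtain k :: "real ^ 'n" where k: "\<And>i. k $ i \<in> \<int>" "x + k \<in> cbox 0 1"
      using lattice_representative[of x] by blast
    have "norm (x + k) \<le> norm (1 :: real ^ 'n)"
      using k(2) by (intro norm_le_componentwise_cart) (auto simp: mem_box_cart)
    moreover have "norm (y + k) \<le> norm (x + k) + norm (x - y)"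
      using norm_triangle_ineq4[of "x + k" "x - y"] by (simp add: add.commute)
    ultimately have "x + k \<in> C" "y + k \<in> C" using that by (auto simp: C_def e_def)
    then have "dist (f (x + k)) (f (y + k)) < \<eta>"
      using that by (intro d(2)) (auto simp: e_def dist_norm)
    then show ?thesis by (simp add: periodicD[OF per k(1)] dist_norm)
  qed
  show ?thesis
  proof
    show "0 < 2 * B / e ^ 4 + 1" using B0 e by (simp add: add_nonneg_pos)
    fix K x y assume K: "2 * B / e ^ 4 + 1 \<le> K"
    have "0 \<le> 2 * B / e ^ 4" using B0 e by simp
    then have K0: "0 \<le> K" using K by linarith
    show "f x - f y - K * norm (x - y) ^ 4 \<le> \<eta>"
    proof (cases "norm (x - y) < e")
      case True
      have "0 \<le> K * norm (x - y) ^ 4" using K0 by simp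
      then show ?thesis using near[OF True] by linarith
    next
      case False
      have "2 * B / e ^ 4 \<le> K" using K by linarith
      then have "2 * B \<le> K * e ^ 4" using e by (simp add: field_simps)
      also have "\<dots> \<le> K * norm (x - y) ^ 4"
        using False K0 e by (intro mult_left_mono power_mono) auto
      finally show ?thesis using B[of x] B[of y] \<eta> by linarith
    qed
  qed
qed

section \<open>Doubling of the space variable on the torus\<close>

lemma continuous_on_shift:
  fixes b :: "(real ^ 'n::finite) \<times> real \<Rightarrow> real"
  assumes "continuous_on (UNIV \<times> I) b"
  shows "continuous_on (UNIV \<times> UNIV \<times> I) (\<lambda>(x, z, s). b (x - z, s))"
  unfolding case_prod_unfold
  by (rule continuous_on_compose2[OF assms]) (auto intro!: continuous_intros)

text \<open>The penalty is not periodic in x' - y', so compactness in that variable comes from its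
  growth, while \<delta> s gives compactness in time when I is unbounded.\<close>

lemma doubling_max:
  fixes a b :: "(real ^ 'n::finite) \<times> real \<Rightarrow> real"
  assumes I: "closed I" "0 \<in> I" "I \<subseteq> {0..}"
    and a: "continuous_on (UNIV \<times> I) a" "\<And>s. s \<in> I \<Longrightarrow> periodic (\<lambda>x. a (x, s))"
    and b: "continuous_on (UNIV \<times> I) b" "\<And>s. s \<in> I \<Longrightarrow> periodic (\<lambda>x. b (x, s))"
    and B: "\<And>x y s. s \<in> I \<Longrightarrow> a (x, s) - b (y, s) \<le> B"
    and K: "0 < K" and \<delta>: "0 < \<delta>"
  obtains x y t where "t \<in> I"
    "\<And>x' y' s. s \<in> I \<Longrightarrow> a (x', s) - b (y', s) - K * norm (x' - y') ^ 4 - \<delta> * s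
        \<le> a (x, t) - b (y, t) - K * norm (x - y) ^ 4 - \<delta> * t"
proof -
  \<comment> \<open>In the variables x and z = x - y the function is periodic in x with z and s
    fixed, the setting of \<open>periodic_attains_max\<close>.\<close>
  define F where "F = (\<lambda>(x, z, s). a (x, s) - b (x - z, s) - K * norm z ^ 4 - \<delta> * s)"
  define c where "c = a (0, 0) - b (0, 0)"
  have c: "c \<le> B" using B I by (simp add: c_def)
  \<comment> \<open>Thresholds beyond which one penalty alone exceeds B - c, where c is the value at
    the origin. In space |z| \<ge> 1 + \<alpha> is required, so that |z|^4 \<ge> |z| \<ge>
    \<alpha>.\<close>
  define \<alpha> where "\<alpha> = (B - c) / K"
  define \<beta> where "\<beta> = (B - c) / \<delta>"
  define R where "R = 2 + 2 * \<alpha> + 2 * \<beta>"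
  have pos: "0 \<le> \<alpha>" "0 \<le> \<beta>" using c K \<delta> by (auto simp: \<alpha>_def \<beta>_def)
  have \<alpha>\<beta>: "B - c = K * \<alpha>" "B - c = \<delta> * \<beta>" using K \<delta> by (auto simp: \<alpha>_def \<beta>_def)
  obtain x p where p: "p \<in> UNIV \<times> I" and max: "\<And>y p'. p' \<in> UNIV \<times> I \<Longrightarrow> F (y, p') \<le> F (x, p)"
  proof (rule periodic_attains_max[of "UNIV \<times> I" "(0, 0)" F R])
    show "closed ((UNIV :: (real ^ 'n) set) \<times> I)" using I by (intro closed_Times) auto
    show "(0, 0) \<in> (UNIV :: (real ^ 'n) set) \<times> I" using I by simp
    have "continuous_on (UNIV \<times> UNIV \<times> I) (\<lambda>(x, z :: real ^ 'n, s). a (x, s))"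
      unfolding case_prod_unfold
      by (rule continuous_on_compose2[OF a(1)]) (auto intro!: continuous_intros)
    then show "continuous_on (UNIV \<times> UNIV \<times> I) F"
      using continuous_on_shift[OF b(1)] unfolding F_def case_prod_unfold
      by (intro continuous_intros)
    show "periodic (\<lambda>x. F (x, s))" if "s \<in> UNIV \<times> I" for s
      unfolding periodic_def
    proof (intro allI impI)
      fix x k :: "real ^ 'n" assume k: "\<forall>i. k $ i \<in> \<int>"
      obtain z t where zt: "s = (z, t)" "t \<in> I" using \<open>s \<in> UNIV \<times> I\<close> by auto
      have "b (x + k - z, t) = b (x - z, t)"
        using periodicD[OF b(2)[OF zt(2)], of k "x - z"] k by (simp add: algebra_simps)
      then show "F (x + k, s) = F (x, s)"
        using periodicD[OF a(2)[OF zt(2)], of k x] k by (simp add: F_def zt)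
    qed
    show "F (y, p) \<le> F (0, 0, 0)" if p: "p \<in> UNIV \<times> I" and far: "R < norm p" for y p
    proof -
      obtain z s where zs: "p = (z, s)" by fastforce
      have s: "s \<in> I" "0 \<le> s" using p I zs by auto
      have "norm p \<le> norm z + \<bar>s\<bar>" using norm_Pair_le[of z s] zs by simp
      then have "1 + \<alpha> \<le> norm z \<or> \<beta> \<le> s"
        using far pos s unfolding R_def by (intro disjCI) linarith
      then consider "1 + \<alpha> \<le> norm z" | "\<beta> \<le> s" by blast
      then have "B - c \<le> K * norm z ^ 4 + \<delta> * s"
      proof cases
        case 1
        have "\<alpha> \<le> norm z" "1 \<le> norm z" using 1 pos by linarith+
        then have "\<alpha> \<le> norm z ^ 4" using self_le_power[of "norm z" 4] by linarith
        then have "B - c \<le> K * norm z ^ 4" using K by (simp add: \<alpha>\<beta>(1))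
        then show ?thesis using s \<delta> by (simp add: add_increasing2)
      next
        case 2
        then have "B - c \<le> \<delta> * s" using \<delta> by (simp add: \<alpha>\<beta>(2))
        then show ?thesis using K by (simp add: add_increasing)
      qed
      then show ?thesis using B[OF s(1), of y "y - z"] by (simp add: F_def zs c_def)
    qed
  qed blast
  obtain z t where zt: "p = (z, t)" by fastforce
  show ?thesis
  proof
    show "t \<in> I" using p zt by simp
    fix x' y' s assume "s \<in> I"
    then show "a (x', s) - b (y', s) - K * norm (x' - y') ^ 4 - \<delta> * s
        \<le> a (x, t) - b (x - z, t) - K * norm (x - (x - z)) ^ 4 - \<delta> * t"
      using max[of "(x' - y', s)" x'] by (simp add: F_def zt)
  qed
qed

section \<open>Comparison with classical solutions\<close>

text \<open>Along y + s v the second derivative of |y + s v - a|^4 at s = 0 is 8 (z . v)^2 + 4 |z|^2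
  |v|^2 with z = y - a; Cauchy-Schwarz turns 8 + 4 into the constant 12.\<close>

lemma quartic_touch:
  assumes u: "C21 u" and t: "0 < t"
    and min: "\<And>y'. u (y, t) + K * norm (y - a) ^ 4 \<le> u (y', t) + K * norm (y' - a) ^ 4"
    and K: "0 < K"
  shows "grad u (y, t) = - ((4 * K * (norm (y - a))\<^sup>2) *\<^sub>R (y - a))"
    and "- (12 * K * (norm (y - a))\<^sup>2 * (norm v)\<^sup>2) \<le> qform (hess u (y, t)) v"
proof -
  define z where "z = y - a"
  have *: "- (grad u (y, t) \<bullet> v) - 4 * K * (z \<bullet> z) * (z \<bullet> v) = 0 \<and>
      - qform (hess u (y, t)) v - K * (8 * (z \<bullet> v)\<^sup>2 + 4 * (z \<bullet> z) * (v \<bullet> v)) \<le> 0" for v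
  proof -
    define q where "q s = z \<bullet> z + 2 * s * (z \<bullet> v) + s\<^sup>2 * (v \<bullet> v)" for s
    have nq: "norm (y + s *\<^sub>R v - a) ^ 4 = (q s)\<^sup>2" for s
    proof -
      have "y + s *\<^sub>R v - a = z + s *\<^sub>R v" by (simp add: z_def)
      then have "(norm (y + s *\<^sub>R v - a))\<^sup>2 = q s"
        unfolding q_def power2_norm_eq_inner
        by (simp add: inner_add_left inner_add_right inner_commute power2_eq_square algebra_simps)
      then show ?thesis by (metis power_mult mult_2 numeral_Bit0)
    qed
    define f where "f s = - u (y + s *\<^sub>R v, t) - K * (q s)\<^sup>2" for s
    define f' where "f' s = - (grad u (y + s *\<^sub>R v, t) \<bullet> v)
        - K * (2 * q s * (2 * (z \<bullet> v) + 2 * s * (v \<bullet> v)))" for s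
    have q': "(q has_real_derivative 2 * (z \<bullet> v) + 2 * s * (v \<bullet> v)) (at s)" for s
      unfolding q_def by (auto intro!: derivative_eq_intros)
    have "f' 0 = 0 \<and> - qform (hess u (y, t)) v
        - K * (8 * (z \<bullet> v)\<^sup>2 + 4 * (z \<bullet> z) * (v \<bullet> v)) \<le> 0"
    proof (rule second_derivative_test)
      show "(f has_real_derivative f' s) (at s)" for s
        unfolding f_def f'_def using C21_line(1)[OF u t, of y v s] q'[of s]
        by (auto intro!: derivative_eq_intros)
      show "(f' has_real_derivative - qform (hess u (y, t)) v
          - K * (8 * (z \<bullet> v)\<^sup>2 + 4 * (z \<bullet> z) * (v \<bullet> v))) (at 0)"
        unfolding f'_def using C21_line(2)[OF u t, of y v 0] q'[of 0]
        by (auto intro!: derivative_eq_intros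
            simp: q_def power2_eq_square algebra_simps)
      show "f s \<le> f 0" for s
        using min[of "y + s *\<^sub>R v"] nq[of s] nq[of 0] by (simp add: f_def)
    qed
    then show ?thesis by (simp add: f'_def q_def)
  qed
  show "grad u (y, t) = - ((4 * K * (norm (y - a))\<^sup>2) *\<^sub>R (y - a))"
  proof (rule vector_eq_rdot[THEN iffD1], intro allI)
    show "grad u (y, t) \<bullet> v = - ((4 * K * (norm (y - a))\<^sup>2) *\<^sub>R (y - a)) \<bullet> v" for v
      using *[of v] by (simp add: z_def power2_norm_eq_inner)
  qed
  have "(z \<bullet> v)\<^sup>2 \<le> (norm z)\<^sup>2 * (norm v)\<^sup>2"
    using Cauchy_Schwarz_ineq[of z v] by (simp add: power2_norm_eq_inner)
  then have "K * (8 * (z \<bullet> v)\<^sup>2 + 4 * (norm z)\<^sup>2 * (norm v)\<^sup>2)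
      \<le> K * (12 * ((norm z)\<^sup>2 * (norm v)\<^sup>2))"
    using K by (intro mult_left_mono) (auto simp: mult_ac)
  then show "- (12 * K * (norm (y - a))\<^sup>2 * (norm v)\<^sup>2) \<le> qform (hess u (y, t)) v"
    using *[of v] unfolding z_def power2_norm_eq_inner by (simp add: mult_ac)
qed

text \<open>With \<open>r = |x - y|\<close> the gradient of the penalty \<open>K |x - y|\<^sup>4\<close> has norm \<open>4 K r\<^sup>3\<close> and its Hessian
  is of order \<open>K r\<^sup>2\<close>; the errors caused by regularization are this Hessian times \<open>\<epsilon> / |p|\<^sub>\<epsilon>\<close>,
  which is small uniformly in \<open>r\<close>.\<close>

lemma quartic_error_small:
  fixes K \<eta> :: real
  assumes K: "0 < K" and \<eta>: "0 < \<eta>"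
  obtains \<epsilon>0 where "0 < \<epsilon>0"
    "\<And>\<epsilon> r (p :: real ^ 'n::finite).
      0 < \<epsilon> \<Longrightarrow> \<epsilon> < \<epsilon>0 \<Longrightarrow> 0 \<le> r \<Longrightarrow> norm p = 4 * K * r ^ 3 \<Longrightarrow> K * r\<^sup>2 * \<epsilon> \<le> \<eta> * norm_eps \<epsilon> p"
proof
  \<comment> \<open>The radius at which K r^2 reaches \<eta>. For smaller r this is combined with
    \<epsilon> \<le> |p|_\<epsilon>; for larger r the condition \<epsilon> < 4\<rho>\<eta> lets
    \<eta>|p| = 4K r^3 \<eta> dominate.\<close>
  define \<rho> where "\<rho> = sqrt (\<eta> / K)"
  have \<rho>: "0 < \<rho>" "K * \<rho>\<^sup>2 = \<eta>" using K \<eta> by (auto simp: \<rho>_def)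
  show "0 < 4 * \<rho> * \<eta>" using \<rho> \<eta> by simp
  fix \<epsilon> r and p :: "real ^ 'n"
  assume \<epsilon>: "0 < \<epsilon>" "\<epsilon> < 4 * \<rho> * \<eta>" and r: "0 \<le> r" and p: "norm p = 4 * K * r ^ 3"
  show "K * r\<^sup>2 * \<epsilon> \<le> \<eta> * norm_eps \<epsilon> p"
  proof (cases "r \<le> \<rho>")
    case True
    then have "r\<^sup>2 \<le> \<rho>\<^sup>2" using r by (intro power_mono)
    then have "K * r\<^sup>2 \<le> \<eta>" using K \<rho>(2) by (metis mult_left_mono less_imp_le)
    then show ?thesis using norm_eps_ge[of \<epsilon> p] \<epsilon> \<eta> by (intro mult_mono) auto
  next
    case False
    have "K * r\<^sup>2 * \<epsilon> \<le> K * r\<^sup>2 * (4 * \<rho> * \<eta>)" using \<epsilon> K by (intro mult_left_mono) auto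
    also have "\<dots> \<le> K * r\<^sup>2 * (4 * r * \<eta>)"
      using False K \<eta> by (intro mult_left_mono mult_right_mono) auto
    also have "\<dots> = \<eta> * norm p" by (simp add: p power2_eq_square power3_eq_cube)
    also have "\<dots> \<le> \<eta> * norm_eps \<epsilon> p" using \<eta> norm_le_norm_eps by (intro mult_left_mono) auto
    finally show ?thesis .
  qed
qed

lemma norm_quartic_gradient:
  "0 < K \<Longrightarrow> norm (- ((4 * K * (norm z)\<^sup>2) *\<^sub>R z)) = 4 * K * norm z ^ 3"
  by (simp add: power2_eq_square power3_eq_cube)

text \<open>At a penalized maximum of \<phi>(y) - u(x,t), a violation d of the obstacle at x
  produces the force |p|_\<epsilon> 4 d^3/\<epsilon>, which only the Hessian can balance. Hence d^3
  \<le> 3n K r^2 \<epsilon>/|p|_\<epsilon>, which is small uniformly in r. Doubling moves all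
  differentiation onto u, so continuity of \<phi> suffices, and \<epsilon>0 is independent of g and
  u.\<close>

lemma classical_solution_ge_obstacle:
  fixes \<phi> \<psi> :: "real ^ 'n::finite \<Rightarrow> real"
  assumes per: "periodic \<phi>" and cont: "continuous_on UNIV \<phi>" and lt: "\<And>x. \<phi> x < \<psi> x"
    and \<eta>: "0 < \<eta>"
  obtains \<epsilon>0 where "0 < \<epsilon>0"
    "\<And>\<epsilon> g u x t. 0 < \<epsilon> \<Longrightarrow> \<epsilon> < \<epsilon>0 \<Longrightarrow> classical_solution \<epsilon> \<phi> \<psi> g u \<Longrightarrow> (\<And>x. \<phi> x \<le> g x) \<Longrightarrow>
        0 \<le> t \<Longrightarrow> \<phi> x - \<eta> \<le> u (x, t)"
proof -
  define n where "n = real CARD('n)"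
  have n: "0 < n" by (simp add: n_def)
  obtain K where K: "0 < K" and mod: "\<And>x y. \<phi> x - \<phi> y - K * norm (x - y) ^ 4 \<le> \<eta> / 2"
    using periodic_quartic_modulus[OF per cont, of "\<eta> / 2"] \<eta> by (metis half_gt_zero order_refl)
  \<comment> \<open>Makes 3n \<eta>' = (\<eta>/2)^3, hence d \<le> \<eta>/2; the other half of
    \<eta> is spent on the modulus of \<phi>.\<close>
  define \<eta>' where "\<eta>' = (\<eta> / 2) ^ 3 / (3 * n)"
  have \<eta>': "0 < \<eta>'" using \<eta> n by (simp add: \<eta>'_def)
  obtain \<epsilon>0 where \<epsilon>0: "0 < \<epsilon>0" and err: "\<And>\<epsilon> r (p :: real ^ 'n). 0 < \<epsilon> \<Longrightarrow> \<epsilon> < \<epsilon>0 \<Longrightarrow> 0 \<le> r \<Longrightarrow>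
      norm p = 4 * K * r ^ 3 \<Longrightarrow> K * r\<^sup>2 * \<epsilon> \<le> \<eta>' * norm_eps \<epsilon> p"
    using quartic_error_small[OF K \<eta>', where ?'n = 'n] by blast
  show ?thesis
  proof (rule that[OF \<epsilon>0])
    fix \<epsilon> g u and X :: "real ^ 'n" and T :: real
    assume \<epsilon>: "0 < \<epsilon>" "\<epsilon> < \<epsilon>0" and u: "classical_solution \<epsilon> \<phi> \<psi> g u"
      and ge: "\<And>x. \<phi> x \<le> g x" and T: "0 \<le> T"
    have uC: "C21 u" and ucont: "continuous_on (UNIV \<times> {0..T}) u"
      and uper: "\<And>s. 0 \<le> s \<Longrightarrow> periodic (\<lambda>x. u (x, s))" and u0: "\<And>x. u (x, 0) = g x"
      using u by (auto simp: classical_solution_def intro: continuous_on_subset)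
    obtain xm sm where m: "\<And>x s. s \<in> {0..T} \<Longrightarrow> - u (x, s) \<le> - u (xm, sm)"
    proof (rule periodic_attains_max[of "{0..T}" 0 "\<lambda>z. - u z" T])
      show "continuous_on (UNIV \<times> {0..T}) (\<lambda>z. - u z)" by (intro continuous_intros ucont)
    qed (use T uper in \<open>auto simp: periodic_minus\<close>)
    obtain B where B: "\<And>x. \<bar>\<phi> x\<bar> \<le> B" using periodic_bounded[OF per cont] by blast
    \<comment> \<open>Time ranges over a compact interval here. The summand s added to - u cancels
      the time penalty with \<delta> = 1 that \<open>doubling_max\<close> imposes.\<close>
    obtain x y t where t: "t \<in> {0..T}" and max: "\<And>x' y' s. s \<in> {0..T} \<Longrightarrow>
        s - u (x', s) - - \<phi> y' - K * norm (x' - y') ^ 4 - 1 * s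
        \<le> t - u (x, t) - - \<phi> y - K * norm (x - y) ^ 4 - 1 * t"
    proof (rule doubling_max[of "{0..T}" "\<lambda>z. snd z - u z" "\<lambda>z. - \<phi> (fst z)" "T - u (xm, sm) + B" K 1])
      show "continuous_on (UNIV \<times> {0..T}) (\<lambda>z. snd z - u z)"
        by (intro continuous_intros ucont)
      show "continuous_on (UNIV \<times> {0..T}) (\<lambda>z. - \<phi> (fst z))"
        by (intro continuous_on_minus continuous_on_compose2[OF cont] continuous_intros) auto
      show "periodic (\<lambda>x. snd (x, s) - u (x, s))" if "s \<in> {0..T}" for s
        using uper[of s] that by (simp add: periodic_def)
      show "periodic (\<lambda>x. - \<phi> (fst (x, s)))" for s :: real
        using per by (simp add: periodic_def)
      show "snd (x, s) - u (x, s) - - \<phi> (fst (y, s)) \<le> T - u (xm, sm) + B"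
        if "s \<in> {0..T}" for x y s
        using m[OF that, of x] abs_ge_self[of "\<phi> y"] B[of y] that
        unfolding fst_conv snd_conv atLeastAtMost_iff by linarith
    qed (use T K in auto)
    have "\<phi> y - u (x, t) - K * norm (x - y) ^ 4 \<le> \<eta>"
    proof (cases "t = 0 \<or> \<phi> x \<le> u (x, t)")
      case True
      then have "\<phi> x \<le> u (x, t)" using ge u0 by auto
      then show ?thesis using mod[of y x] \<eta> by (simp add: norm_minus_commute)
    next
      case False
      then have t0: "0 < t" and below: "u (x, t) < \<phi> x" using t by auto
      define p where "p = grad u (x, t)"
      define r where "r = norm (x - y)"
      define d where "d = \<phi> x - u (x, t)"
      have touch: "u (x, t) + K * norm (x - y) ^ 4 \<le> u (y', t) + K * norm (y' - y) ^ 4" for y'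
        using max[OF t, of y' y] by linarith
      have np: "norm p = 4 * K * r ^ 3"
        unfolding p_def r_def quartic_touch(1)[OF uC t0 touch K] by (rule norm_quartic_gradient[OF K])
      have hess: "- (12 * K * r\<^sup>2 * (norm v)\<^sup>2) \<le> qform (hess u (x, t)) v" for v
        unfolding r_def by (rule quartic_touch(2)[OF uC t0 touch K])
      have "0 \<le> - dt u (x, t)"
        by (rule derivative_nonneg_at_right_end_max[OF DERIV_minus[OF C21_D(3)[OF uC t0]] t0])
          (use max[of _ x y] t in fastforce)
      then have "curv (p /\<^sub>R norm_eps \<epsilon> p) (hess u (x, t)) - norm_eps \<epsilon> p * deriv (V \<epsilon> \<phi> \<psi> x) (u (x, t)) \<le> 0"
        using classical_solution_eq[OF u t0, of x] by (simp add: p_def)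
      moreover have "deriv (V \<epsilon> \<phi> \<psi> x) (u (x, t)) = - (4 / \<epsilon> * d ^ 3)"
        unfolding deriv_V d_def using below lt[of x] by (simp add: max_def)
      moreover have "- (12 * K * r\<^sup>2 * n) \<le> curv (p /\<^sub>R norm_eps \<epsilon> p) (hess u (x, t))"
        unfolding n_def by (rule curv_lower_bound[OF norm_unit_eps _ hess]) (use K in simp)
      ultimately have "norm_eps \<epsilon> p * (4 / \<epsilon> * d ^ 3) \<le> 12 * K * r\<^sup>2 * n" by simp
      then have "norm_eps \<epsilon> p * d ^ 3 \<le> 3 * n * (K * r\<^sup>2 * \<epsilon>)"
        using \<epsilon> by (simp add: field_simps)
      also have "\<dots> \<le> 3 * n * (\<eta>' * norm_eps \<epsilon> p)"
        using err[OF \<epsilon> _ np] n by (intro mult_left_mono) (auto simp: r_def)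
      also have "\<dots> = norm_eps \<epsilon> p * (\<eta> / 2) ^ 3" using n by (simp add: \<eta>'_def)
      finally have "d ^ 3 \<le> (\<eta> / 2) ^ 3" using norm_eps_pos[OF \<epsilon>(1), of p] by simp
      then have "d \<le> \<eta> / 2" using \<eta> by (intro power_le_imp_le_base[of d 2]) (auto simp: numeral_3_eq_3 numeral_2_eq_2)
      then show ?thesis using mod[of y x] by (simp add: norm_minus_commute d_def)
    qed
    then show "\<phi> X - \<eta> \<le> u (X, T)"
      using max[of T X X] T by simp
  qed
qed

text \<open>The two functions are compared through a single second order object: for a fixed translation \<open>z\<close>,
  the shifted classical solution \<open>v(\<cdot> - z)\<close> touches \<open>w\<close> from above, so its Hessian enters the test of
  \<open>w\<close>, while the penalty bounds that Hessian from below. No lemma on sums of semijets is needed.\<close>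

lemma sub_jet_le_classical:
  fixes \<phi> \<psi> g :: "real ^ 'n::finite \<Rightarrow> real"
  assumes \<phi>: "periodic \<phi>" "continuous_on UNIV \<phi>" and \<psi>: "periodic \<psi>" "continuous_on UNIV \<psi>"
    and g: "periodic g" "continuous_on UNIV g"
    and lt: "\<And>x. \<phi> x < \<psi> x" and ge: "\<And>x. \<phi> x \<le> g x"
    and \<eta>: "0 < \<eta>" and \<delta>: "0 < \<delta>"
  obtains \<epsilon>0 where "0 < \<epsilon>0"
    "\<And>\<epsilon> \<epsilon>' w v x t. 0 \<le> \<epsilon> \<Longrightarrow> \<epsilon> \<le> \<epsilon>' \<Longrightarrow> 0 < \<epsilon>' \<Longrightarrow> \<epsilon>' < \<epsilon>0 \<Longrightarrow> classical_solution \<epsilon>' \<phi> \<psi> g v \<Longrightarrow>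
       sub_jet \<epsilon> \<phi> w \<Longrightarrow> continuous_on (UNIV \<times> {0..}) w \<Longrightarrow> (\<And>t. 0 \<le> t \<Longrightarrow> periodic (\<lambda>x. w (x, t))) \<Longrightarrow>
       (\<And>x. w (x, 0) \<le> g x) \<Longrightarrow> (\<And>x t. 0 \<le> t \<Longrightarrow> w (x, t) \<le> \<psi> x + \<eta>) \<Longrightarrow> 0 \<le> t \<Longrightarrow>
       w (x, t) - v (x, t) \<le> 2 * \<eta> + \<delta> * t"
proof -
  obtain K1 where K1: "\<And>K x y. K1 \<le> K \<Longrightarrow> \<phi> x - \<phi> y - K * norm (x - y) ^ 4 \<le> \<eta>" "0 < K1"
    by (rule periodic_quartic_modulus[OF \<phi> \<eta>]) blast
  obtain K2 where K2: "\<And>K x y. K2 \<le> K \<Longrightarrow> \<psi> x - \<psi> y - K * norm (x - y) ^ 4 \<le> \<eta>"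
    by (rule periodic_quartic_modulus[OF \<psi> \<eta>]) blast
  obtain K3 where K3: "\<And>K x y. K3 \<le> K \<Longrightarrow> g x - g y - K * norm (x - y) ^ 4 \<le> \<eta>"
    by (rule periodic_quartic_modulus[OF g \<eta>]) blast
  define K where "K = max K1 (max K2 K3)"
  have K: "0 < K" using K1(2) by (simp add: K_def)
  have mod: "\<phi> x - \<phi> y - K * norm (x - y) ^ 4 \<le> \<eta>" "\<psi> x - \<psi> y - K * norm (x - y) ^ 4 \<le> \<eta>"
    "g x - g y - K * norm (x - y) ^ 4 \<le> \<eta>" for x y
    by (auto intro!: K1 K2 K3 simp: K_def)
  obtain \<epsilon>1 where \<epsilon>1: "0 < \<epsilon>1" and obst: "\<And>\<epsilon> g u x t. 0 < \<epsilon> \<Longrightarrow> \<epsilon> < \<epsilon>1 \<Longrightarrow>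
      classical_solution \<epsilon> \<phi> \<psi> g u \<Longrightarrow> (\<And>x. \<phi> x \<le> g x) \<Longrightarrow> 0 \<le> t \<Longrightarrow> \<phi> x - \<eta> \<le> u (x, t)"
    by (rule classical_solution_ge_obstacle[OF \<phi> lt \<eta>]) blast
  \<comment> \<open>The factor 12 of the Hessian bound leaves a total error of \<delta>/2, strictly
    below \<delta>.\<close>
  have "0 < \<delta> / 24" using \<delta> by simp
  obtain \<epsilon>2 where \<epsilon>2: "0 < \<epsilon>2" and err: "\<And>\<epsilon> r (p :: real ^ 'n). 0 < \<epsilon> \<Longrightarrow> \<epsilon> < \<epsilon>2 \<Longrightarrow> 0 \<le> r \<Longrightarrow>
      norm p = 4 * K * r ^ 3 \<Longrightarrow> K * r\<^sup>2 * \<epsilon> \<le> \<delta> / 24 * norm_eps \<epsilon> p"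
    using quartic_error_small[OF K \<open>0 < \<delta> / 24\<close>, where ?'n = 'n] by blast
  show ?thesis
  proof (rule that[of "min \<epsilon>1 \<epsilon>2"])
    show "0 < min \<epsilon>1 \<epsilon>2" using \<epsilon>1 \<epsilon>2 by simp
    fix \<epsilon> \<epsilon>' w v and X :: "real ^ 'n" and T :: real
    assume \<epsilon>: "0 \<le> \<epsilon>" "\<epsilon> \<le> \<epsilon>'" "0 < \<epsilon>'" "\<epsilon>' < min \<epsilon>1 \<epsilon>2"
      and v: "classical_solution \<epsilon>' \<phi> \<psi> g v" and w: "sub_jet \<epsilon> \<phi> w"
      and wcont: "continuous_on (UNIV \<times> {0..}) w"
      and wper: "\<And>t. 0 \<le> t \<Longrightarrow> periodic (\<lambda>x. w (x, t))"
      and w0: "\<And>x. w (x, 0) \<le> g x" and w\<psi>: "\<And>x t. 0 \<le> t \<Longrightarrow> w (x, t) \<le> \<psi> x + \<eta>" and T: "0 \<le> T"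
    have vC: "C21 v" and vcont: "continuous_on (UNIV \<times> {0..}) v"
      and vper: "\<And>s. 0 \<le> s \<Longrightarrow> periodic (\<lambda>x. v (x, s))" and v0: "\<And>x. v (x, 0) = g x"
      using v by (auto simp: classical_solution_def)
    have v\<phi>: "\<phi> x - \<eta> \<le> v (x, t)" if "0 \<le> t" for x t
      using \<epsilon> ge that by (intro obst[OF _ _ v]) auto
    obtain B1 where B1: "\<And>x. \<bar>\<phi> x\<bar> \<le> B1" using periodic_bounded[OF \<phi>] by blast
    obtain B2 where B2: "\<And>x. \<bar>\<psi> x\<bar> \<le> B2" using periodic_bounded[OF \<psi>] by blast
    obtain x y t where t: "t \<in> {0..}" and max: "\<And>x' y' s. s \<in> {0..} \<Longrightarrow>
        w (x', s) - v (y', s) - K * norm (x' - y') ^ 4 - \<delta> * s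
        \<le> w (x, t) - v (y, t) - K * norm (x - y) ^ 4 - \<delta> * t"
    proof (rule doubling_max[of "{0..}" w v "B1 + B2 + 2 * \<eta>" K \<delta>])
      show "w (x, s) - v (y, s) \<le> B1 + B2 + 2 * \<eta>" if "s \<in> {0..}" for x y s
        using w\<psi>[of s x] v\<phi>[of s y] abs_le_D1[OF B2[of x]] abs_le_D2[OF B1[of y]] that by simp
    qed (use wcont wper vcont vper K \<delta> in auto)
    have t0: "0 \<le> t" using t by simp
    have "0 \<le> \<delta> * t" using t0 \<delta> by simp
    have "w (x, t) - v (y, t) - K * norm (x - y) ^ 4 - \<delta> * t \<le> 2 * \<eta>"
    proof -
      \<comment> \<open>In the first three cases the bound follows from the initial data or an
        obstacle: one \<eta> pays for the modulus and, in the obstacle cases, another for the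
        tolerated violation. In the fourth both penalizations have a favourable sign, and the
        equations give a contradiction.\<close>
      consider "t = 0" | "w (x, t) \<le> \<phi> x" | "\<psi> y < v (y, t)"
        | "0 < t" "\<phi> x < w (x, t)" "v (y, t) \<le> \<psi> y" using t0 by linarith
      then show ?thesis
      proof cases
        case 1
        then show ?thesis using w0[of x] v0[of y] mod(3)[of x y] \<eta> by simp
      next
        case 2
        then show ?thesis using v\<phi>[OF t0, of y] mod(1)[of x y] \<open>0 \<le> \<delta> * t\<close> by linarith
      next
        case 3
        then show ?thesis using w\<psi>[OF t0, of x] mod(2)[of x y] \<open>0 \<le> \<delta> * t\<close> by linarith
      next
        case 4
        define z where "z = y - x"
        define p where "p = grad v (y, t)"
        define Y where "Y = hess v (y, t)"
        have touch: "v (y, t) + K * norm (y - x) ^ 4 \<le> v (y', t) + K * norm (y' - x) ^ 4" for y'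
          using max[OF t, of x y'] by (simp add: norm_minus_commute)
        note qt = quartic_touch[OF vC 4(1) touch K]
        have p: "p = - ((4 * K * (norm z)\<^sup>2) *\<^sub>R z)" unfolding p_def z_def by (rule qt(1))
        have np: "norm p = 4 * K * norm z ^ 3"
          unfolding p by (rule norm_quartic_gradient[OF K])
        have hess: "- (12 * K * (norm z)\<^sup>2 * (norm \<xi>)\<^sup>2) \<le> qform Y \<xi>" for \<xi>
          unfolding z_def Y_def by (rule qt(2))
        have "superjet w x t (dt v (y, t) + \<delta>) p Y"
          unfolding superjet_def
        proof (intro allI impI)
          fix \<gamma> :: real assume "\<gamma> > 0"
          then have ev: "\<forall>\<^sub>F q in nhds (y, t). v q \<le> v (y, t) + p \<bullet> (fst q - y)
              + qform Y (fst q - y) / 2 + dt v (y, t) * (snd q - t)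
              + \<gamma> * ((norm (fst q - y))\<^sup>2 + \<bar>snd q - t\<bar>)"
            using C21_superjet[OF vC 4(1), of y] unfolding superjet_def case_prod_unfold p_def Y_def
            by simp
          have "((\<lambda>q. (fst q + z, snd q)) \<longlongrightarrow> (fst (x, t) + z, snd (x, t))) (nhds (x, t))"
            by (intro tendsto_intros filterlim_ident)
          then have lim: "((\<lambda>q. (fst q + z, snd q)) \<longlongrightarrow> (y, t)) (nhds (x, t))"
            by (simp add: z_def)
          have "open ((UNIV :: (real ^ 'n) set) \<times> {0<..} :: ((real ^ 'n) \<times> real) set)"
            by (intro open_Times) auto
          then have "\<forall>\<^sub>F q in nhds (x, t). q \<in> UNIV \<times> {0<..}"
            by (rule eventually_nhds_in_open) (use 4 in simp)
          with eventually_compose_filterlim[OF ev lim]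
          show "\<forall>\<^sub>F (x', s) in nhds (x, t). w (x', s) \<le> w (x, t) + p \<bullet> (x' - x)
              + qform Y (x' - x) / 2 + (dt v (y, t) + \<delta>) * (s - t)
              + \<gamma> * ((norm (x' - x))\<^sup>2 + \<bar>s - t\<bar>)"
          proof eventually_elim
            case (elim q)
            obtain x' s where q: "q = (x', s)" by fastforce
            have s: "s \<in> {0..}" using elim(2) by (simp add: q)
            have zy: "x' + z - y = x' - x" "x' - (x' + z) = x - y" by (auto simp: z_def)
            show ?case
              using elim(1) max[OF s, of x' "x' + z"]
              by (simp add: q zy distrib_right right_diff_distrib)
          qed
        qed
        then obtain \<zeta> where \<zeta>: "norm \<zeta> \<le> 1" "p \<noteq> 0 \<longrightarrow> \<zeta> = p /\<^sub>R norm_eps \<epsilon> p"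
          "dt v (y, t) + \<delta> \<le> curv \<zeta> Y"
          using w 4 unfolding sub_jet_def by blast
        define \<zeta>' where "\<zeta>' = p /\<^sub>R norm_eps \<epsilon>' p"
        have "deriv (V \<epsilon>' \<phi> \<psi> y) (v (y, t)) \<le> 0"
          unfolding deriv_V using 4(3) \<epsilon> by (simp add: max_def)
        then have "norm_eps \<epsilon>' p * deriv (V \<epsilon>' \<phi> \<psi> y) (v (y, t)) \<le> 0"
          using norm_eps_pos[OF \<epsilon>(3), of p] by (simp add: mult_le_0_iff)
        then have "curv \<zeta>' Y \<le> dt v (y, t)"
          using classical_solution_eq[OF v 4(1), of y] by (simp add: p_def Y_def \<zeta>'_def)
        \<comment> \<open>Both inequalities contract the same matrix \<open>Y\<close>, so its trace
          drops out.\<close>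
        with \<zeta>(3) have \<delta>_le: "\<delta> \<le> qform Y \<zeta>' - qform Y \<zeta>" unfolding curv_eq by linarith
        have False
        proof (cases "p = 0")
          case True
          then have "z = 0" using np K by simp
          then have "0 \<le> qform Y \<zeta>" using hess[of \<zeta>] by simp
          then show False using \<delta>_le \<delta> True by (simp add: \<zeta>'_def)
        next
          case False
          define P where "P = (norm p)\<^sup>2"
          define A where "A = \<epsilon>'\<^sup>2 + P"
          define D where "D = \<epsilon>\<^sup>2 + P"
          define H where "H = 12 * K * (norm z)\<^sup>2"
          have P: "0 < P" using False by (simp add: P_def)
          have H: "0 \<le> H" using K by (simp add: H_def)
          have "\<epsilon>\<^sup>2 \<le> \<epsilon>'\<^sup>2" using \<epsilon> by (intro power_mono) auto
          then have AD: "0 < D" "D \<le> A" using P by (auto simp: A_def D_def add_nonneg_pos)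
          have Q: "- (H * P) \<le> qform Y p" using hess[of p] by (simp add: H_def P_def)
          \<comment> \<open>This sign comes from \<epsilon> \<le> \<epsilon>' and is what makes the
            lower bound \<open>Q\<close> sufficient.\<close>
          have c: "0 \<le> 1 / D - 1 / A" using AD by (simp add: frac_le)
          have "qform Y \<zeta>' - qform Y \<zeta> = - (qform Y p * (1 / D - 1 / A))"
            using \<zeta>(2) False
            by (simp add: \<zeta>'_def qform_unit_eps A_def D_def P_def right_diff_distrib)
          also have "\<dots> \<le> H * P * (1 / D - 1 / A)"
            using mult_right_mono[OF Q c] by simp
          also have "\<dots> = H * (P / D - P / A)" by (simp add: right_diff_distrib)
          also have "\<dots> \<le> H * (\<epsilon>'\<^sup>2 / A)"
          proof (rule mult_left_mono[OF _ H])
            have "P / D \<le> 1" using AD by (simp add: D_def)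
            moreover have "P / A + \<epsilon>'\<^sup>2 / A = 1"
              using AD by (simp add: add_divide_distrib[symmetric] A_def)
            ultimately show "P / D - P / A \<le> \<epsilon>'\<^sup>2 / A" by linarith
          qed
          also have "\<dots> = 12 * (K * (norm z)\<^sup>2 * \<epsilon>' * \<epsilon>') / A"
            by (simp add: H_def power2_eq_square)
          also have "\<dots> \<le> 12 * (\<delta> / 24 * norm_eps \<epsilon>' p * norm_eps \<epsilon>' p) / A"
          proof -
            have 1: "K * (norm z)\<^sup>2 * \<epsilon>' \<le> \<delta> / 24 * norm_eps \<epsilon>' p"
              using \<epsilon> np by (intro err) auto
            have 2: "\<epsilon>' \<le> norm_eps \<epsilon>' p" using \<epsilon> by (intro norm_eps_ge) simp
            have 3: "0 \<le> \<delta> / 24 * norm_eps \<epsilon>' p"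
              using \<delta> norm_eps_pos[OF \<epsilon>(3), of p] by simp
            have "K * (norm z)\<^sup>2 * \<epsilon>' * \<epsilon>' \<le> \<delta> / 24 * norm_eps \<epsilon>' p * norm_eps \<epsilon>' p"
              by (rule mult_mono[OF 1 2 3]) (use \<epsilon>(3) in simp)
            then show ?thesis using AD by (intro divide_right_mono mult_left_mono) auto
          qed
          also have "\<dots> = \<delta> / 2 * ((norm_eps \<epsilon>' p)\<^sup>2 / A)" by (simp add: power2_eq_square)
          also have "\<dots> = \<delta> / 2" 
            unfolding norm_eps_sq P_def[symmetric] A_def[symmetric] using AD by simp
          finally show False using \<delta>_le \<delta> by simp
        qed
        then show ?thesis ..
      qed
    qed
    then show "w (X, T) - v (X, T) \<le> 2 * \<eta> + \<delta> * T"
      using max[of T X X] T by simp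
  qed
qed

lemma classical_solution_le:
  fixes u v :: "(real ^ 'n::finite) \<times> real \<Rightarrow> real"
  assumes u: "classical_solution \<epsilon> \<phi> \<psi> g u" and v: "classical_solution \<epsilon> \<phi> \<psi> g v" and \<epsilon>: "0 < \<epsilon>"
    and T: "0 \<le> T"
  shows "u (X, T) \<le> v (X, T)"
proof (rule field_le_epsilon)
  fix e :: real assume e: "0 < e"
  define \<delta> where "\<delta> = e / (T + 1)"
  have \<delta>: "0 < \<delta>" "\<delta> * T \<le> e" using e T by (auto simp: \<delta>_def field_simps)
  have uC: "C21 u" and ucont: "continuous_on (UNIV \<times> {0..T}) u"
    and uper: "\<And>s. 0 \<le> s \<Longrightarrow> periodic (\<lambda>x. u (x, s))" and u0: "\<And>x. u (x, 0) = g x"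
    using u by (auto simp: classical_solution_def intro: continuous_on_subset)
  have vC: "C21 v" and vcont: "continuous_on (UNIV \<times> {0..T}) v"
    and vper: "\<And>s. 0 \<le> s \<Longrightarrow> periodic (\<lambda>x. v (x, s))" and v0: "\<And>x. v (x, 0) = g x"
    using v by (auto simp: classical_solution_def intro: continuous_on_subset)
  obtain x t where t: "t \<in> {0..T}" and max: "\<And>y s. s \<in> {0..T} \<Longrightarrow>
      u (y, s) - v (y, s) - \<delta> * s \<le> u (x, t) - v (x, t) - \<delta> * t"
  proof (rule periodic_attains_max[of "{0..T}" 0 "\<lambda>z. u z - v z - \<delta> * snd z" T])
    show "continuous_on (UNIV \<times> {0..T}) (\<lambda>z. u z - v z - \<delta> * snd z)"
      by (intro continuous_intros ucont vcont)
    show "periodic (\<lambda>x. u (x, s) - v (x, s) - \<delta> * snd (x, s))" if "s \<in> {0..T}" for s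
      using uper[of s] vper[of s] that by (simp add: periodic_def)
  qed (use T in auto)
  have "0 \<le> \<delta> * t" using \<delta> t by simp
  have "u (x, t) - v (x, t) - \<delta> * t \<le> 0"
  proof (rule ccontr)
    assume "\<not> ?thesis"
    then have gt: "v (x, t) < u (x, t)" and "t \<noteq> 0" using \<open>0 \<le> \<delta> * t\<close> u0 v0 by auto
    then have t0: "0 < t" using t by simp
    have *: "grad u (x, t) \<bullet> \<xi> - grad v (x, t) \<bullet> \<xi> = 0 \<and>
        qform (hess u (x, t)) \<xi> - qform (hess v (x, t)) \<xi> \<le> 0" for \<xi>
    proof -
      have "grad u (x + 0 *\<^sub>R \<xi>, t) \<bullet> \<xi> - grad v (x + 0 *\<^sub>R \<xi>, t) \<bullet> \<xi> = 0 \<and>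
          qform (hess u (x + 0 *\<^sub>R \<xi>, t)) \<xi> - qform (hess v (x + 0 *\<^sub>R \<xi>, t)) \<xi> \<le> 0"
      proof (rule second_derivative_test[where f = "\<lambda>s. u (x + s *\<^sub>R \<xi>, t) - v (x + s *\<^sub>R \<xi>, t)"])
        show "u (x + s *\<^sub>R \<xi>, t) - v (x + s *\<^sub>R \<xi>, t) \<le> u (x + 0 *\<^sub>R \<xi>, t) - v (x + 0 *\<^sub>R \<xi>, t)" for s
          using max[OF t, of "x + s *\<^sub>R \<xi>"] by simp
      qed (intro DERIV_diff C21_line uC vC t0)+
      then show ?thesis by simp
    qed
    have grad: "grad v (x, t) = grad u (x, t)"
      by (rule vector_eq_rdot[THEN iffD1]) (use * in simp)
    define p where "p = grad u (x, t)"
    have hess: "curv (p /\<^sub>R norm_eps \<epsilon> p) (hess u (x, t)) \<le> curv (p /\<^sub>R norm_eps \<epsilon> p) (hess v (x, t))"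
      using * by (intro curv_mono norm_unit_eps) simp
    have "deriv (V \<epsilon> \<phi> \<psi> x) (v (x, t)) \<le> deriv (V \<epsilon> \<phi> \<psi> x) (u (x, t))"
      unfolding deriv_V using \<epsilon> gt by (intro mult_left_mono diff_mono power_mono) auto
    then have "norm_eps \<epsilon> p * deriv (V \<epsilon> \<phi> \<psi> x) (v (x, t)) \<le> norm_eps \<epsilon> p * deriv (V \<epsilon> \<phi> \<psi> x) (u (x, t))"
      using norm_eps_pos[OF \<epsilon>, of p] by (intro mult_left_mono) auto
    then have "dt u (x, t) \<le> dt v (x, t)"
      using classical_solution_eq[OF u t0, of x] classical_solution_eq[OF v t0, of x] hess
      by (simp add: grad p_def)
    moreover have "0 \<le> dt u (x, t) - dt v (x, t) - \<delta>"
    proof (rule derivative_nonneg_at_right_end_max[OF _ t0])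
      show "((\<lambda>s. u (x, s) - v (x, s) - \<delta> * s) has_real_derivative
          dt u (x, t) - dt v (x, t) - \<delta>) (at t)"
        using C21_D(3)[OF uC t0, of x] C21_D(3)[OF vC t0, of x]
        by (auto intro!: derivative_eq_intros)
    qed (use max t in auto)
    ultimately show False using \<delta> by linarith
  qed
  then show "u (X, T) \<le> v (X, T) + e" using max[of T X] T \<delta> by simp
qed

section \<open>Convergence\<close>

lemma sub_test_zero_of_classical_limit:
  fixes u :: "(real ^ 'n::finite) \<times> real \<Rightarrow> real"
  assumes sol: "\<And>k. classical_solution (\<epsilon> k) \<phi> \<psi> g (v k)" and pos: "\<And>k. 0 < \<epsilon> k"
    and \<epsilon>: "\<epsilon> \<longlonglongrightarrow> 0" and \<phi>: "continuous_on UNIV \<phi>" and u: "continuous_on (UNIV \<times> {0..}) u"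
    and lim: "\<And>T. uniform_limit (UNIV \<times> {0..T}) v u sequentially"
  shows "sub_test 0 \<phi> u"
proof (rule sub_jet_imp_sub_test, rule sub_test_limit)
  show "sub_test (\<epsilon> k) \<phi> (v k)" for k
    by (rule sub_jet_imp_sub_test[OF classical_sub_jet[OF sol pos]])
  show "continuous_on (UNIV \<times> {0<..}) (v k)" for k
    using sol[of k] by (auto simp: classical_solution_def intro: continuous_on_subset)
  show "continuous_on (UNIV \<times> {0<..}) u" by (rule continuous_on_subset[OF u]) auto
  fix K :: "((real ^ 'n) \<times> real) set" assume K: "compact K" "K \<subseteq> UNIV \<times> {0<..}"
  obtain B where B: "\<And>z. z \<in> K \<Longrightarrow> norm z \<le> B"
    using compact_imp_bounded[OF K(1)] by (auto simp: bounded_iff)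
  have "K \<subseteq> UNIV \<times> {0..B}"
  proof
    fix z assume z: "z \<in> K"
    then have "\<bar>snd z\<bar> \<le> B" using B[OF z] norm_snd_le[of "snd z" "fst z"] by simp
    then show "z \<in> UNIV \<times> {0..B}" using z K(2) by (cases z) auto
  qed
  then show "uniform_limit K v u sequentially" using lim uniform_limit_on_subset by blast
qed (fact \<epsilon> \<phi>)+

text \<open>Stability along the constant sequence, with \<epsilon> identically 0. Comparison needs
  this upgrade because it tests w with a translated classical solution.\<close>

lemma viscosity_subsolution_sub_jet:
  assumes "viscosity_subsolution \<phi> \<psi> w" "continuous_on UNIV \<phi>"
  shows "sub_jet 0 \<phi> w"
proof (rule sub_test_limit[where \<epsilon> = "\<lambda>_. 0" and wk = "\<lambda>_. w"])
  have "continuous_on (UNIV \<times> {0..}) w"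
    using assms by (auto simp: viscosity_subsolution_def admissible_def)
  then show "continuous_on (UNIV \<times> {0<..}) w" "continuous_on (UNIV \<times> {0<..}) w"
    by (auto intro: continuous_on_subset)
  show "uniform_limit K (\<lambda>_. w) w sequentially" for K by (rule uniform_limit_const)
qed (use assms in \<open>auto simp: viscosity_subsolution_iff\<close>)

text \<open>The comparison for w and for - w, with time slope \<eta>/(T + 1), so that its
  contribution up to T is at most the third \<eta>. Positive \<epsilon> will serve for the Cauchy
  property and \<epsilon> = 0 for uniqueness of the limit.\<close>

lemma two_sided_close_to_classical:
  fixes \<phi> \<psi> g :: "real ^ 'n::finite \<Rightarrow> real"
  assumes \<phi>: "periodic \<phi>" "continuous_on UNIV \<phi>" and \<psi>: "periodic \<psi>" "continuous_on UNIV \<psi>"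
    and g: "periodic g" "continuous_on UNIV g"
    and lt: "\<And>x. \<phi> x < \<psi> x" and between: "\<And>x. \<phi> x \<le> g x \<and> g x \<le> \<psi> x"
    and \<eta>: "0 < \<eta>" and T: "0 \<le> T"
  obtains \<epsilon>0 where "0 < \<epsilon>0"
    "\<And>\<epsilon> \<epsilon>' w v x t. 0 \<le> \<epsilon> \<Longrightarrow> \<epsilon> \<le> \<epsilon>' \<Longrightarrow> 0 < \<epsilon>' \<Longrightarrow> \<epsilon>' < \<epsilon>0 \<Longrightarrow> classical_solution \<epsilon>' \<phi> \<psi> g v \<Longrightarrow>
       sub_jet \<epsilon> \<phi> w \<Longrightarrow> sub_jet \<epsilon> (\<lambda>x. - \<psi> x) (\<lambda>z. - w z) \<Longrightarrow>
       continuous_on (UNIV \<times> {0..}) w \<Longrightarrow> (\<And>t. 0 \<le> t \<Longrightarrow> periodic (\<lambda>x. w (x, t))) \<Longrightarrow>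
       (\<And>x. w (x, 0) = g x) \<Longrightarrow> (\<And>x t. 0 \<le> t \<Longrightarrow> \<phi> x - \<eta> \<le> w (x, t) \<and> w (x, t) \<le> \<psi> x + \<eta>) \<Longrightarrow>
       0 \<le> t \<Longrightarrow> t \<le> T \<Longrightarrow> \<bar>w (x, t) - v (x, t)\<bar> \<le> 3 * \<eta>"
proof -
  define \<delta> where "\<delta> = \<eta> / (T + 1)"
  have \<delta>: "0 < \<delta>" and \<delta>T: "\<delta> * t \<le> \<eta>" if "0 \<le> t" "t \<le> T" for t
  proof -
    show "0 < \<delta>" using \<eta> T by (simp add: \<delta>_def)
    then have "\<delta> * t \<le> \<delta> * (T + 1)" using that by (intro mult_left_mono) auto
    also have "\<dots> = \<eta>" using T by (simp add: \<delta>_def)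
    finally show "\<delta> * t \<le> \<eta>" .
  qed
  have \<phi>': "periodic (\<lambda>x. - \<phi> x)" "continuous_on UNIV (\<lambda>x. - \<phi> x)"
    and \<psi>': "periodic (\<lambda>x. - \<psi> x)" "continuous_on UNIV (\<lambda>x. - \<psi> x)"
    and g': "periodic (\<lambda>x. - g x)" "continuous_on UNIV (\<lambda>x. - g x)"
    using \<phi> \<psi> g by (auto simp: periodic_minus intro: continuous_on_minus)
  have ge: "\<phi> x \<le> g x" and ge': "- \<psi> x \<le> - g x" and lt': "- \<psi> x < - \<phi> x" for x
    using lt[of x] between[of x] by auto
  obtain \<epsilon>1 where \<epsilon>1: "0 < \<epsilon>1" and up: "\<And>\<epsilon> \<epsilon>' w v x t. 0 \<le> \<epsilon> \<Longrightarrow> \<epsilon> \<le> \<epsilon>' \<Longrightarrow> 0 < \<epsilon>' \<Longrightarrow> \<epsilon>' < \<epsilon>1 \<Longrightarrow>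
       classical_solution \<epsilon>' \<phi> \<psi> g v \<Longrightarrow>
       sub_jet \<epsilon> \<phi> w \<Longrightarrow> continuous_on (UNIV \<times> {0..}) w \<Longrightarrow> (\<And>t. 0 \<le> t \<Longrightarrow> periodic (\<lambda>x. w (x, t))) \<Longrightarrow>
       (\<And>x. w (x, 0) \<le> g x) \<Longrightarrow> (\<And>x t. 0 \<le> t \<Longrightarrow> w (x, t) \<le> \<psi> x + \<eta>) \<Longrightarrow> 0 \<le> t \<Longrightarrow>
       w (x, t) - v (x, t) \<le> 2 * \<eta> + \<delta> * t"
    by (rule sub_jet_le_classical[OF \<phi> \<psi> g lt ge \<eta> \<delta>[OF order_refl T]]) blast
  obtain \<epsilon>2 where \<epsilon>2: "0 < \<epsilon>2" and low: "\<And>\<epsilon> \<epsilon>' w v x t. 0 \<le> \<epsilon> \<Longrightarrow> \<epsilon> \<le> \<epsilon>' \<Longrightarrow> 0 < \<epsilon>' \<Longrightarrow> \<epsilon>' < \<epsilon>2 \<Longrightarrow>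
       classical_solution \<epsilon>' (\<lambda>x. - \<psi> x) (\<lambda>x. - \<phi> x) (\<lambda>x. - g x) v \<Longrightarrow>
       sub_jet \<epsilon> (\<lambda>x. - \<psi> x) w \<Longrightarrow> continuous_on (UNIV \<times> {0..}) w \<Longrightarrow>
       (\<And>t. 0 \<le> t \<Longrightarrow> periodic (\<lambda>x. w (x, t))) \<Longrightarrow>
       (\<And>x. w (x, 0) \<le> - g x) \<Longrightarrow> (\<And>x t. 0 \<le> t \<Longrightarrow> w (x, t) \<le> - \<phi> x + \<eta>) \<Longrightarrow> 0 \<le> t \<Longrightarrow>
       w (x, t) - v (x, t) \<le> 2 * \<eta> + \<delta> * t"
    by (rule sub_jet_le_classical[OF \<psi>' \<phi>' g' lt' ge' \<eta> \<delta>[OF order_refl T]]) blast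
  show ?thesis
  proof (rule that[of "min \<epsilon>1 \<epsilon>2"])
    show "0 < min \<epsilon>1 \<epsilon>2" using \<epsilon>1 \<epsilon>2 by simp
    fix \<epsilon> \<epsilon>' w v and x :: "real ^ 'n" and t :: real
    assume \<epsilon>: "0 \<le> \<epsilon>" "\<epsilon> \<le> \<epsilon>'" "0 < \<epsilon>'" "\<epsilon>' < min \<epsilon>1 \<epsilon>2"
      and v: "classical_solution \<epsilon>' \<phi> \<psi> g v"
      and w: "sub_jet \<epsilon> \<phi> w" "sub_jet \<epsilon> (\<lambda>x. - \<psi> x) (\<lambda>z. - w z)"
      and cont: "continuous_on (UNIV \<times> {0..}) w" and per: "\<And>t. 0 \<le> t \<Longrightarrow> periodic (\<lambda>x. w (x, t))"
      and w0: "\<And>x. w (x, 0) = g x"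
      and bd: "\<And>x t. 0 \<le> t \<Longrightarrow> \<phi> x - \<eta> \<le> w (x, t) \<and> w (x, t) \<le> \<psi> x + \<eta>"
      and t: "0 \<le> t" "t \<le> T"
    have "w (x, t) - v (x, t) \<le> 2 * \<eta> + \<delta> * t"
      by (rule up[OF \<epsilon>(1-3) _ v w(1) cont per]) (use \<epsilon> w0 bd t in auto)
    moreover have "- w (x, t) - - v (x, t) \<le> 2 * \<eta> + \<delta> * t"
    proof (rule low[OF \<epsilon>(1-3) _ classical_solution_minus[OF v] w(2)])
      show "- w (y, s) \<le> - \<phi> y + \<eta>" if "0 \<le> s" for y s using bd[OF that, of y] by simp
    qed (use \<epsilon> w0 t per cont in \<open>auto simp: periodic_minus intro: continuous_on_minus\<close>)
    ultimately show "\<bar>w (x, t) - v (x, t)\<bar> \<le> 3 * \<eta>" using \<delta>T[OF t] by linarith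
  qed
qed

text \<open>The family of classical solutions is given, and its uniqueness is the first conjunct.
  Agreement of solutions is asserted for t \<ge> 0 only, values at negative times being
  arbitrary.\<close>

theorem theorem1p1:
  fixes g \<phi> \<psi> :: "real ^ 'n::finite \<Rightarrow> real"
    and u\<^sub>\<epsilon> :: "real \<Rightarrow> (real ^ 'n) \<times> real \<Rightarrow> real"
  assumes "periodic g" "C_k 2 g"
    and "periodic \<phi>" "C_k 1 \<phi>"
    and "periodic \<psi>" "C_k 1 \<psi>"
    and "\<And>x. \<phi> x < \<psi> x"
    and "\<And>x. \<phi> x \<le> g x \<and> g x \<le> \<psi> x"
    and "\<And>\<epsilon>. 0 < \<epsilon> \<Longrightarrow> \<epsilon> < 1 \<Longrightarrow> classical_solution \<epsilon> \<phi> \<psi> g (u\<^sub>\<epsilon> \<epsilon>)"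
  shows "(\<forall>\<epsilon> w. 0 < \<epsilon> \<and> \<epsilon> < 1 \<and> classical_solution \<epsilon> \<phi> \<psi> g w \<longrightarrow>
            (\<forall>x. \<forall>t\<ge>0. w (x, t) = u\<^sub>\<epsilon> \<epsilon> (x, t))) \<and>
         (\<exists>u. viscosity_solution \<phi> \<psi> u \<and> (\<forall>x. u (x, 0) = g x) \<and>
            (\<forall>w. viscosity_solution \<phi> \<psi> w \<and> (\<forall>x. w (x, 0) = g x) \<longrightarrow>
               (\<forall>x. \<forall>t\<ge>0. w (x, t) = u (x, t))) \<and>
            (\<forall>K. compact K \<and> K \<subseteq> UNIV \<times> {0..} \<longrightarrow> uniform_limit K u\<^sub>\<epsilon> u (at_right 0)))"
proof -
  note lt = assms(7) and between = assms(8) and sol = assms(9)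
  have \<phi>: "periodic \<phi>" "continuous_on UNIV \<phi>" and \<psi>: "periodic \<psi>" "continuous_on UNIV \<psi>"
    and g: "periodic g" "continuous_on UNIV g"
    using assms(1,3,5) C_k_imp_continuous[OF assms(2)] C_k_imp_continuous[OF assms(4)]
      C_k_imp_continuous[OF assms(6)] by simp_all
  have \<phi>': "periodic (\<lambda>x. - \<phi> x)" "continuous_on UNIV (\<lambda>x. - \<phi> x)"
    and \<psi>': "periodic (\<lambda>x. - \<psi> x)" "continuous_on UNIV (\<lambda>x. - \<psi> x)"
    using \<phi> \<psi> by (auto simp: periodic_minus intro: continuous_on_minus)
  note close = two_sided_close_to_classical[OF \<phi> \<psi> g lt between]

  have obst: "\<exists>\<epsilon>0>0. \<forall>\<epsilon>. 0 < \<epsilon> \<and> \<epsilon> < \<epsilon>0 \<and> \<epsilon> < 1 \<longrightarrow>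
      (\<forall>x. \<forall>t\<ge>0. \<phi> x - \<eta> \<le> u\<^sub>\<epsilon> \<epsilon> (x, t) \<and> u\<^sub>\<epsilon> \<epsilon> (x, t) \<le> \<psi> x + \<eta>)" if \<eta>: "0 < \<eta>" for \<eta>
  proof -
    obtain \<epsilon>1 where \<epsilon>1: "0 < \<epsilon>1" "\<And>\<epsilon> g u x t. 0 < \<epsilon> \<Longrightarrow> \<epsilon> < \<epsilon>1 \<Longrightarrow>
        classical_solution \<epsilon> \<phi> \<psi> g u \<Longrightarrow> (\<And>x. \<phi> x \<le> g x) \<Longrightarrow> 0 \<le> t \<Longrightarrow> \<phi> x - \<eta> \<le> u (x, t)"
      by (rule classical_solution_ge_obstacle[OF \<phi> lt \<eta>]) blast
    have lt': "- \<psi> x < - \<phi> x" for x using lt[of x] by simp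
    obtain \<epsilon>2 where \<epsilon>2: "0 < \<epsilon>2" "\<And>\<epsilon> g u x t. 0 < \<epsilon> \<Longrightarrow> \<epsilon> < \<epsilon>2 \<Longrightarrow>
        classical_solution \<epsilon> (\<lambda>x. - \<psi> x) (\<lambda>x. - \<phi> x) g u \<Longrightarrow> (\<And>x. - \<psi> x \<le> g x) \<Longrightarrow> 0 \<le> t \<Longrightarrow>
        - \<psi> x - \<eta> \<le> u (x, t)"
      by (rule classical_solution_ge_obstacle[OF \<psi>' lt' \<eta>]) blast
    show ?thesis
    proof (intro exI[of _ "min \<epsilon>1 \<epsilon>2"] conjI allI impI)
      fix \<epsilon> x and t :: real assume \<epsilon>: "0 < \<epsilon> \<and> \<epsilon> < min \<epsilon>1 \<epsilon>2 \<and> \<epsilon> < 1" and t: "0 \<le> t"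
      then have s: "classical_solution \<epsilon> \<phi> \<psi> g (u\<^sub>\<epsilon> \<epsilon>)" by (intro sol) auto
      show "\<phi> x - \<eta> \<le> u\<^sub>\<epsilon> \<epsilon> (x, t)"
        by (rule \<epsilon>1(2)[OF _ _ s]) (use \<epsilon> t between in auto)
      have "- \<psi> x - \<eta> \<le> - u\<^sub>\<epsilon> \<epsilon> (x, t)"
        by (rule \<epsilon>2(2)[OF _ _ classical_solution_minus[OF s]]) (use \<epsilon> t between in auto)
      then show "u\<^sub>\<epsilon> \<epsilon> (x, t) \<le> \<psi> x + \<eta>" by simp
    qed (use \<epsilon>1 \<epsilon>2 in auto)
  qed

  \<comment> \<open>The solution with the smaller parameter acts as w, being both a subsolution and,
    after reflection, a supersolution in the jet sense; the other one is v.\<close>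
  have cauchy: "\<exists>\<epsilon>0>0. \<forall>\<epsilon> \<epsilon>'. 0 < \<epsilon> \<and> \<epsilon> < \<epsilon>0 \<and> \<epsilon> < 1 \<and> 0 < \<epsilon>' \<and> \<epsilon>' < \<epsilon>0 \<and> \<epsilon>' < 1 \<longrightarrow>
      (\<forall>x t. 0 \<le> t \<and> t \<le> T \<longrightarrow> \<bar>u\<^sub>\<epsilon> \<epsilon> (x, t) - u\<^sub>\<epsilon> \<epsilon>' (x, t)\<bar> \<le> e)" if e: "0 < e" and T: "0 \<le> T" for e T
  proof -
    have \<eta>: "0 < e / 3" using e by simp
    obtain \<epsilon>1 where \<epsilon>1: "0 < \<epsilon>1" and b: "\<And>\<epsilon>. 0 < \<epsilon> \<and> \<epsilon> < \<epsilon>1 \<and> \<epsilon> < 1 \<Longrightarrow>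
        \<forall>x. \<forall>t\<ge>0. \<phi> x - e / 3 \<le> u\<^sub>\<epsilon> \<epsilon> (x, t) \<and> u\<^sub>\<epsilon> \<epsilon> (x, t) \<le> \<psi> x + e / 3"
      using obst[OF \<eta>] by blast
    obtain \<epsilon>2 where \<epsilon>2: "0 < \<epsilon>2" and c: "\<And>\<epsilon> \<epsilon>' w v x t. 0 \<le> \<epsilon> \<Longrightarrow> \<epsilon> \<le> \<epsilon>' \<Longrightarrow> 0 < \<epsilon>' \<Longrightarrow> \<epsilon>' < \<epsilon>2 \<Longrightarrow>
       classical_solution \<epsilon>' \<phi> \<psi> g v \<Longrightarrow>
       sub_jet \<epsilon> \<phi> w \<Longrightarrow> sub_jet \<epsilon> (\<lambda>x. - \<psi> x) (\<lambda>z. - w z) \<Longrightarrow>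
       continuous_on (UNIV \<times> {0..}) w \<Longrightarrow> (\<And>t. 0 \<le> t \<Longrightarrow> periodic (\<lambda>x. w (x, t))) \<Longrightarrow>
       (\<And>x. w (x, 0) = g x) \<Longrightarrow>
       (\<And>x t. 0 \<le> t \<Longrightarrow> \<phi> x - e / 3 \<le> w (x, t) \<and> w (x, t) \<le> \<psi> x + e / 3) \<Longrightarrow>
       0 \<le> t \<Longrightarrow> t \<le> T \<Longrightarrow> \<bar>w (x, t) - v (x, t)\<bar> \<le> 3 * (e / 3)"
      by (rule close[OF \<eta> T]) blast
    have ordered: "\<bar>u\<^sub>\<epsilon> \<epsilon> (x, t) - u\<^sub>\<epsilon> \<epsilon>' (x, t)\<bar> \<le> e"
      if "0 < \<epsilon>" "\<epsilon> \<le> \<epsilon>'" "\<epsilon>' < min \<epsilon>1 \<epsilon>2" "\<epsilon>' < 1" "0 \<le> t" "t \<le> T" for \<epsilon> \<epsilon>' x t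
    proof -
      have s: "classical_solution \<epsilon> \<phi> \<psi> g (u\<^sub>\<epsilon> \<epsilon>)" "classical_solution \<epsilon>' \<phi> \<psi> g (u\<^sub>\<epsilon> \<epsilon>')"
        using that by (auto intro: sol)
      have "\<bar>u\<^sub>\<epsilon> \<epsilon> (x, t) - u\<^sub>\<epsilon> \<epsilon>' (x, t)\<bar> \<le> 3 * (e / 3)"
      proof (rule c[where \<epsilon> = \<epsilon> and \<epsilon>' = \<epsilon>', OF _ _ _ _ s(2)])
        show "sub_jet \<epsilon> \<phi> (u\<^sub>\<epsilon> \<epsilon>)" using that by (intro classical_sub_jet[OF s(1)])
        show "sub_jet \<epsilon> (\<lambda>x. - \<psi> x) (\<lambda>z. - u\<^sub>\<epsilon> \<epsilon> z)"
          using that by (intro classical_sub_jet[OF classical_solution_minus[OF s(1)]])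
        show "\<phi> x - e / 3 \<le> u\<^sub>\<epsilon> \<epsilon> (x, t) \<and> u\<^sub>\<epsilon> \<epsilon> (x, t) \<le> \<psi> x + e / 3" if "0 \<le> t" for x t
          using b[of \<epsilon>] \<open>0 < \<epsilon>\<close> \<open>\<epsilon> \<le> \<epsilon>'\<close> \<open>\<epsilon>' < min \<epsilon>1 \<epsilon>2\<close> \<open>\<epsilon>' < 1\<close> that by auto
      qed (use s(1) that in \<open>auto simp: classical_solution_def\<close>)
      then show ?thesis by simp
    qed
    show ?thesis
    proof (intro exI[of _ "min \<epsilon>1 \<epsilon>2"] conjI allI impI)
      fix \<epsilon> \<epsilon>' x t
      assume *: "0 < \<epsilon> \<and> \<epsilon> < min \<epsilon>1 \<epsilon>2 \<and> \<epsilon> < 1 \<and> 0 < \<epsilon>' \<and> \<epsilon>' < min \<epsilon>1 \<epsilon>2 \<and> \<epsilon>' < 1" "0 \<le> t \<and> t \<le> T"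
      show "\<bar>u\<^sub>\<epsilon> \<epsilon> (x, t) - u\<^sub>\<epsilon> \<epsilon>' (x, t)\<bar> \<le> e"
      proof (cases "\<epsilon> \<le> \<epsilon>'")
        case True
        then show ?thesis using * by (intro ordered) auto
      next
        case False
        then have "\<bar>u\<^sub>\<epsilon> \<epsilon>' (x, t) - u\<^sub>\<epsilon> \<epsilon> (x, t)\<bar> \<le> e" using * by (intro ordered) auto
        then show ?thesis by (simp add: abs_minus_commute)
      qed
    qed (use \<epsilon>1 \<epsilon>2 in auto)
  qed

  \<comment> \<open>The sequence starts at 1/2, since classical solutions are given only for
    parameters strictly below 1.\<close>
  define \<epsilon> :: "nat \<Rightarrow> real" where "\<epsilon> k = inverse (real (Suc (Suc k)))" for k
  have \<epsilon>: "0 < \<epsilon> k" "\<epsilon> k < 1" for k by (auto simp: \<epsilon>_def field_simps)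
  have \<epsilon>0: "\<epsilon> \<longlonglongrightarrow> 0"
    unfolding \<epsilon>_def using LIMSEQ_Suc[OF LIMSEQ_inverse_real_of_nat] by simp
  have \<epsilon>_small: "\<forall>\<^sub>F k in sequentially. \<epsilon> k < \<epsilon>1" if "0 < \<epsilon>1" for \<epsilon>1
    using order_tendstoD(2)[OF \<epsilon>0 that] .
  define u where "u z = lim (\<lambda>k. u\<^sub>\<epsilon> (\<epsilon> k) z)" for z
  have pointwise: "(\<lambda>k. u\<^sub>\<epsilon> (\<epsilon> k) (x, t)) \<longlonglongrightarrow> u (x, t)" if t: "0 \<le> t" for x t
  proof -
    have "Cauchy (\<lambda>k. u\<^sub>\<epsilon> (\<epsilon> k) (x, t))"
    proof (rule metric_CauchyI)
      fix e :: real assume e: "0 < e"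
      then obtain \<epsilon>1 where \<epsilon>1: "0 < \<epsilon>1" and c: "\<And>\<epsilon> \<epsilon>' x s. 0 < \<epsilon> \<and> \<epsilon> < \<epsilon>1 \<and> \<epsilon> < 1 \<and> 0 < \<epsilon>' \<and> \<epsilon>' < \<epsilon>1 \<and> \<epsilon>' < 1
          \<Longrightarrow> 0 \<le> s \<and> s \<le> t \<Longrightarrow> \<bar>u\<^sub>\<epsilon> \<epsilon> (x, s) - u\<^sub>\<epsilon> \<epsilon>' (x, s)\<bar> \<le> e / 2"
        using cauchy[of "e / 2" t] t by (metis half_gt_zero)
      obtain N where N: "\<And>k. k \<ge> N \<Longrightarrow> \<epsilon> k < \<epsilon>1"
        using \<epsilon>_small[OF \<epsilon>1] by (auto simp: eventually_sequentially)
      show "\<exists>N. \<forall>m\<ge>N. \<forall>n\<ge>N. dist (u\<^sub>\<epsilon> (\<epsilon> m) (x, t)) (u\<^sub>\<epsilon> (\<epsilon> n) (x, t)) < e"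
      proof (intro exI[of _ N] allI impI)
        fix m n assume "m \<ge> N" "n \<ge> N"
        then have "\<bar>u\<^sub>\<epsilon> (\<epsilon> m) (x, t) - u\<^sub>\<epsilon> (\<epsilon> n) (x, t)\<bar> \<le> e / 2"
          using \<epsilon> N t by (intro c) auto
        then show "dist (u\<^sub>\<epsilon> (\<epsilon> m) (x, t)) (u\<^sub>\<epsilon> (\<epsilon> n) (x, t)) < e" using e by (simp add: dist_norm)
      qed
    qed
    then show ?thesis
      unfolding u_def by (simp add: Cauchy_convergent_iff convergent_LIMSEQ_iff)
  qed
  \<comment> \<open>Holding \<epsilon>' fixed and letting k tend to infinity in the Cauchy estimate
    gives convergence along the full parameter, not just along the chosen sequence.\<close>
  have conv: "\<exists>\<epsilon>0>0. \<forall>\<epsilon>. 0 < \<epsilon> \<and> \<epsilon> < \<epsilon>0 \<and> \<epsilon> < 1 \<longrightarrow>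
      (\<forall>x t. 0 \<le> t \<and> t \<le> T \<longrightarrow> \<bar>u\<^sub>\<epsilon> \<epsilon> (x, t) - u (x, t)\<bar> \<le> e)" if e: "0 < e" and T: "0 \<le> T" for e T
  proof -
    obtain \<epsilon>1 where \<epsilon>1: "0 < \<epsilon>1" and c: "\<And>\<epsilon> \<epsilon>' x s. 0 < \<epsilon> \<and> \<epsilon> < \<epsilon>1 \<and> \<epsilon> < 1 \<and> 0 < \<epsilon>' \<and> \<epsilon>' < \<epsilon>1 \<and> \<epsilon>' < 1
          \<Longrightarrow> 0 \<le> s \<and> s \<le> T \<Longrightarrow> \<bar>u\<^sub>\<epsilon> \<epsilon> (x, s) - u\<^sub>\<epsilon> \<epsilon>' (x, s)\<bar> \<le> e"
      using cauchy[OF e T] by metis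
    show ?thesis
    proof (intro exI[of _ \<epsilon>1] conjI allI impI)
      fix \<epsilon>' x t assume *: "0 < \<epsilon>' \<and> \<epsilon>' < \<epsilon>1 \<and> \<epsilon>' < 1" "0 \<le> t \<and> t \<le> T"
      have "(\<lambda>k. \<bar>u\<^sub>\<epsilon> \<epsilon>' (x, t) - u\<^sub>\<epsilon> (\<epsilon> k) (x, t)\<bar>) \<longlonglongrightarrow> \<bar>u\<^sub>\<epsilon> \<epsilon>' (x, t) - u (x, t)\<bar>"
        using * by (intro tendsto_intros pointwise) auto
      moreover have "\<forall>\<^sub>F k in sequentially. \<bar>u\<^sub>\<epsilon> \<epsilon>' (x, t) - u\<^sub>\<epsilon> (\<epsilon> k) (x, t)\<bar> \<le> e"
        using \<epsilon>_small[OF \<epsilon>1] by eventually_elim (use * \<epsilon> in \<open>auto intro!: c\<close>)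
      ultimately show "\<bar>u\<^sub>\<epsilon> \<epsilon>' (x, t) - u (x, t)\<bar> \<le> e"
        by (rule tendsto_upperbound) simp
    qed (fact \<epsilon>1)
  qed
  have unif: "uniform_limit (UNIV \<times> {0..T}) (\<lambda>k. u\<^sub>\<epsilon> (\<epsilon> k)) u sequentially" for T
  proof (cases "0 \<le> T")
    case True
    show ?thesis
      unfolding uniform_limit_iff
    proof (intro allI impI)
      fix e :: real assume e: "0 < e"
      then obtain \<epsilon>1 where \<epsilon>1: "0 < \<epsilon>1" and c: "\<And>\<epsilon> x s. 0 < \<epsilon> \<and> \<epsilon> < \<epsilon>1 \<and> \<epsilon> < 1
          \<Longrightarrow> 0 \<le> s \<and> s \<le> T \<Longrightarrow> \<bar>u\<^sub>\<epsilon> \<epsilon> (x, s) - u (x, s)\<bar> \<le> e / 2"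
        using conv[OF _ True, of "e / 2"] by (metis half_gt_zero)
      show "\<forall>\<^sub>F k in sequentially. \<forall>z\<in>UNIV \<times> {0..T}. dist (u\<^sub>\<epsilon> (\<epsilon> k) z) (u z) < e"
        using \<epsilon>_small[OF \<epsilon>1]
      proof eventually_elim
        case (elim k)
        show ?case
        proof (clarsimp simp: dist_norm)
          fix x and t :: real assume "0 \<le> t" "t \<le> T"
          then have "\<bar>u\<^sub>\<epsilon> (\<epsilon> k) (x, t) - u (x, t)\<bar> \<le> e / 2" using elim \<epsilon> by (intro c) auto
          then show "\<bar>u\<^sub>\<epsilon> (\<epsilon> k) (x, t) - u (x, t)\<bar> < e" using e by simp
        qed
      qed
    qed
  qed (simp add: uniform_limit_iff)
  have sol\<epsilon>: "classical_solution (\<epsilon> k) \<phi> \<psi> g (u\<^sub>\<epsilon> (\<epsilon> k))" for k using \<epsilon> by (intro sol)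
  have sol\<epsilon>': "continuous_on (UNIV \<times> {0..}) (u\<^sub>\<epsilon> (\<epsilon> k))" "u\<^sub>\<epsilon> (\<epsilon> k) (x, 0) = g x"
    "0 \<le> t \<Longrightarrow> periodic (\<lambda>x. u\<^sub>\<epsilon> (\<epsilon> k) (x, t))" for k x t
    using sol\<epsilon>[of k] by (simp_all add: classical_solution_def)
  have u_cont_T: "continuous_on (UNIV \<times> {0..T}) u" for T
  proof (rule uniform_limit_theorem[OF _ unif])
    show "\<forall>\<^sub>F k in sequentially. continuous_on (UNIV \<times> {0..T}) (u\<^sub>\<epsilon> (\<epsilon> k))"
      by (intro always_eventually allI continuous_on_subset[OF sol\<epsilon>'(1)]) auto
  qed simp
  have u_cont: "continuous_on (UNIV \<times> {0..}) u"
    unfolding continuous_on_eq_continuous_within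
  proof
    fix z :: "(real ^ 'n) \<times> real" assume z: "z \<in> UNIV \<times> {0..}"
    obtain x t where xt: "z = (x, t)" "0 \<le> t" using z by auto
    \<comment> \<open>Continuity is local in time: near (x, t) the half-space coincides with the
      slab up to t + 1, where the convergence is uniform.\<close>
    have "at z within UNIV \<times> {0..} = at z within UNIV \<times> {0..t + 1}"
      by (rule at_within_nhd[of _ "UNIV \<times> {..<t + 1}"]) (auto simp: xt intro: open_Times)
    moreover have "continuous (at z within UNIV \<times> {0..t + 1}) u"
      using u_cont_T[of "t + 1"] xt by (simp add: continuous_on_eq_continuous_within)
    ultimately show "continuous (at z within UNIV \<times> {0..}) u" by simp
  qed
  have u0: "u (x, 0) = g x" for x
    using pointwise[of 0 x] by (simp add: sol\<epsilon>' LIMSEQ_const_iff)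
  have u_per: "periodic (\<lambda>x. u (x, t))" if "0 \<le> t" for t
    using sol\<epsilon>'(3)[OF that] by (simp add: u_def periodic_def)
  have u_bd: "\<phi> x \<le> u (x, t) \<and> u (x, t) \<le> \<psi> x" if t: "0 \<le> t" for x t
  proof -
    have "\<phi> x - e \<le> u (x, t) \<and> u (x, t) \<le> \<psi> x + e" if e: "0 < e" for e
    proof -
      obtain \<epsilon>1 where \<epsilon>1: "0 < \<epsilon>1" and b: "\<And>\<epsilon>. 0 < \<epsilon> \<and> \<epsilon> < \<epsilon>1 \<and> \<epsilon> < 1 \<Longrightarrow>
          \<forall>x. \<forall>t\<ge>0. \<phi> x - e \<le> u\<^sub>\<epsilon> \<epsilon> (x, t) \<and> u\<^sub>\<epsilon> \<epsilon> (x, t) \<le> \<psi> x + e"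
        using obst[OF e] by blast
      have "\<forall>\<^sub>F k in sequentially. \<phi> x - e \<le> u\<^sub>\<epsilon> (\<epsilon> k) (x, t) \<and> u\<^sub>\<epsilon> (\<epsilon> k) (x, t) \<le> \<psi> x + e"
        using \<epsilon>_small[OF \<epsilon>1] by eventually_elim (use b \<epsilon> t in blast)
      then have lo: "\<forall>\<^sub>F k in sequentially. \<phi> x - e \<le> u\<^sub>\<epsilon> (\<epsilon> k) (x, t)"
        and hi: "\<forall>\<^sub>F k in sequentially. u\<^sub>\<epsilon> (\<epsilon> k) (x, t) \<le> \<psi> x + e"
        by (auto elim: eventually_mono)
      then show ?thesis
        using tendsto_lowerbound[OF pointwise[OF t] lo] tendsto_upperbound[OF pointwise[OF t] hi]
        by simp
    qed
    then have "\<phi> x \<le> u (x, t) + e" "u (x, t) \<le> \<psi> x + e" if "0 < e" for e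
      using that by (auto simp: diff_le_eq)
    then show ?thesis by (auto intro: field_le_epsilon)
  qed
  have "bounded (u ` (UNIV \<times> {0..}))"
  proof -
    obtain B1 where B1: "\<And>x. \<bar>\<phi> x\<bar> \<le> B1" using periodic_bounded[OF \<phi>] by blast
    obtain B2 where B2: "\<And>x. \<bar>\<psi> x\<bar> \<le> B2" using periodic_bounded[OF \<psi>] by blast
    have "\<bar>u (x, t)\<bar> \<le> B1 + B2" if "0 \<le> t" for x t
      using B1[of x] B2[of x] u_bd[OF that, of x] by linarith
    then show ?thesis unfolding bounded_iff by (intro exI[of _ "B1 + B2"]) auto
  qed
  then have adm: "admissible \<phi> \<psi> u"
    using u_per u_cont u_bd by (simp add: admissible_def)
  have sub: "viscosity_subsolution \<phi> \<psi> u"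
    unfolding viscosity_subsolution_iff
    using adm sub_test_zero_of_classical_limit[OF sol\<epsilon> \<epsilon>(1) \<epsilon>0 \<phi>(2) u_cont unif] by simp
  moreover have super: "viscosity_supersolution \<phi> \<psi> u"
    unfolding viscosity_supersolution_iff viscosity_subsolution_iff
  proof
    show "admissible (\<lambda>x. - \<psi> x) (\<lambda>x. - \<phi> x) (\<lambda>z. - u z)"
      using adm by (simp add: admissible_minus)
    show "sub_test 0 (\<lambda>x. - \<psi> x) (\<lambda>z. - u z)"
    proof (rule sub_test_zero_of_classical_limit[OF classical_solution_minus[OF sol\<epsilon>] \<epsilon>(1) \<epsilon>0 \<psi>'(2)])
      show "continuous_on (UNIV \<times> {0..}) (\<lambda>z. - u z)" by (rule continuous_on_minus[OF u_cont])
      show "uniform_limit (UNIV \<times> {0..T}) (\<lambda>k z. - u\<^sub>\<epsilon> (\<epsilon> k) z) (\<lambda>z. - u z) sequentially" for T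
        by (rule uniform_limit_uminus[OF unif])
    qed
  qed
  ultimately have visc: "viscosity_solution \<phi> \<psi> u" by (simp add: viscosity_solution_def)

  \<comment> \<open>Two viscosity solutions are never compared directly: each lies within e/2 of the
    same classical solution, with 3 (e/6) for w and \<open>conv\<close> for u.\<close>
  have unique: "w (x, t) = u (x, t)"
    if w: "viscosity_solution \<phi> \<psi> w" and w0: "\<And>x. w (x, 0) = g x" and t: "0 \<le> t" for w x t
  proof -
    have wsub: "viscosity_subsolution \<phi> \<psi> w"
      and wsuper: "viscosity_subsolution (\<lambda>x. - \<psi> x) (\<lambda>x. - \<phi> x) (\<lambda>z. - w z)"
      using w by (auto simp: viscosity_solution_def viscosity_supersolution_iff)
    have wadm: "admissible \<phi> \<psi> w" using wsub by (simp add: viscosity_subsolution_def)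
    have "\<bar>w (x, t) - u (x, t)\<bar> \<le> 0 + e" if e: "0 < e" for e
    proof -
      have \<eta>: "0 < e / 6" using e by simp
      obtain \<epsilon>1 where \<epsilon>1: "0 < \<epsilon>1" and c: "\<And>\<epsilon> \<epsilon>' w v x s. 0 \<le> \<epsilon> \<Longrightarrow> \<epsilon> \<le> \<epsilon>' \<Longrightarrow> 0 < \<epsilon>' \<Longrightarrow> \<epsilon>' < \<epsilon>1 \<Longrightarrow>
         classical_solution \<epsilon>' \<phi> \<psi> g v \<Longrightarrow>
         sub_jet \<epsilon> \<phi> w \<Longrightarrow> sub_jet \<epsilon> (\<lambda>x. - \<psi> x) (\<lambda>z. - w z) \<Longrightarrow>
         continuous_on (UNIV \<times> {0..}) w \<Longrightarrow> (\<And>t. 0 \<le> t \<Longrightarrow> periodic (\<lambda>x. w (x, t))) \<Longrightarrow>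
         (\<And>x. w (x, 0) = g x) \<Longrightarrow>
         (\<And>x t. 0 \<le> t \<Longrightarrow> \<phi> x - e / 6 \<le> w (x, t) \<and> w (x, t) \<le> \<psi> x + e / 6) \<Longrightarrow>
         0 \<le> s \<Longrightarrow> s \<le> t \<Longrightarrow> \<bar>w (x, s) - v (x, s)\<bar> \<le> 3 * (e / 6)"
        by (rule close[OF \<eta> t]) blast
      have "0 < e / 2" using e by simp
      from conv[OF this t] obtain \<epsilon>2 where \<epsilon>2: "0 < \<epsilon>2" and d: "\<And>\<epsilon> x s. 0 < \<epsilon> \<and> \<epsilon> < \<epsilon>2 \<and> \<epsilon> < 1
          \<Longrightarrow> 0 \<le> s \<and> s \<le> t \<Longrightarrow> \<bar>u\<^sub>\<epsilon> \<epsilon> (x, s) - u (x, s)\<bar> \<le> e / 2"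
        by metis
      have "\<forall>\<^sub>F k in sequentially. \<epsilon> k < \<epsilon>1 \<and> \<epsilon> k < \<epsilon>2"
        using \<epsilon>_small[OF \<epsilon>1] \<epsilon>_small[OF \<epsilon>2] by eventually_elim simp
      then obtain k where k: "\<epsilon> k < \<epsilon>1" "\<epsilon> k < \<epsilon>2"
        using eventually_happens'[OF sequentially_bot] by blast
      have "\<bar>w (x, t) - u\<^sub>\<epsilon> (\<epsilon> k) (x, t)\<bar> \<le> 3 * (e / 6)"
      proof (rule c[where \<epsilon> = 0 and \<epsilon>' = "\<epsilon> k", OF _ _ _ _ sol\<epsilon>])
        show "sub_jet 0 \<phi> w" by (rule viscosity_subsolution_sub_jet[OF wsub \<phi>(2)])
        show "sub_jet 0 (\<lambda>x. - \<psi> x) (\<lambda>z. - w z)"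
          by (rule viscosity_subsolution_sub_jet[OF wsuper \<psi>'(2)])
        show "\<phi> x - e / 6 \<le> w (x, t) \<and> w (x, t) \<le> \<psi> x + e / 6" if "0 \<le> t" for x t
        proof -
          have "\<phi> x \<le> w (x, t)" "w (x, t) \<le> \<psi> x" using wadm that by (auto simp: admissible_def)
          then show ?thesis using e by linarith
        qed
      qed (use wadm w0 k \<epsilon>[of k] t in \<open>auto simp: admissible_def\<close>)
      moreover have "\<bar>u\<^sub>\<epsilon> (\<epsilon> k) (x, t) - u (x, t)\<bar> \<le> e / 2"
        using k \<epsilon> t by (intro d) auto
      ultimately show ?thesis by linarith
    qed
    then have "\<bar>w (x, t) - u (x, t)\<bar> \<le> 0" by (rule field_le_epsilon)
    then show ?thesis by simp
  qed

  have locunif: "uniform_limit K u\<^sub>\<epsilon> u (at_right 0)" if K: "compact K" "K \<subseteq> UNIV \<times> {0..}" for K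
  proof -
    obtain B where B: "\<And>z. z \<in> K \<Longrightarrow> norm z \<le> B"
      using compact_imp_bounded[OF K(1)] by (auto simp: bounded_iff)
    define T where "T = max B 0"
    have T: "0 \<le> T" by (simp add: T_def)
    show ?thesis
      unfolding uniform_limit_iff
    proof (intro allI impI)
      fix e :: real assume e: "0 < e"
      then obtain \<epsilon>1 where \<epsilon>1: "0 < \<epsilon>1" and c: "\<And>\<epsilon> x s. 0 < \<epsilon> \<and> \<epsilon> < \<epsilon>1 \<and> \<epsilon> < 1
          \<Longrightarrow> 0 \<le> s \<and> s \<le> T \<Longrightarrow> \<bar>u\<^sub>\<epsilon> \<epsilon> (x, s) - u (x, s)\<bar> \<le> e / 2"
        using conv[OF _ T, of "e / 2"] by (metis half_gt_zero)
      show "\<forall>\<^sub>F \<epsilon> in at_right 0. \<forall>z\<in>K. dist (u\<^sub>\<epsilon> \<epsilon> z) (u z) < e"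
        unfolding eventually_at_right_field
      proof (intro exI[of _ "min \<epsilon>1 1"] conjI allI impI ballI)
        fix \<epsilon> z assume \<epsilon>: "0 < \<epsilon>" "\<epsilon> < min \<epsilon>1 1" and z: "z \<in> K"
        obtain x t where xt: "z = (x, t)" by fastforce
        have "\<bar>t\<bar> \<le> B" using B[OF z] norm_snd_le[of t x] by (simp add: xt)
        then have "\<bar>u\<^sub>\<epsilon> \<epsilon> (x, t) - u (x, t)\<bar> \<le> e / 2"
          using \<epsilon> z K(2) by (intro c) (auto simp: xt T_def)
        then show "dist (u\<^sub>\<epsilon> \<epsilon> z) (u z) < e" using e by (simp add: dist_norm xt)
      qed (use \<epsilon>1 in auto)
    qed
  qed

  show ?thesis
  proof (intro conjI)
    show "\<forall>\<epsilon> w. 0 < \<epsilon> \<and> \<epsilon> < 1 \<and> classical_solution \<epsilon> \<phi> \<psi> g w \<longrightarrow>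
        (\<forall>x. \<forall>t\<ge>0. w (x, t) = u\<^sub>\<epsilon> \<epsilon> (x, t))"
      using classical_solution_le sol by (metis order_antisym)
    show "\<exists>u. viscosity_solution \<phi> \<psi> u \<and> (\<forall>x. u (x, 0) = g x) \<and>
        (\<forall>w. viscosity_solution \<phi> \<psi> w \<and> (\<forall>x. w (x, 0) = g x) \<longrightarrow>
           (\<forall>x. \<forall>t\<ge>0. w (x, t) = u (x, t))) \<and>
        (\<forall>K. compact K \<and> K \<subseteq> UNIV \<times> {0..} \<longrightarrow> uniform_limit K u\<^sub>\<epsilon> u (at_right 0))"
    proof (intro exI[of _ u] conjI allI impI)
      show "w (x, t) = u (x, t)"
        if "viscosity_solution \<phi> \<psi> w \<and> (\<forall>x. w (x, 0) = g x)" "0 \<le> t" for w x t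
        using that by (intro unique) auto
      show "uniform_limit K u\<^sub>\<epsilon> u (at_right 0)" if "compact K \<and> K \<subseteq> UNIV \<times> {0..}" for K
        using that by (intro locunif) auto
    qed (fact visc u0)+
  qed
qed

end
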